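(* Let $\mathcal{A}$ be the cluster algebra of type $\Gamma=A_n$ ($n\ge1$), or $\Gamma=B_n$ or $C_n$ ($n\ge2$), with the special frozen variables coming from the polygon model. Set $$K(A_n)=\{E_i\mid i=1,\dots,n+3\},\qquad K(B_n)=\{E_i\mid i=1,\dots,n+1\},\qquad K(C_n)=\{E_i\mid i=1,\dots,n+1\}.$$ Then $K(\Gamma)$ is a basis of the lineality space of the Gröbner cone $\mathcal{C}_{\mathcal{A}}$ of $\mathcal{A}$.
   Context: **Cluster algebras and Gröbner cone.** Cluster algebras are of geometric type over a field $\mathbb{K}$ of characteristic zero, generated as $\mathbb{K}$-algebras by all cluster variables and all frozen variables (frozen variables are not inverted). Let $\mathcal{V}$ be the (finite) set of cluster variables and $\mathcal{W}$ the set of frozen variables. Let $\mathbb{K}[\mathbf{z}]=\mathbb{K}[z_v\mid v\in\mathcal{V}\cup\mathcal{W}]$, let $I_{\mathcal{A}}$ be the kernel of $\mathbb{K}[\mathbf{z}]\to\mathcal{A}$, $z_v\mapsto v$, and let $I_{\mathcal{A}}^{\times}$ be the ideal generated by all $z_vz_w$ with $v,w\in\mathcal{V}$ not in a common cluster. For $\omega\in\mathbb{R}^{\mathcal{V}\cup\mathcal{W}}$, $\mathrm{In}_\omega(f)$ is the sum of the terms of $f$ of maximal $\omega$-weight and $\mathrm{In}_\omega(I)=\langle\mathrm{In}_\omega(f):f\in I\rangle$. The Gröbner cone $\mathcal{C}_{\mathcal{A}}$ is the closure of $\{\omega\in\mathbb{R}^{\mathcal{V}\cup\mathcal{W}}:\mathrm{In}_\omega(I_{\mathcal{A}})=I_{\mathcal{A}}^{\times}\}$.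 **Polygon models (Fomin–Zelevinsky).** $\mathbf{P}_N$ is a regular $N$-gon with vertices $1,\dots,N$ (modulo $N$) labeled counterclockwise; $[i,j]$ denotes the edge or diagonal with endpoints $i,j$ (diagonals join non-adjacent vertices). For $N$ even, $\overline{i}$ is the vertex antipodal to $i$, $\overline{[i,j]}=[\overline i,\overline j]$, and a diameter is a diagonal $[i,\overline i]$. Type $A_n$, $n\ge1$, $N=n+3$: $\mathcal{A}$ is the cluster algebra of type $A_n$ whose cluster variables $x_l$ correspond to diagonals $l$ and frozen variables $x_l$ to edges $l$ of $\mathbf{P}_N$; clusters correspond to triangulations (maximal sets of non-crossing diagonals), and the exchange relations are $x_{[a,c]}x_{[b,d]}=x_{[a,b]}x_{[c,d]}+x_{[a,d]}x_{[b,c]}$ for crossing diagonals $[a,c],[b,d]$. Types $B_n,C_n$, $n\ge2$, $N=2n+2$: $\mathcal{A}$ is the cluster algebra of that type whose cluster variables $x_l=x_{\overline l}$ correspond to diagonal pairs $\{l,\overline l\}$ (a diameter is a degenerate pair, $l=\overline l$) and frozen variables to pairs of edges $\{l,\overline l\}$; clusters correspond to centrally symmetric triangulations. With $r=1$ in type $B_n$ and $r=2$ in type $C_n$, the exchange relations are exactly: $x_{[a,c]}x_{[b,d]}=x_{[a,b]}x_{[c,d]}+x_{[a,d]}x_{[b,c]}$ for $a,b,c,d,\overline a$ in counterclockwise order; $x_{[a,c]}x_{[a,\overline b]}=x_{[a,b]}x_{[a,\overline c]}+x_{[a,\overline a]}^{2/r}x_{[b,c]}$ for $a,b,c,\overline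 a$ in counterclockwise order; $x_{[a,\overline a]}x_{[b,\overline b]}=x_{[a,b]}^r+x_{[a,\overline b]}^r$ for $b\ne a,\overline a$. **The vectors $E_i$.** For a diagonal or edge $l$ in type $A_n$, a diameter $l$ in types $B_n,C_n$, or a diagonal or edge pair $L=\{l,\overline l\}$ in types $B_n,C_n$, let $e_l$ resp. $e_L$ be the corresponding standard basis vector of $\mathbb{R}^{\mathcal{V}\cup\mathcal{W}}$. In type $A_n$, $E_i=\sum e_l$ over all edges and diagonals $l$ incident to vertex $i$. In type $B_n$, $E_i=e_{[i,\overline i]}+\sum e_L$, the sum over all (non-diameter) diagonal pairs and edge pairs $L=\{l,\overline l\}$ such that $i$ is an endpoint of $l$ or $\overline l$. In type $C_n$, $E_i=2e_{[i,\overline i]}+\sum e_L$ with the same sum. *)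

theory Defs
  imports "HOL-Analysis.Analysis" "HOL-Analysis.Finite_Function_Topology" "HOL-Algebra.Ideal"
begin

section \<open>Polynomial rings\<close>

text \<open>
  Monomials are finitely supported exponent vectors of type \<open>'v \<Rightarrow>\<^sub>0 nat\<close>, and polynomials over
  \<open>'k\<close> are of type \<open>('v \<Rightarrow>\<^sub>0 nat) \<Rightarrow>\<^sub>0 'k\<close>.  The type \<open>'v\<close> is an arbitrary type of variable names;
  the ring \<open>K[z\<^sub>v | v \<in> S]\<close> is the subring of polynomials involving only variables from \<open>S\<close>.
\<close>

definition pvars :: "(('v \<Rightarrow>\<^sub>0 nat) \<Rightarrow>\<^sub>0 'k::zero) \<Rightarrow> 'v set" where
  "pvars p = (\<Union>\<mu>\<in>Poly_Mapping.keys p. Poly_Mapping.keys \<mu>)"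

definition poly_ring :: "'v set \<Rightarrow> (('v \<Rightarrow>\<^sub>0 nat) \<Rightarrow>\<^sub>0 'k::comm_ring_1) ring" where
  "poly_ring S = \<lparr>carrier = {p. pvars p \<subseteq> S}, mult = (*), one = 1, zero = 0, add = (+)\<rparr>"

definition pvar :: "'v \<Rightarrow> (('v \<Rightarrow>\<^sub>0 nat) \<Rightarrow>\<^sub>0 'k::comm_ring_1)" where
  "pvar v = Poly_Mapping.single (Poly_Mapping.single v 1) 1"

text \<open>Evaluation at \<open>g\<close>, with coefficients mapped along \<open>emb\<close>.\<close>

definition eval_poly :: "('k::field \<Rightarrow> 'f::field) \<Rightarrow> ('v \<Rightarrow> 'f) \<Rightarrow> (('v \<Rightarrow>\<^sub>0 nat) \<Rightarrow>\<^sub>0 'k) \<Rightarrow> 'f" where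
  "eval_poly emb g p =
     (\<Sum>\<mu>\<in>Poly_Mapping.keys p. emb (Poly_Mapping.lookup p \<mu>) *
        (\<Prod>v\<in>Poly_Mapping.keys \<mu>. g v ^ Poly_Mapping.lookup \<mu> v))"

text \<open>The inclusion of the ground field \<open>'k\<close> in an ambient field \<open>'f\<close>.\<close>

definition field_embedding :: "('k::field \<Rightarrow> 'f::field) \<Rightarrow> bool" where
  "field_embedding emb \<longleftrightarrow>
     emb 1 = 1 \<and> (\<forall>a b. emb (a + b) = emb a + emb b) \<and> (\<forall>a b. emb (a * b) = emb a * emb b)"

text \<open>\<open>g\<close> is an algebraically independent family indexed by \<open>S\<close> that generates the field \<open>'f\<close>.\<close>

definition free_generating :: "('k::field \<Rightarrow> 'f::field) \<Rightarrow> 'v set \<Rightarrow> ('v \<Rightarrow> 'f) \<Rightarrow> bool" where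
  "free_generating emb S g \<longleftrightarrow>
     (\<forall>p\<in>carrier (poly_ring S). eval_poly emb g p = 0 \<longrightarrow> p = 0) \<and>
     (\<forall>f. \<exists>p\<in>carrier (poly_ring S). \<exists>q\<in>carrier (poly_ring S).
        eval_poly emb g q \<noteq> 0 \<and> f = eval_poly emb g p / eval_poly emb g q)"

section \<open>Cluster algebras of geometric type\<close>

text \<open>
  Labeled seeds of rank \<open>n\<close> with extended clusters of size \<open>m\<close>: the elements with index \<open>< n\<close> are
  the cluster, those with index in \<open>{n..<m}\<close> are the frozen variables.  In the extended exchange
  matrix, rows are indexed by \<open>{..<m}\<close> and columns by \<open>{..<n}\<close>; entries outside are irrelevant.
\<close>

record 'f seed =
  seed_var :: "nat \<Rightarrow> 'f"
  seed_mat :: "nat \<Rightarrow> nat \<Rightarrow> int"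

definition skew_symmetrizable :: "nat \<Rightarrow> (nat \<Rightarrow> nat \<Rightarrow> int) \<Rightarrow> bool" where
  "skew_symmetrizable n B \<longleftrightarrow>
     (\<exists>d::nat \<Rightarrow> int. (\<forall>i<n. 0 < d i) \<and> (\<forall>i<n. \<forall>j<n. d i * B i j = - (d j * B j i)))"

definition is_seed :: "('k::field \<Rightarrow> 'f::field) \<Rightarrow> nat \<Rightarrow> nat \<Rightarrow> 'f seed \<Rightarrow> bool" where
  "is_seed emb n m s \<longleftrightarrow>
     n \<le> m \<and> free_generating emb {..<m} (seed_var s) \<and> skew_symmetrizable n (seed_mat s)"

text \<open>Below, \<open>nat b\<close> and \<open>nat (- b)\<close> are the positive parts \<open>[b]\<^sub>+\<close> and \<open>[-b]\<^sub>+\<close> of an entry \<open>b\<close>.\<close>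

definition mutated_var :: "nat \<Rightarrow> nat \<Rightarrow> 'f seed \<Rightarrow> 'f::field" where
  "mutated_var m k s =
     ((\<Prod>i<m. seed_var s i ^ nat (seed_mat s i k)) + (\<Prod>i<m. seed_var s i ^ nat (- seed_mat s i k)))
     / seed_var s k"

definition mutated_mat :: "nat \<Rightarrow> (nat \<Rightarrow> nat \<Rightarrow> int) \<Rightarrow> (nat \<Rightarrow> nat \<Rightarrow> int)" where
  "mutated_mat k B = (\<lambda>i j.
     if i = k \<or> j = k then - B i j else B i j + sgn (B i k) * max 0 (B i k * B k j))"

definition mutate :: "nat \<Rightarrow> nat \<Rightarrow> 'f::field seed \<Rightarrow> 'f seed" where
  "mutate m k s =
     \<lparr>seed_var = (seed_var s)(k := mutated_var m k s), seed_mat = mutated_mat k (seed_mat s)\<rparr>"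

inductive_set seeds :: "nat \<Rightarrow> nat \<Rightarrow> 'f::field seed \<Rightarrow> 'f seed set" for n m s where
  initial: "s \<in> seeds n m s"
| mutation: "t \<in> seeds n m s \<Longrightarrow> k < n \<Longrightarrow> mutate m k t \<in> seeds n m s"

definition clusters :: "nat \<Rightarrow> nat \<Rightarrow> 'f::field seed \<Rightarrow> 'f set set" where
  "clusters n m s = (\<lambda>t. seed_var t ` {..<n}) ` seeds n m s"

definition cluster_vars :: "nat \<Rightarrow> nat \<Rightarrow> 'f::field seed \<Rightarrow> 'f set" where
  "cluster_vars n m s = \<Union> (clusters n m s)"

definition frozen_vars :: "nat \<Rightarrow> nat \<Rightarrow> 'f seed \<Rightarrow> 'f set" where
  "frozen_vars n m s = seed_var s ` {n..<m}"

definition all_vars :: "nat \<Rightarrow> nat \<Rightarrow> 'f::field seed \<Rightarrow> 'f set" where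
  "all_vars n m s = cluster_vars n m s \<union> frozen_vars n m s"

text \<open>The subalgebra generated by the cluster variables and the (non-inverted) frozen variables.\<close>

definition cluster_algebra ::
    "('k::field \<Rightarrow> 'f::field) \<Rightarrow> nat \<Rightarrow> nat \<Rightarrow> 'f seed \<Rightarrow> 'f ring" where
  "cluster_algebra emb n m s =
     \<lparr>carrier = \<Inter>{R. range emb \<subseteq> R \<and> all_vars n m s \<subseteq> R \<and>
                     (\<forall>a\<in>R. \<forall>b\<in>R. a - b \<in> R \<and> a * b \<in> R)},
      mult = (*), one = 1, zero = 0, add = (+)\<rparr>"

text \<open>
  Exchange relations, as polynomials in the variables \<open>z\<^sub>v\<close>, where \<open>v\<close> ranges over the cluster
  variables and frozen variables.
\<close>

definition exchange_relations ::
    "nat \<Rightarrow> nat \<Rightarrow> 'f::field seed \<Rightarrow> (('f \<Rightarrow>\<^sub>0 nat) \<Rightarrow>\<^sub>0 'k::comm_ring_1) set" where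
  "exchange_relations n m s =
     {pvar (seed_var t k) * pvar (mutated_var m k t)
        - (\<Prod>i<m. pvar (seed_var t i) ^ nat (seed_mat t i k))
        - (\<Prod>i<m. pvar (seed_var t i) ^ nat (- seed_mat t i k)) | t k. t \<in> seeds n m s \<and> k < n}"

text \<open>
  The algebra has Cartan type \<open>C\<close> if, up to simultaneous permutation of rows and columns, \<open>C\<close> is
  the Cartan counterpart of the exchange matrix of some seed.
\<close>

definition cartan_counterpart :: "(nat \<Rightarrow> nat \<Rightarrow> int) \<Rightarrow> (nat \<Rightarrow> nat \<Rightarrow> int)" where
  "cartan_counterpart B = (\<lambda>i j. if i = j then 2 else - \<bar>B i j\<bar>)"

definition has_cartan_type ::
    "nat \<Rightarrow> nat \<Rightarrow> 'f::field seed \<Rightarrow> (nat \<Rightarrow> nat \<Rightarrow> int) \<Rightarrow> bool" where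
  "has_cartan_type n m s C \<longleftrightarrow>
     (\<exists>t\<in>seeds n m s. \<exists>\<sigma>. bij_betw \<sigma> {..<n} {..<n} \<and>
        (\<forall>i<n. \<forall>j<n. cartan_counterpart (seed_mat t) (\<sigma> i) (\<sigma> j) = C i j))"

text \<open>
  Cartan matrices, with nodes \<open>0, \<dots>, n - 1\<close> and the special node of types \<open>B\<close> and \<open>C\<close> last, in the
  convention \<open>C i j = \<langle>\<alpha>\<^sub>i\<^sup>\<or>, \<alpha>\<^sub>j\<rangle>\<close> of Kac and Fomin-Zelevinsky (the transpose of Bourbaki's).
\<close>

definition cartan_A :: "nat \<Rightarrow> nat \<Rightarrow> nat \<Rightarrow> int" where
  "cartan_A n = (\<lambda>i j. if i = j then 2 else if i = Suc j \<or> j = Suc i then - 1 else 0)"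

definition cartan_B :: "nat \<Rightarrow> nat \<Rightarrow> nat \<Rightarrow> int" where
  "cartan_B n = (\<lambda>i j. if i = n - 1 \<and> j = n - 2 then - 2 else cartan_A n i j)"

definition cartan_C :: "nat \<Rightarrow> nat \<Rightarrow> nat \<Rightarrow> int" where
  "cartan_C n = (\<lambda>i j. if i = n - 2 \<and> j = n - 1 then - 2 else cartan_A n i j)"

section \<open>The Groebner cone\<close>

definition relation_ideal ::
    "('k::field \<Rightarrow> 'f::field) \<Rightarrow> nat \<Rightarrow> nat \<Rightarrow> 'f seed \<Rightarrow> (('f \<Rightarrow>\<^sub>0 nat) \<Rightarrow>\<^sub>0 'k) set" where
  "relation_ideal emb n m s =
     a_kernel (poly_ring (all_vars n m s)) (cluster_algebra emb n m s) (eval_poly emb (\<lambda>v. v))"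

definition incompatibility_ideal ::
    "nat \<Rightarrow> nat \<Rightarrow> 'f::field seed \<Rightarrow> (('f \<Rightarrow>\<^sub>0 nat) \<Rightarrow>\<^sub>0 'k::field) set" where
  "incompatibility_ideal n m s =
     Idl\<^bsub>poly_ring (all_vars n m s)\<^esub>
       {pvar v * pvar w | v w. v \<in> cluster_vars n m s \<and> w \<in> cluster_vars n m s \<and>
          \<not> (\<exists>X\<in>clusters n m s. v \<in> X \<and> w \<in> X)}"

definition weight :: "('v \<Rightarrow>\<^sub>0 real) \<Rightarrow> ('v \<Rightarrow>\<^sub>0 nat) \<Rightarrow> real" where
  "weight \<omega> \<mu> =
     (\<Sum>v\<in>Poly_Mapping.keys \<mu>. real (Poly_Mapping.lookup \<mu> v) * Poly_Mapping.lookup \<omega> v)"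

definition initial_form ::
    "('v \<Rightarrow>\<^sub>0 real) \<Rightarrow> (('v \<Rightarrow>\<^sub>0 nat) \<Rightarrow>\<^sub>0 'k::comm_ring_1) \<Rightarrow> (('v \<Rightarrow>\<^sub>0 nat) \<Rightarrow>\<^sub>0 'k)" where
  "initial_form \<omega> p =
     (\<Sum>\<mu>\<in>{\<mu>\<in>Poly_Mapping.keys p. \<forall>\<nu>\<in>Poly_Mapping.keys p. weight \<omega> \<nu> \<le> weight \<omega> \<mu>}.
        Poly_Mapping.single \<mu> (Poly_Mapping.lookup p \<mu>))"

definition initial_ideal ::
    "'v set \<Rightarrow> ('v \<Rightarrow>\<^sub>0 real) \<Rightarrow> (('v \<Rightarrow>\<^sub>0 nat) \<Rightarrow>\<^sub>0 'k::comm_ring_1) set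
      \<Rightarrow> (('v \<Rightarrow>\<^sub>0 nat) \<Rightarrow>\<^sub>0 'k) set" where
  "initial_ideal S \<omega> I = Idl\<^bsub>poly_ring S\<^esub> (initial_form \<omega> ` I)"

text \<open>
  \<open>\<real>\<^sup>S\<close> is the space of all \<open>\<omega> :: 'v \<Rightarrow>\<^sub>0 real\<close> supported on \<open>S\<close>.  The type \<open>'v \<Rightarrow>\<^sub>0 real\<close> carries the
  \<open>\<ell>\<^sup>1\<close> norm, for which \<open>\<real>\<^sup>S\<close> is a closed subspace with its usual topology when \<open>S\<close> is finite, so
  that taking the closure in the whole type amounts to taking it in \<open>\<real>\<^sup>S\<close>.
\<close>

definition groebner_cone ::
    "('k::field \<Rightarrow> 'f::field) \<Rightarrow> nat \<Rightarrow> nat \<Rightarrow> 'f seed \<Rightarrow> ('f \<Rightarrow>\<^sub>0 real) set" where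
  "groebner_cone emb n m s =
     closure {\<omega>. Poly_Mapping.keys \<omega> \<subseteq> all_vars n m s \<and>
       initial_ideal (all_vars n m s) \<omega> (relation_ideal emb n m s) = incompatibility_ideal n m s}"

text \<open>For a convex cone, this is the largest linear subspace contained in it.\<close>

definition lineality_space :: "'a::real_vector set \<Rightarrow> 'a set" where
  "lineality_space C = C \<inter> uminus ` C"

definition is_basis :: "'a::real_vector set \<Rightarrow> 'a set \<Rightarrow> bool" where
  "is_basis B V \<longleftrightarrow> independent B \<and> span B = V"

section \<open>Polygons\<close>

text \<open>
  The vertices of the \<open>N\<close>-gon are \<open>1, \<dots>, N\<close> in counterclockwise order; the segment \<open>[i,j]\<close> is the
  two-element set \<open>{i, j}\<close>.
\<close>

definition polygon_edges :: "nat \<Rightarrow> nat set set" where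
  "polygon_edges N = (\<lambda>i. {i, i mod N + 1}) ` {1..N}"

definition polygon_diagonals :: "nat \<Rightarrow> nat set set" where
  "polygon_diagonals N = {{i, j} | i j. i \<in> {1..N} \<and> j \<in> {1..N} \<and> i \<noteq> j} - polygon_edges N"

text \<open>The (pairwise distinct) vertices \<open>vs\<close> are passed in this order in one counterclockwise turn.\<close>

definition ccw :: "nat \<Rightarrow> nat list \<Rightarrow> bool" where
  "ccw N vs \<longleftrightarrow> set vs \<subseteq> {1..N} \<and> (\<exists>k. sorted_wrt (<) (rotate k vs))"

definition crossing :: "nat \<Rightarrow> nat set \<Rightarrow> nat set \<Rightarrow> bool" where
  "crossing N l l' \<longleftrightarrow> (\<exists>a b c d. ccw N [a, b, c, d] \<and> l = {a, c} \<and> l' = {b, d})"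

definition noncrossing :: "nat \<Rightarrow> nat set set \<Rightarrow> bool" where
  "noncrossing N T \<longleftrightarrow> T \<subseteq> polygon_diagonals N \<and> (\<forall>l\<in>T. \<forall>l'\<in>T. \<not> crossing N l l')"

definition triangulation :: "nat \<Rightarrow> nat set set \<Rightarrow> bool" where
  "triangulation N T \<longleftrightarrow>
     noncrossing N T \<and> (\<forall>T'. noncrossing N T' \<and> T \<subseteq> T' \<longrightarrow> T' = T)"

section \<open>The polygon model in type A\<close>

definition relations_A :: "nat \<Rightarrow> (nat set \<Rightarrow> 'f) \<Rightarrow> (('f \<Rightarrow>\<^sub>0 nat) \<Rightarrow>\<^sub>0 'k::comm_ring_1) set" where
  "relations_A n x = (let X = (\<lambda>i j. pvar (x {i, j})) in
     {X a c * X b d - X a b * X c d - X a d * X b c | a b c d. ccw (n + 3) [a, b, c, d]})"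

text \<open>
  The seed \<open>s\<close> generates a cluster algebra of type \<open>A\<^sub>n\<close>, in which \<open>x l\<close> is the cluster variable or
  frozen variable that corresponds to the diagonal or edge \<open>l\<close>.
\<close>

definition polygon_model_A ::
    "('k::field \<Rightarrow> 'f::field) \<Rightarrow> nat \<Rightarrow> nat \<Rightarrow> 'f seed \<Rightarrow> (nat set \<Rightarrow> 'f) \<Rightarrow> bool" where
  "polygon_model_A emb n m s x \<longleftrightarrow>
     is_seed emb n m s \<and> has_cartan_type n m s (cartan_A n) \<and>
     inj_on x (polygon_diagonals (n + 3) \<union> polygon_edges (n + 3)) \<and>
     cluster_vars n m s = x ` polygon_diagonals (n + 3) \<and>
     frozen_vars n m s = x ` polygon_edges (n + 3) \<and>
     clusters n m s = {x ` T | T. triangulation (n + 3) T} \<and>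
     (exchange_relations n m s :: (('f \<Rightarrow>\<^sub>0 nat) \<Rightarrow>\<^sub>0 'k) set) = relations_A n x"

definition E_A :: "nat \<Rightarrow> (nat set \<Rightarrow> 'f) \<Rightarrow> nat \<Rightarrow> ('f \<Rightarrow>\<^sub>0 real)" where
  "E_A n x i = (\<Sum>l\<in>{l\<in>polygon_diagonals (n + 3) \<union> polygon_edges (n + 3). i \<in> l}.
     Poly_Mapping.single (x l) 1)"

definition K_A :: "nat \<Rightarrow> (nat set \<Rightarrow> 'f) \<Rightarrow> ('f \<Rightarrow>\<^sub>0 real) set" where
  "K_A n x = E_A n x ` {1..n + 3}"

section \<open>The polygon model in types B and C\<close>

text \<open>
  Here \<open>N = 2 n + 2\<close>.  The labelling \<open>x\<close> is indexed by the sets \<open>{l, opp l}\<close>, where \<open>opp l\<close> is the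
  segment antipodal to \<open>l\<close>; a diameter \<open>l\<close> yields the singleton \<open>{l}\<close>.
\<close>

definition antipode :: "nat \<Rightarrow> nat \<Rightarrow> nat" where
  "antipode n i = (if i \<le> n + 1 then i + (n + 1) else i - (n + 1))"

definition seg_pair :: "nat \<Rightarrow> nat set \<Rightarrow> nat set set" where
  "seg_pair n l = {l, antipode n ` l}"

definition diameter :: "nat \<Rightarrow> nat \<Rightarrow> nat set set" where
  "diameter n i = seg_pair n {i, antipode n i}"

definition diagonal_pairs :: "nat \<Rightarrow> nat set set set" where
  "diagonal_pairs n = seg_pair n ` polygon_diagonals (2 * n + 2)"

definition edge_pairs :: "nat \<Rightarrow> nat set set set" where
  "edge_pairs n = seg_pair n ` polygon_edges (2 * n + 2)"

definition symmetric_triangulation :: "nat \<Rightarrow> nat set set \<Rightarrow> bool" where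
  "symmetric_triangulation n T \<longleftrightarrow>
     triangulation (2 * n + 2) T \<and> (\<lambda>l. antipode n ` l) ` T = T"

text \<open>The parameter \<open>r\<close> is 1 in type \<open>B\<close> and 2 in type \<open>C\<close>.\<close>

definition relations_BC ::
    "nat \<Rightarrow> nat \<Rightarrow> (nat set set \<Rightarrow> 'f) \<Rightarrow> (('f \<Rightarrow>\<^sub>0 nat) \<Rightarrow>\<^sub>0 'k::comm_ring_1) set" where
  "relations_BC r n x = (let N = 2 * n + 2; opp = antipode n; X = (\<lambda>i j. pvar (x (seg_pair n {i, j}))) in
     {X a c * X b d - X a b * X c d - X a d * X b c | a b c d. ccw N [a, b, c, d, opp a]} \<union>
     {X a c * X a (opp b) - X a b * X a (opp c) - X a (opp a) ^ (2 div r) * X b c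
        | a b c. ccw N [a, b, c, opp a]} \<union>
     {X a (opp a) * X b (opp b) - X a b ^ r - X a (opp b) ^ r
        | a b. a \<in> {1..N} \<and> b \<in> {1..N} \<and> b \<noteq> a \<and> b \<noteq> opp a})"

definition polygon_model_BC ::
    "nat \<Rightarrow> (nat \<Rightarrow> nat \<Rightarrow> nat \<Rightarrow> int) \<Rightarrow>
     ('k::field \<Rightarrow> 'f::field) \<Rightarrow> nat \<Rightarrow> nat \<Rightarrow> 'f seed \<Rightarrow> (nat set set \<Rightarrow> 'f) \<Rightarrow> bool" where
  "polygon_model_BC r cartan emb n m s x \<longleftrightarrow>
     is_seed emb n m s \<and> has_cartan_type n m s (cartan n) \<and>
     inj_on x (diagonal_pairs n \<union> edge_pairs n) \<and>
     cluster_vars n m s = x ` diagonal_pairs n \<and>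
     frozen_vars n m s = x ` edge_pairs n \<and>
     clusters n m s = {x ` (seg_pair n ` T) | T. symmetric_triangulation n T} \<and>
     (exchange_relations n m s :: (('f \<Rightarrow>\<^sub>0 nat) \<Rightarrow>\<^sub>0 'k) set) = relations_BC r n x"

definition polygon_model_B ::
    "('k::field \<Rightarrow> 'f::field) \<Rightarrow> nat \<Rightarrow> nat \<Rightarrow> 'f seed \<Rightarrow> (nat set set \<Rightarrow> 'f) \<Rightarrow> bool" where
  "polygon_model_B = polygon_model_BC 1 cartan_B"

definition polygon_model_C ::
    "('k::field \<Rightarrow> 'f::field) \<Rightarrow> nat \<Rightarrow> nat \<Rightarrow> 'f seed \<Rightarrow> (nat set set \<Rightarrow> 'f) \<Rightarrow> bool" where
  "polygon_model_C = polygon_model_BC 2 cartan_C"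

text \<open>
  In \<open>E_BC\<close>, the vertex \<open>i\<close> is an endpoint of \<open>l\<close> or \<open>opp l\<close> if and only if \<open>i \<in> \<Union>{l, opp l}\<close>; the
  diameter at \<open>i\<close> is the only pair at \<open>i\<close> consisting of diameters.
\<close>

definition E_BC :: "real \<Rightarrow> nat \<Rightarrow> (nat set set \<Rightarrow> 'f) \<Rightarrow> nat \<Rightarrow> ('f \<Rightarrow>\<^sub>0 real)" where
  "E_BC c n x i =
     Poly_Mapping.single (x (diameter n i)) c +
     (\<Sum>L\<in>{L\<in>diagonal_pairs n \<union> edge_pairs n. i \<in> \<Union>L \<and> L \<noteq> diameter n i}.
        Poly_Mapping.single (x L) 1)"

definition K_B :: "nat \<Rightarrow> (nat set set \<Rightarrow> 'f) \<Rightarrow> ('f \<Rightarrow>\<^sub>0 real) set" where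
  "K_B n x = E_BC 1 n x ` {1..n + 1}"

definition K_C :: "nat \<Rightarrow> (nat set set \<Rightarrow> 'f) \<Rightarrow> ('f \<Rightarrow>\<^sub>0 real) set" where
  "K_C n x = E_BC 2 n x ` {1..n + 1}"

end

theory Submission
  imports Defs "HOL-Computational_Algebra.Polynomial"
begin

text \<open>
  Write \<open>I\<close> for the relation ideal and \<open>I\<^sup>\<times>\<close> for the incompatibility ideal.  A weight \<open>\<omega>\<close> satisfies
  \<open>In\<^sub>\<omega>(I) = I\<^sup>\<times>\<close> as soon as (i) every product of two incompatible cluster variables is a combination
  of monomials of smaller \<open>\<omega>\<close>-weight, and (ii) the standard monomials, those outside \<open>I\<^sup>\<times>\<close>, are
  linearly independent in the cluster algebra.  For (i) the weight of an arc of length \<open>t\<close> in the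
  \<open>N\<close>-gon is \<open>t (N - t)\<close>, up to scaling, to which any combination of the vectors \<open>E\<^sub>i\<close> can be added
  because all relations are homogeneous for them.  Letting the multiple of the length weight tend to
  zero puts the span of the \<open>E\<^sub>i\<close> into the lineality space.  Conversely, the weights of a lineality
  vector agree on both sides of every exchange relation with standard right-hand side, and this
  linear system forces it into the span.

  For (ii), every seed is algebraically independent, hence so is the fan triangulation at vertex 1,
  and the arcs become the \<open>2 \<times> 2\<close> minors (type A), or their symmetric analogues (types B and C), of
  vectors \<open>(\<alpha>\<^sub>i, \<beta>\<^sub>i)\<close> with independent coordinates.  The leading monomial of a product of arcs records
  at which vertices arcs open and close, and a noncrossing system of arcs is determined by these
  data: an innermost arc joins the first closing vertex to the last opening vertex before it.
\<close>

text \<open>In types B and C the exchange relations do not cover all incompatible pairs, while (i)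
  is required for each of them. The missing relations are obtained as polynomial identities in the
  coordinates, which thus serve for (i) as well as for (ii). Behind the formulas is the half turn of
  the polygon, acting on coordinate vectors by a linear map of determinant 1 that takes (0, 1) to
  (1, 0). In type C it is (\<alpha>, \<beta>) -> (\<beta>, -\<alpha>), with square -1. In type B it
  is (\<alpha>, \<beta>) -> (2 \<alpha> + \<beta>, -\<alpha>), with fixed vector (1, -1): a diameter
  is the minor with this vector, and its square is the minor of a vertex with its antipode. All this
  holds up to a common factor, kept as one more independent variable; its exponent makes up for what
  the constant coordinates of the extreme vertices hide. A decrease of real weights does not make
  rewriting stop, so the reductions in (i) also lower a rank in the natural numbers. The length
  weight works because t (N - t) is strictly concave: two crossing arcs outweigh either pair of
  opposite sides of their quadrilateral.\<close>

abbreviation "keys \<equiv> Poly_Mapping.keys"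
abbreviation "lookup \<equiv> Poly_Mapping.lookup"
abbreviation "single \<equiv> Poly_Mapping.single"

section \<open>Polynomial evaluation\<close>

definition meval :: "('v \<Rightarrow> 'b::comm_monoid_mult) \<Rightarrow> ('v \<Rightarrow>\<^sub>0 nat) \<Rightarrow> 'b" where
  "meval g \<mu> = (\<Prod>v\<in>keys \<mu>. g v ^ lookup \<mu> v)"

definition peval ::
    "('a::comm_ring_1 \<Rightarrow> 'b::comm_ring_1) \<Rightarrow> ('v \<Rightarrow> 'b) \<Rightarrow> (('v \<Rightarrow>\<^sub>0 nat) \<Rightarrow>\<^sub>0 'a) \<Rightarrow> 'b" where
  "peval c g p = (\<Sum>\<mu>\<in>keys p. c (lookup p \<mu>) * meval g \<mu>)"

lemma eval_poly_eq_peval: "eval_poly emb g p = peval emb g p"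
  by (simp add: eval_poly_def peval_def meval_def)

lemma keys_add_nat: "keys (\<mu> + \<nu> :: 'v \<Rightarrow>\<^sub>0 nat) = keys \<mu> \<union> keys \<nu>"
  by (auto simp: in_keys_iff lookup_add)

lemma meval_superset:
  assumes "finite A" "keys \<mu> \<subseteq> A"
  shows "meval g \<mu> = (\<Prod>v\<in>A. g v ^ lookup \<mu> v)"
  unfolding meval_def using assms by (intro prod.mono_neutral_left) (auto simp: in_keys_iff)

lemma meval_zero [simp]: "meval g 0 = 1"
  by (simp add: meval_def)

lemma meval_add: "meval g (\<mu> + \<nu>) = meval g \<mu> * meval g \<nu>"
proof -
  let ?A = "keys \<mu> \<union> keys \<nu>"
  have "meval g (\<mu> + \<nu>) = (\<Prod>v\<in>?A. g v ^ lookup (\<mu> + \<nu>) v)"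
    by (rule meval_superset) (auto simp: keys_add_nat)
  also have "\<dots> = (\<Prod>v\<in>?A. g v ^ lookup \<mu> v) * (\<Prod>v\<in>?A. g v ^ lookup \<nu> v)"
    by (simp add: lookup_add power_add prod.distrib)
  also have "\<dots> = meval g \<mu> * meval g \<nu>"
    by (simp add: meval_superset[of ?A])
  finally show ?thesis .
qed

lemma meval_single: "meval g (single v k) = g v ^ k"
  by (cases "k = 0") (auto simp: meval_def)

lemma meval_cong: "(\<And>v. v \<in> keys \<mu> \<Longrightarrow> f v = g v) \<Longrightarrow> meval f \<mu> = meval g \<mu>"
  unfolding meval_def by (rule prod.cong) auto

lemma poly_mapping_sum_singles:
  "p = (\<Sum>\<mu>\<in>keys p. single \<mu> (lookup p \<mu>))"
proof (rule poly_mapping_eqI)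
  fix k
  have "lookup (\<Sum>\<mu>\<in>keys p. single \<mu> (lookup p \<mu>)) k
      = (\<Sum>\<mu>\<in>keys p. if \<mu> = k then lookup p \<mu> else 0)"
    by (simp add: lookup_sum lookup_single when_def)
  also have "\<dots> = lookup p k"
    by (auto simp: in_keys_iff)
  finally show "lookup p k =
    lookup (\<Sum>\<mu>\<in>keys p. single \<mu> (lookup p \<mu>)) k" by simp
qed

text \<open>Three kinds of instances occur: the field embedding \<open>emb\<close>;
  \<open>single 0\<close>, for which \<open>peval\<close> substitutes polynomials for variables; and
  an evaluation \<open>peval c g\<close> itself, which makes evaluating after substituting a case of
  \<open>hom_peval\<close>.\<close>

locale coeff_hom =
  fixes c :: "'a::comm_ring_1 \<Rightarrow> 'b::comm_ring_1"
  assumes hom_one: "c 1 = 1" and hom_add: "c (a + b) = c a + c b" and hom_mult: "c (a * b) = c a * c b"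
begin

lemma hom_zero [simp]: "c 0 = 0"
  using hom_add[of 0 0] by simp

lemma hom_uminus: "c (- a) = - c a"
  using hom_add[of a "- a"] by (simp add: eq_neg_iff_add_eq_0 add.commute)

lemma peval_superset:
  assumes "finite A" "keys p \<subseteq> A"
  shows "peval c g p = (\<Sum>\<mu>\<in>A. c (lookup p \<mu>) * meval g \<mu>)"
  unfolding peval_def using assms by (intro sum.mono_neutral_left) (auto simp: in_keys_iff)

lemma peval_zero [simp]: "peval c g 0 = 0"
  by (simp add: peval_def)

lemma peval_add: "peval c g (p + q) = peval c g p + peval c g q"
proof -
  let ?A = "keys p \<union> keys q"
  have "peval c g (p + q) = (\<Sum>\<mu>\<in>?A. c (lookup (p + q) \<mu>) * meval g \<mu>)"
    by (rule peval_superset) (auto dest: subsetD[OF Poly_Mapping.keys_add])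
  also have "\<dots> = peval c g p + peval c g q"
    by (simp add: lookup_add hom_add distrib_right sum.distrib peval_superset[of ?A])
  finally show ?thesis .
qed

lemma peval_sum: "peval c g (\<Sum>i\<in>A. f i) = (\<Sum>i\<in>A. peval c g (f i))"
  by (induction A rule: infinite_finite_induct) (auto simp: peval_add)

lemma peval_uminus: "peval c g (- p) = - peval c g p"
  using peval_add[of g p "- p"] by (simp add: eq_neg_iff_add_eq_0 add.commute)

lemma peval_diff: "peval c g (p - q) = peval c g p - peval c g q"
  using peval_add[of g p "- q"] by (simp add: peval_uminus)

lemma peval_single: "peval c g (single \<mu> a) = c a * meval g \<mu>"
  by (cases "a = 0") (auto simp: peval_def)

lemma peval_pvar [simp]: "peval c g (pvar v) = g v"
  by (simp add: pvar_def peval_single hom_one meval_single)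

lemma peval_one [simp]: "peval c g 1 = 1"
  using peval_single[of g 0 1] by (simp add: hom_one)

lemma peval_mult: "peval c g (p * q) = peval c g p * peval c g q"
proof -
  let ?f = "\<lambda>p \<mu>. single \<mu> (lookup p \<mu>)"
  have "p * q = (\<Sum>\<mu>\<in>keys p. ?f p \<mu>) * (\<Sum>\<nu>\<in>keys q. ?f q \<nu>)"
    using poly_mapping_sum_singles by metis
  also have "\<dots> = (\<Sum>\<mu>\<in>keys p. \<Sum>\<nu>\<in>keys q.
      single (\<mu> + \<nu>) (lookup p \<mu> * lookup q \<nu>))"
    by (simp add: sum_product mult_single)
  finally have "peval c g (p * q) = (\<Sum>\<mu>\<in>keys p. \<Sum>\<nu>\<in>keys q.
      c (lookup p \<mu>) * meval g \<mu> * (c (lookup q \<nu>) * meval g \<nu>))"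
    by (simp add: peval_sum peval_single hom_mult meval_add mult_ac)
  also have "\<dots> = peval c g p * peval c g q"
    by (simp add: peval_def sum_product)
  finally show ?thesis .
qed

lemma peval_power: "peval c g (p ^ k) = peval c g p ^ k"
  by (induction k) (auto simp: peval_mult)

lemma peval_prod: "peval c g (\<Prod>i\<in>A. f i) = (\<Prod>i\<in>A. peval c g (f i))"
  by (induction A rule: infinite_finite_induct) (auto simp: peval_mult)

lemma hom_prod: "c (\<Prod>i\<in>A. f i) = (\<Prod>i\<in>A. c (f i))"
  by (induction A rule: infinite_finite_induct) (auto simp: hom_mult hom_one)

lemma hom_power: "c (a ^ k) = c a ^ k"
  by (induction k) (auto simp: hom_mult hom_one)

lemma hom_meval: "c (meval g \<mu>) = meval (\<lambda>v. c (g v)) \<mu>"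
  by (simp add: meval_def hom_prod hom_power)

lemma hom_sum: "c (\<Sum>i\<in>A. f i) = (\<Sum>i\<in>A. c (f i))"
  by (induction A rule: infinite_finite_induct) (auto simp: hom_add)

lemma hom_peval:
  "c (peval d g p) = peval (\<lambda>a. c (d a)) (\<lambda>v. c (g v)) p"
  by (simp add: peval_def hom_sum hom_mult hom_meval)

end

lemma coeff_hom_single: "coeff_hom (single (0 :: 'v \<Rightarrow>\<^sub>0 nat) :: 'a::comm_ring_1 \<Rightarrow> _)"
  by unfold_locales (auto simp: single_add mult_single)

lemma meval_pvar: "meval pvar \<mu> = (single \<mu> 1 :: ('v \<Rightarrow>\<^sub>0 nat) \<Rightarrow>\<^sub>0 'a::comm_ring_1)"
proof -
  have pow: "pvar v ^ k = (single (single v k) 1 :: ('v \<Rightarrow>\<^sub>0 nat) \<Rightarrow>\<^sub>0 'a)" for v k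
    by (induction k) (auto simp: pvar_def mult_single single_add[symmetric])
  have pr: "(\<Prod>v\<in>A. single (f v) (1::'a)) = single (\<Sum>v\<in>A. f v) 1"
    for A and f :: "'v \<Rightarrow> ('v \<Rightarrow>\<^sub>0 nat)"
    by (induction A rule: infinite_finite_induct) (auto simp: mult_single)
  show ?thesis
    by (simp add: meval_def pow pr poly_mapping_sum_singles[symmetric])
qed

lemma peval_pvar_id: "peval (single 0) pvar p = p"
proof -
  have "peval (single 0) pvar p =
      (\<Sum>\<mu>\<in>keys p. single \<mu> (lookup p \<mu>))"
    by (simp add: peval_def meval_pvar mult_single)
  then show ?thesis by (simp flip: poly_mapping_sum_singles)
qed

lemma peval_cong:
  "(\<And>v. v \<in> pvars p \<Longrightarrow> f v = g v) \<Longrightarrow> peval c f p = peval c g p"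
  unfolding peval_def pvars_def by (intro sum.cong refl arg_cong2[where f = "(*)"] meval_cong) auto

lemma pvars_zero [simp]: "pvars 0 = {}"
  and pvars_one [simp]: "pvars 1 = {}"
  by (auto simp: pvars_def)

lemma pvars_single_subset: "pvars (single \<mu> a) \<subseteq> keys \<mu>"
  by (auto simp: pvars_def split: if_splits)

lemma pvars_pvar_subset: "pvars (pvar v) \<subseteq> {v}"
  unfolding pvar_def using pvars_single_subset[of "single v 1"] by auto

lemma pvars_add_subset: "pvars (p + q) \<subseteq> pvars p \<union> pvars q"
  unfolding pvars_def using Poly_Mapping.keys_add[of p q] by blast

lemma pvars_uminus [simp]: "pvars (- p :: ('v \<Rightarrow>\<^sub>0 nat) \<Rightarrow>\<^sub>0 'a::ab_group_add) = pvars p"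
  unfolding pvars_def by (auto simp: in_keys_iff)

lemma pvars_diff_subset: "pvars (p - q :: ('v \<Rightarrow>\<^sub>0 nat) \<Rightarrow>\<^sub>0 'a::ab_group_add) \<subseteq> pvars p \<union> pvars q"
  using pvars_add_subset[of p "- q"] by simp

lemma pvars_mult_subset: "pvars (p * q :: ('v \<Rightarrow>\<^sub>0 nat) \<Rightarrow>\<^sub>0 'a::comm_ring_1) \<subseteq> pvars p \<union> pvars q"
proof
  fix v assume "v \<in> pvars (p * q)"
  then obtain \<mu> where \<mu>: "\<mu> \<in> keys (p * q)" "v \<in> keys \<mu>"
    by (auto simp: pvars_def)
  then obtain a b where "\<mu> = a + b" "a \<in> keys p" "b \<in> keys q"
    using keys_mult[of p q] by blast
  with \<mu> show "v \<in> pvars p \<union> pvars q"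
    by (auto simp: pvars_def keys_add_nat)
qed

lemma pvars_sum: "(\<And>i. i \<in> A \<Longrightarrow> pvars (f i) \<subseteq> S) \<Longrightarrow> pvars (\<Sum>i\<in>A. f i) \<subseteq> S"
  by (induction A rule: infinite_finite_induct) (auto dest: subsetD[OF pvars_add_subset])

lemma pvars_power:
  "pvars (p :: ('v \<Rightarrow>\<^sub>0 nat) \<Rightarrow>\<^sub>0 'a::comm_ring_1) \<subseteq> S \<Longrightarrow> pvars (p ^ k) \<subseteq> S"
  by (induction k) (auto dest: subsetD[OF pvars_mult_subset])

lemma pvars_prod:
  fixes f :: "'i \<Rightarrow> (('v \<Rightarrow>\<^sub>0 nat) \<Rightarrow>\<^sub>0 'a::comm_ring_1)"
  shows "(\<And>i. i \<in> A \<Longrightarrow> pvars (f i) \<subseteq> S) \<Longrightarrow> pvars (\<Prod>i\<in>A. f i) \<subseteq> S"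
  by (induction A rule: infinite_finite_induct) (auto dest: subsetD[OF pvars_mult_subset])

lemma pvars_addI: "pvars p \<subseteq> S \<Longrightarrow> pvars q \<subseteq> S \<Longrightarrow> pvars (p + q) \<subseteq> S"
  using pvars_add_subset[of p q] by blast

lemma pvars_diffI:
  "pvars p \<subseteq> S \<Longrightarrow> pvars q \<subseteq> S \<Longrightarrow> pvars (p - q :: ('v \<Rightarrow>\<^sub>0 nat) \<Rightarrow>\<^sub>0 'a::ab_group_add) \<subseteq> S"
  using pvars_diff_subset[of p q] by blast

lemma pvars_multI:
  "pvars p \<subseteq> S \<Longrightarrow> pvars q \<subseteq> S \<Longrightarrow> pvars (p * q :: ('v \<Rightarrow>\<^sub>0 nat) \<Rightarrow>\<^sub>0 'a::comm_ring_1) \<subseteq> S"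
  using pvars_mult_subset[of p q] by blast

lemma pvars_pvarI: "v \<in> S \<Longrightarrow> pvars (pvar v) \<subseteq> S"
  using pvars_pvar_subset[of v] by blast

lemma pvars_constI: "pvars (single 0 a) \<subseteq> S"
  using pvars_single_subset[of 0 a] by auto

lemma pvars_peval:
  assumes "\<And>v. v \<in> pvars p \<Longrightarrow> pvars (f v) \<subseteq> S"
  shows "pvars (peval (single 0) f p) \<subseteq> S"
proof -
  have "pvars (meval f \<mu>) \<subseteq> S" if "\<mu> \<in> keys p" for \<mu>
    unfolding meval_def by (intro pvars_prod pvars_power) (use that assms in \<open>auto simp: pvars_def\<close>)
  then show ?thesis
    unfolding peval_def by (intro pvars_sum pvars_multI pvars_constI)
qed

section \<open>Algebraic independence of clusters\<close>

definition alg_indep :: "('a::comm_ring_1 \<Rightarrow> 'b::comm_ring_1) \<Rightarrow> 'v set \<Rightarrow> ('v \<Rightarrow> 'b) \<Rightarrow> bool" where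
  "alg_indep c S g \<longleftrightarrow> (\<forall>p. pvars p \<subseteq> S \<longrightarrow> peval c g p = 0 \<longrightarrow> p = 0)"

lemma free_generating_imp_alg_indep: "free_generating emb S g \<Longrightarrow> alg_indep emb S g"
  by (auto simp: free_generating_def alg_indep_def poly_ring_def eval_poly_eq_peval)

lemma alg_indep_cong:
  assumes "\<And>v. v \<in> S \<Longrightarrow> f v = g v" shows "alg_indep c S f \<longleftrightarrow> alg_indep c S g"
  unfolding alg_indep_def using peval_cong[of _ f g c] assms by (metis subsetD)

lemma pvar_nonzero: "pvar v \<noteq> (0 :: ('v \<Rightarrow>\<^sub>0 nat) \<Rightarrow>\<^sub>0 'a::comm_ring_1)"
  by (simp add: pvar_def) (metis lookup_single_eq lookup_zero zero_neq_one)

context coeff_hom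
begin

lemma alg_indep_nonzero: "alg_indep c S g \<Longrightarrow> v \<in> S \<Longrightarrow> g v \<noteq> 0"
  using pvar_nonzero[of v] pvars_pvarI[of v S] unfolding alg_indep_def by (metis peval_pvar)

lemma coeff_hom_peval: "coeff_hom (peval c g)"
  by unfold_locales (auto simp: peval_add peval_mult)

end

lemma (in coeff_hom) peval_substitute:
  "peval c g (peval (single 0) f p) = peval c (\<lambda>v. peval c g (f v)) p"
  by (simp add: coeff_hom.hom_peval[OF coeff_hom_peval] peval_single)

lemma (in coeff_hom) alg_indep_reindex:
  fixes g :: "'j \<Rightarrow> 'b" and f :: "'i \<Rightarrow> 'j"
  assumes ind: "alg_indep c A g" and f: "inj_on f H" "f ` H \<subseteq> A"
  shows "alg_indep c H (\<lambda>i. g (f i))"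
  unfolding alg_indep_def
proof (intro allI impI)
  fix p :: "('i \<Rightarrow>\<^sub>0 nat) \<Rightarrow>\<^sub>0 'a"
  assume p: "pvars p \<subseteq> H" and z: "peval c (\<lambda>i. g (f i)) p = 0"
  define P :: "('j \<Rightarrow>\<^sub>0 nat) \<Rightarrow>\<^sub>0 'a" where "P = peval (single 0) (\<lambda>v. pvar (f v)) p"
  have "peval c g P = 0"
    unfolding P_def peval_substitute using z by simp
  moreover have "pvars P \<subseteq> A"
    unfolding P_def using f p by (intro pvars_peval pvars_pvarI) auto
  ultimately have "P = 0" using ind by (auto simp: alg_indep_def)
  \<comment> \<open>Undoing the renaming recovers \<open>p\<close> from \<open>P = 0\<close>; on
    \<open>H\<close> the injective \<open>f\<close> is inverted by
    \<open>inv_into H f\<close>.\<close>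
  define G :: "'j \<Rightarrow> (('i \<Rightarrow>\<^sub>0 nat) \<Rightarrow>\<^sub>0 'a)" where "G = (\<lambda>w. pvar (inv_into H f w))"
  have "peval (single 0) G P = peval (single 0) (\<lambda>v. G (f v)) p"
    unfolding P_def coeff_hom.peval_substitute[OF coeff_hom_single]
    by (simp add: coeff_hom.peval_pvar[OF coeff_hom_single])
  also have "\<dots> = peval (single 0) pvar p"
    unfolding G_def by (rule peval_cong) (use p f in auto)
  also have "peval (single 0) G P = 0"
    unfolding \<open>P = 0\<close> by (rule coeff_hom.peval_zero[OF coeff_hom_single])
  finally show "p = 0" by (simp add: peval_pvar_id)
qed

lemma (in coeff_hom) alg_indep_family:
  assumes ind: "alg_indep c A g" and G: "inj_on G H" "G ` H \<subseteq> g ` A"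
  shows "alg_indep c H G"
proof -
  have "\<forall>i\<in>H. \<exists>a. a \<in> A \<and> G i = g a" using G(2) by blast
  from bchoice[OF this] obtain f where f: "\<forall>i\<in>H. f i \<in> A \<and> G i = g (f i)" by blast
  have "inj_on f H"
  proof (rule inj_onI)
    fix i j assume ij: "i \<in> H" "j \<in> H" "f i = f j"
    then have "G i = G j" using f by simp
    then show "i = j" using G(1) ij by (simp add: inj_on_eq_iff)
  qed
  moreover have "f ` H \<subseteq> A" using f by blast
  ultimately have "alg_indep c H (\<lambda>i. g (f i))" by (rule alg_indep_reindex[OF ind])
  moreover have "alg_indep c H G \<longleftrightarrow> alg_indep c H (\<lambda>i. g (f i))"
    by (rule alg_indep_cong) (simp add: f)
  ultimately show ?thesis by simp
qed

lemma pvar_power: "pvar v ^ k = (single (single v k) 1 :: ('v \<Rightarrow>\<^sub>0 nat) \<Rightarrow>\<^sub>0 'a::comm_ring_1)"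
  using meval_pvar[of "single v k"] by (simp add: meval_single)

lemma prod_single_one:
  "(\<Prod>v\<in>A. single (f v) (1::'a::comm_ring_1)) = single (\<Sum>v\<in>A. f v :: 'b::comm_monoid_add) 1"
  by (induction A rule: infinite_finite_induct) (auto simp: mult_single)

lemma poly_mapping_split_key:
  "(\<mu> :: 'v \<Rightarrow>\<^sub>0 nat) = Poly_Mapping.update k 0 \<mu> + single k (lookup \<mu> k)"
  by (rule poly_mapping_eqI) (auto simp: lookup_add lookup_update lookup_single)

text \<open>Grouping the monomials by their exponent at \<open>k\<close> gives access to the bound
  on the number of roots of a polynomial in one variable.\<close>

lemma poly_in_one_variable:
  fixes p :: "('v \<Rightarrow>\<^sub>0 nat) \<Rightarrow>\<^sub>0 'a::comm_ring_1"
  obtains N q where "\<And>j. pvars (q j) \<subseteq> pvars p - {k}" "p = (\<Sum>j\<le>N. q j * pvar k ^ j)"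
proof
  let ?K = "keys p" and ?d = "\<lambda>\<mu>. lookup \<mu> k"
  define N where "N = Max (insert 0 (?d ` ?K))"
  define q where "q j = (\<Sum>\<mu>\<in>{\<mu>\<in>?K. ?d \<mu> = j}.
    single (Poly_Mapping.update k 0 \<mu>) (lookup p \<mu>))" for j
  have N: "?d \<mu> \<le> N" if "\<mu> \<in> ?K" for \<mu>
    unfolding N_def using that by (intro Max_ge) auto
  have "q j * pvar k ^ j = (\<Sum>\<mu>\<in>{\<mu>\<in>?K. ?d \<mu> = j}. single \<mu> (lookup p \<mu>))" for j
    unfolding q_def sum_distrib_right
    by (rule sum.cong) (auto simp: pvar_power mult_single poly_mapping_split_key[symmetric])
  then have "(\<Sum>j\<le>N. q j * pvar k ^ j) =
      (\<Sum>j\<le>N. \<Sum>\<mu>\<in>{\<mu>\<in>?K. ?d \<mu> = j}. single \<mu> (lookup p \<mu>))" by simp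
  also have "\<dots> = (\<Sum>\<mu>\<in>?K. single \<mu> (lookup p \<mu>))"
    by (rule sum.group) (use N in auto)
  finally show "p = (\<Sum>j\<le>N. q j * pvar k ^ j)" by (simp flip: poly_mapping_sum_singles)
  show "pvars (q j) \<subseteq> pvars p - {k}" for j
    unfolding q_def
  proof (rule pvars_sum)
    fix \<mu> assume \<mu>: "\<mu> \<in> {\<mu>\<in>?K. ?d \<mu> = j}"
    have "keys (Poly_Mapping.update k 0 \<mu>) \<subseteq> pvars p - {k}"
      using \<mu> by (auto simp: in_keys_iff lookup_update pvars_def split: if_splits)
    then show "pvars (single (Poly_Mapping.update k 0 \<mu>) (lookup p \<mu>)) \<subseteq> pvars p - {k}"
      by (rule order_trans[OF pvars_single_subset])
  qed
qed

lemma alg_indepD: "alg_indep c S g \<Longrightarrow> pvars p \<subseteq> S \<Longrightarrow> peval c g p = 0 \<Longrightarrow> p = 0"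
  by (simp add: alg_indep_def)

text \<open>A relation for the new family pulls back to a polynomial relation that holds for every value
  of the \<open>k\<close>-th member, since the old family is independent; the Moebius map takes infinitely many
  values, so all coefficients vanish.\<close>

lemma alg_indep_moebius:
  fixes h :: "'a::comm_ring_1 \<Rightarrow> 'f::field" and g :: "'v \<Rightarrow> 'f"
  assumes hom: "coeff_hom h" and inf: "infinite (UNIV :: 'f set)"
    and ind: "alg_indep h S g" and k: "k \<in> S"
    and pv: "pvars a \<subseteq> S - {k}" "pvars b \<subseteq> S - {k}" "pvars c \<subseteq> S - {k}" "pvars d \<subseteq> S - {k}"
    and g': "g' * (peval h g c * g k + peval h g d) = peval h g a * g k + peval h g b"
    and nz: "peval h g c * g k + peval h g d \<noteq> 0"
    and det: "peval h g a * peval h g d - peval h g b * peval h g c \<noteq> 0"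
  shows "alg_indep h S (g(k := g'))"
  unfolding alg_indep_def
proof (intro allI impI)
  interpret coeff_hom h by (rule hom)
  fix p assume p: "pvars p \<subseteq> S" and p0: "peval h (g(k := g')) p = 0"
  obtain q N where q: "\<And>j. pvars (q j) \<subseteq> pvars p - {k}" and p_eq: "p = (\<Sum>j\<le>N. q j * pvar k ^ j)"
    by (rule poly_in_one_variable[of p k]) blast
  define A B C D where "A = peval h g a" and "B = peval h g b" and "C = peval h g c" and "D = peval h g d"
  define \<phi> where "\<phi> y = (A * y + B) / (C * y + D)" for y
  \<comment> \<open>The numerator of \<open>p\<close> after replacing the variable \<open>k\<close>
    by \<open>(a y + b) / (c y + d)\<close>; the exponent \<open>N - j\<close> brings all terms to
    the common denominator of degree \<open>N\<close>.\<close>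
  define P where "P = (\<Sum>j\<le>N. q j * (a * pvar k + b) ^ j * (c * pvar k + d) ^ (N - j))"
  have eval_upd: "peval h (g(k := y)) r = peval h g r" if "pvars r \<subseteq> S - {k}" for r y
    by (rule peval_cong) (use that in auto)
  have qS: "pvars (q j) \<subseteq> S - {k}" for j using q[of j] p by blast
  have p_at: "peval h (g(k := x)) p = (\<Sum>j\<le>N. peval h g (q j) * x ^ j)" for x
    unfolding p_eq by (simp add: peval_sum peval_mult peval_power eval_upd qS)
  have P_at: "peval h (g(k := y)) P = (C * y + D) ^ N * peval h (g(k := \<phi> y)) p"
    if y: "C * y + D \<noteq> 0" for y
  proof -
    have "peval h (g(k := y)) P = (\<Sum>j\<le>N. peval h g (q j) * (A * y + B) ^ j * (C * y + D) ^ (N - j))"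
      unfolding P_def
      by (simp add: peval_sum peval_mult peval_power peval_add eval_upd qS pv A_def B_def C_def D_def)
    also have "\<dots> = (\<Sum>j\<le>N. (C * y + D) ^ N * (peval h g (q j) * \<phi> y ^ j))"
    proof (rule sum.cong)
      fix j assume "j \<in> {..N}"
      then have "(C * y + D) ^ N = (C * y + D) ^ j * (C * y + D) ^ (N - j)"
        by (simp flip: power_add)
      then show "peval h g (q j) * (A * y + B) ^ j * (C * y + D) ^ (N - j) =
          (C * y + D) ^ N * (peval h g (q j) * \<phi> y ^ j)"
        using y by (simp add: \<phi>_def power_divide)
    qed simp
    finally show ?thesis by (simp add: p_at sum_distrib_left)
  qed
  have "\<phi> (g k) = g'"
    using g' nz unfolding \<phi>_def A_def B_def C_def D_def by (simp add: field_simps)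
  then have "peval h g P = 0"
    using P_at[of "g k"] p0 nz unfolding C_def D_def by simp
  moreover have "pvars P \<subseteq> S"
    unfolding P_def
    by (intro pvars_sum pvars_multI pvars_power pvars_addI pvars_pvarI k) (use qS pv in blast)+
  ultimately have "P = 0" by (intro alg_indepD[OF ind])
  \<comment> \<open>Since \<open>P = 0\<close>, \<open>p\<close> vanishes when its
    \<open>k\<close>-th value is replaced by any \<open>\<phi> y\<close>. \<open>R\<close> is
    \<open>p\<close> as a polynomial in that value alone.\<close>
  define R where "R = (\<Sum>j\<le>N. monom (peval h g (q j)) j)"
  have R: "poly R x = peval h (g(k := x)) p" for x
    by (simp add: R_def p_at poly_sum poly_monom)
  define Y where "Y = {y. C * y + D \<noteq> 0}"
  have "inj_on \<phi> Y"
  proof (rule inj_onI)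
    fix x y assume xy: "x \<in> Y" "y \<in> Y" "\<phi> x = \<phi> y"
    then have "(A * x + B) * (C * y + D) = (A * y + B) * (C * x + D)"
      by (simp add: Y_def \<phi>_def frac_eq_eq)
    then have "(A * D - B * C) * (x - y) = 0" by (simp add: algebra_simps)
    then show "x = y" using det by (simp add: A_def B_def C_def D_def)
  qed
  moreover have "infinite Y"
  proof -
    have "- Y \<subseteq> {- D / C}"
    proof
      fix y assume "y \<in> - Y"
      then have *: "C * y + D = 0" by (simp add: Y_def)
      then have "C \<noteq> 0" using det by (auto simp flip: A_def B_def C_def D_def)
      then show "y \<in> {- D / C}" using * by (simp add: field_simps add_eq_0_iff)
    qed
    then have "finite (- Y)" by (rule finite_subset) simp
    then show ?thesis using inf by (metis Compl_partition finite_Un)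
  qed
  ultimately have inf_im: "infinite (\<phi> ` Y)" by (simp add: finite_image_iff)
  have im:  "\<phi> ` Y \<subseteq> {x. poly R x = 0}"
  proof
    fix x assume "x \<in> \<phi> ` Y"
    then obtain y where y: "C * y + D \<noteq> 0" "x = \<phi> y" by (auto simp: Y_def)
    from P_at[OF y(1)] y show "x \<in> {x. poly R x = 0}" by (simp add: \<open>P = 0\<close> R)
  qed
  have "R = 0"
  proof (rule ccontr)
    assume "R \<noteq> 0"
    then have "finite {x. poly R x = 0}" by (rule poly_roots_finite)
    with im have "finite (\<phi> ` Y)" by (rule finite_subset)
    with inf_im show False by (rule notE)
  qed
  have "q j = 0" if "j \<le> N" for j
  proof -
    have "coeff R j = peval h g (q j)"
      using that by (simp add: R_def coeff_sum)
    then have "peval h g (q j) = 0" using \<open>R = 0\<close> by simp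
    then show ?thesis using alg_indepD[OF ind, of "q j"] qS[of j] by auto
  qed
  then show "p = 0" by (simp add: p_eq)
qed

section \<open>Mutation preserves algebraic independence and skew-symmetrizability\<close>

lemma field_embedding_coeff_hom: "field_embedding emb \<Longrightarrow> coeff_hom emb"
  by unfold_locales (auto simp: field_embedding_def)

lemma field_embedding_eq_0_iff:
  assumes "field_embedding emb" shows "emb a = 0 \<longleftrightarrow> a = 0"
proof -
  interpret coeff_hom emb using assms by (rule field_embedding_coeff_hom)
  have "emb a * emb (inverse a) = 1" if "a \<noteq> 0"
    using that hom_mult[of a "inverse a"] by (simp add: hom_one)
  then show ?thesis by (cases "a = 0") auto
qed

lemma field_embedding_infinite:
  fixes emb :: "'k::field_char_0 \<Rightarrow> 'f::field"
  assumes "field_embedding emb" shows "infinite (UNIV :: 'f set)"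
proof -
  interpret coeff_hom emb using assms by (rule field_embedding_coeff_hom)
  have "inj (\<lambda>n. emb (of_nat n))"
  proof (rule injI)
    fix a b :: nat assume "emb (of_nat a) = emb (of_nat b)"
    then have "emb (of_nat a - of_nat b) = 0"
      using hom_add[of "of_nat a" "- of_nat b"] by (simp add: hom_uminus)
    then show "a = b" using field_embedding_eq_0_iff[OF assms] by simp
  qed
  from range_inj_infinite[OF this] show ?thesis by (rule infinite_super[OF subset_UNIV])
qed

text \<open>The signs of \<open>x\<close>, \<open>y\<close> are opposite and so are those of
  \<open>z\<close>, \<open>w\<close>, hence both maxima are positive at the same time. With
  \<open>x = B i k\<close>, \<open>y = B k i\<close>, \<open>z = B j k\<close>,
  \<open>w = B k j\<close> and \<open>a\<close>, \<open>b\<close>, \<open>d\<close> the symmetrizing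
  factors of \<open>i\<close>, \<open>j\<close>, \<open>k\<close>, this is the skew symmetry of the
  correction term in a matrix mutation at \<open>k\<close>.\<close>

lemma max_zero_mult_swap:
  fixes a b d x y z w :: int
  assumes "0 < a" "0 < b" "0 < d" and 1: "a * x = - (d * y)" and 2: "b * z = - (d * w)"
  shows "a * (sgn x * max 0 (x * w)) = - (b * (sgn z * max 0 (z * y)))"
proof -
  have sx: "sgn x = - sgn y"
    using arg_cong[OF 1, of sgn] assms(1,3) by (simp add: sgn_mult)
  have sz: "sgn z = - sgn w"
    using arg_cong[OF 2, of sgn] assms(2,3) by (simp add: sgn_mult)
  have zx: "0 < z * y \<longleftrightarrow> 0 < x * w"
  proof -
    have "sgn (z * y) = sgn (x * w)" by (simp add: sgn_mult sx sz)
    then show ?thesis by (metis sgn_1_pos)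
  qed
  show ?thesis
  proof (cases "0 < x * w")
    case True
    then have eq: "sgn y = - sgn w" using sx by (smt (verit) mult_neg_pos mult_pos_neg sgn_if zero_less_mult_iff)
    have "a * (sgn x * max 0 (x * w)) = sgn x * ((a * x) * w)" using True by simp
    also have "\<dots> = - (sgn x * d * y * w)" by (simp add: 1)
    finally have l: "a * (sgn x * max 0 (x * w)) = - (sgn x * d * y * w)" .
    have "b * (sgn z * max 0 (z * y)) = sgn z * ((b * z) * y)" using True zx by simp
    also have "\<dots> = - (sgn z * d * w * y)" by (simp add: 2)
    finally show ?thesis using l sx sz eq by simp
  qed (use zx in auto)
qed

lemma skew_symmetrizable_mutated:
  assumes "skew_symmetrizable n B" "k < n"
  shows "skew_symmetrizable n (mutated_mat k B)"
proof -
  obtain d where d: "\<forall>i<n. 0 < d i" "\<forall>i<n. \<forall>j<n. d i * B i j = - (d j * B j i)"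
    using assms(1) by (auto simp: skew_symmetrizable_def)
  then have dpos: "0 < d i" and D: "j < n \<Longrightarrow> d i * B i j = - (d j * B j i)" if "i < n" for i j
    using that by blast+
  have "d i * mutated_mat k B i j = - (d j * mutated_mat k B j i)" if "i < n" "j < n" for i j
  proof (cases "i = k \<or> j = k")
    case True
    then show ?thesis using D[OF that] by (auto simp: mutated_mat_def)
  next
    case False
    have "d i * (sgn (B i k) * max 0 (B i k * B k j)) = - (d j * (sgn (B j k) * max 0 (B j k * B k i)))"
      by (rule max_zero_mult_swap[of "d i" "d j" "d k"]) (intro dpos D that assms(2))+
    then show ?thesis using False D[OF that] by (simp add: mutated_mat_def distrib_left)
  qed
  then show ?thesis using dpos unfolding skew_symmetrizable_def by blast
qed

lemma skew_symmetrizable_diag: "skew_symmetrizable n B \<Longrightarrow> k < n \<Longrightarrow> B k k = 0"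
  unfolding skew_symmetrizable_def by (metis add.inverse_neutral equal_neg_zero less_irrefl mult_eq_0_iff)

text \<open>A mutation replaces the \<open>k\<close>-th variable \<open>y\<close> by
  \<open>u / y\<close>, where \<open>u\<close> is the exchange binomial: a Moebius map of
  determinant \<open>- u\<close>. Frozen variables stay, as mutations take place only at
  \<open>k < n\<close>.\<close>

lemma seed_properties:
  fixes emb :: "'k::field_char_0 \<Rightarrow> 'f::field"
  assumes emb: "field_embedding emb" and s: "is_seed emb n m s" and t: "t \<in> seeds n m s"
  shows "alg_indep emb {..<m} (seed_var t)" "skew_symmetrizable n (seed_mat t)"
    "\<And>i. n \<le> i \<Longrightarrow> seed_var t i = seed_var s i"
proof -
  interpret coeff_hom emb using emb by (rule field_embedding_coeff_hom)
  have "alg_indep emb {..<m} (seed_var t) \<and> skew_symmetrizable n (seed_mat t) \<and>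
    (\<forall>i\<ge>n. seed_var t i = seed_var s i)"
    using t
  proof induction
    case initial
    then show ?case using s by (auto simp: is_seed_def free_generating_imp_alg_indep)
  next
    case (mutation t k)
    let ?g = "seed_var t" and ?B = "seed_mat t"
    have k: "k < m" using mutation.hyps s by (auto simp: is_seed_def)
    \<comment> \<open>The zero diagonal entry keeps the variable \<open>k\<close> out of the
      exchange binomial.\<close>
    have Bkk: "?B k k = 0" using mutation skew_symmetrizable_diag by blast
    define M where "M f = (\<Prod>i\<in>{..<m} - {k}. pvar i ^ f i :: (nat \<Rightarrow>\<^sub>0 nat) \<Rightarrow>\<^sub>0 'k)" for f :: "nat \<Rightarrow> nat"
    define u where "u = M (\<lambda>i. nat (?B i k)) + M (\<lambda>i. nat (- ?B i k))"
    have M_single: "\<exists>\<mu>. M f = single \<mu> 1" for f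
      unfolding M_def pvar_power prod_single_one by blast
    then obtain \<mu> \<nu> where "u = single \<mu> 1 + single \<nu> 1"
      unfolding u_def by metis
    \<comment> \<open>The coefficient is 1, or 2 if the two monomials coincide, which is nonzero in
      characteristic 0.\<close>
    then have "lookup u \<mu> \<noteq> 0"
      by (simp add: lookup_add lookup_single when_def)
    then have "u \<noteq> 0" by auto
    have pvM: "pvars (M f) \<subseteq> {..<m} - {k}" for f
      unfolding M_def by (intro pvars_prod pvars_power pvars_pvarI)
    then have pu: "pvars u \<subseteq> {..<m} - {k}" unfolding u_def by (intro pvars_addI)
    have u_nz: "peval emb ?g u \<noteq> 0"
      using alg_indepD[of emb "{..<m}" ?g u] mutation.IH pu \<open>u \<noteq> 0\<close> by auto
    have M_eval: "peval emb ?g (M f) = (\<Prod>i<m. ?g i ^ f i)" if "f k = 0" for f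
    proof -
      have "(\<Prod>i<m. ?g i ^ f i) = ?g k ^ f k * (\<Prod>i\<in>{..<m} - {k}. ?g i ^ f i)"
        using k by (intro prod.remove) auto
      then show ?thesis using that by (simp add: M_def peval_prod peval_power)
    qed
    have ind: "alg_indep emb {..<m} ?g" using mutation.IH by (rule conjunct1)
    have gk: "?g k \<noteq> 0" by (rule alg_indep_nonzero[OF ind]) (simp add: k)
    have "mutated_var m k t * ?g k = peval emb ?g u"
      using gk Bkk by (simp add: mutated_var_def u_def peval_add M_eval)
    then have "alg_indep emb {..<m} (?g(k := mutated_var m k t))"
      using k pu gk u_nz
      by (intro alg_indep_moebius[where a = 0 and b = u and c = 1 and d = 0, OF coeff_hom_axioms
            field_embedding_infinite[OF emb] ind]) simp_all
    moreover have "skew_symmetrizable n (mutated_mat k ?B)"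
      by (rule skew_symmetrizable_mutated) (simp_all add: mutation)
    ultimately show ?case using mutation by (simp add: mutate_def fun_upd_def)
  qed
  then show "alg_indep emb {..<m} (seed_var t)" "skew_symmetrizable n (seed_mat t)"
    "\<And>i. n \<le> i \<Longrightarrow> seed_var t i = seed_var s i" by auto
qed

lemma exchange_relation_vanishes:
  fixes emb :: "'k::field_char_0 \<Rightarrow> 'f::field"
  assumes emb: "field_embedding emb" and s: "is_seed emb n m s"
    and p: "p \<in> exchange_relations n m s"
  shows "peval emb (\<lambda>v. v) p = 0"
proof -
  interpret coeff_hom emb using emb by (rule field_embedding_coeff_hom)
  obtain t k where tk: "t \<in> seeds n m s" "k < n" and p_eq: "p = pvar (seed_var t k) * pvar (mutated_var m k t)
        - (\<Prod>i<m. pvar (seed_var t i) ^ nat (seed_mat t i k))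
        - (\<Prod>i<m. pvar (seed_var t i) ^ nat (- seed_mat t i k))"
    using p by (auto simp: exchange_relations_def)
  have "k < m" using tk s by (auto simp: is_seed_def)
  then have "seed_var t k \<noteq> 0"
    using alg_indep_nonzero[OF seed_properties(1)[OF emb s tk(1)]] by simp
  then show ?thesis
    by (simp add: p_eq peval_diff peval_mult peval_prod peval_power mutated_var_def)
qed

text \<open>General values allow three uses: reals give \<open>weight\<close>, natural numbers give
  ranks and degrees, and exponent vectors, themselves a commutative semiring, give the leading
  exponent of a product.\<close>

definition linear_weight :: "('v \<Rightarrow> 'b::comm_semiring_1) \<Rightarrow> ('v \<Rightarrow>\<^sub>0 nat) \<Rightarrow> 'b" where
  "linear_weight f \<mu> = (\<Sum>v\<in>keys \<mu>. of_nat (lookup \<mu> v) * f v)"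

lemma linear_weight_superset:
  assumes "finite A" "keys \<mu> \<subseteq> A"
  shows "linear_weight f \<mu> = (\<Sum>v\<in>A. of_nat (lookup \<mu> v) * f v)"
  unfolding linear_weight_def using assms by (intro sum.mono_neutral_left) (auto simp: in_keys_iff)

lemma linear_weight_zero [simp]: "linear_weight f 0 = 0"
  by (simp add: linear_weight_def)

lemma linear_weight_add [simp]: "linear_weight f (\<mu> + \<nu>) = linear_weight f \<mu> + linear_weight f \<nu>"
proof -
  let ?A = "keys \<mu> \<union> keys \<nu>"
  have "linear_weight f (\<mu> + \<nu>) = (\<Sum>v\<in>?A. of_nat (lookup (\<mu> + \<nu>) v) * f v)"
    by (rule linear_weight_superset) (auto simp: keys_add_nat)
  also have "\<dots> = linear_weight f \<mu> + linear_weight f \<nu>"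
    by (simp add: lookup_add distrib_right sum.distrib linear_weight_superset[of ?A])
  finally show ?thesis .
qed

lemma linear_weight_single [simp]: "linear_weight f (single v k) = of_nat k * f v"
  by (cases "k = 0") (auto simp: linear_weight_def)

lemma linear_weight_hom:
  fixes f :: "'v \<Rightarrow> 'b::comm_semiring_1" and \<phi> :: "'b \<Rightarrow> 'c::comm_semiring_1"
  assumes "\<phi> 0 = 0" and add: "\<And>x y. \<phi> (x + y) = \<phi> x + \<phi> y"
  shows "\<phi> (linear_weight f \<mu>) = linear_weight (\<lambda>v. \<phi> (f v)) \<mu>"
proof -
  have "\<phi> (of_nat k * x) = of_nat k * \<phi> x" for k x
    by (induction k) (auto simp: distrib_right assms)
  moreover have "\<phi> (\<Sum>v\<in>A. g v) = (\<Sum>v\<in>A. \<phi> (g v))" for A and g :: "'v \<Rightarrow> 'b"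
    by (induction A rule: infinite_finite_induct) (auto simp: assms)
  ultimately show ?thesis by (simp add: linear_weight_def)
qed

lemma linear_weight_nat_pos_iff:
  "0 < linear_weight (f :: 'v \<Rightarrow> nat) \<mu> \<longleftrightarrow> (\<exists>v\<in>keys \<mu>. 0 < f v)"
proof -
  have "linear_weight f \<mu> = 0 \<longleftrightarrow> (\<forall>v\<in>keys \<mu>. f v = 0)"
    by (auto simp: linear_weight_def in_keys_iff)
  then show ?thesis by (metis gr_zeroI less_irrefl)
qed

lemma weight_eq: "weight \<omega> \<mu> = linear_weight (lookup \<omega>) \<mu>"
  by (simp add: weight_def linear_weight_def)

lemma split_variable:
  fixes \<mu> :: "'v \<Rightarrow>\<^sub>0 nat"
  assumes "v \<in> keys \<mu>"
  obtains \<mu>' where "\<mu> = single v 1 + \<mu>'"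
proof
  show "\<mu> = single v 1 + (Poly_Mapping.update v (lookup \<mu> v - 1) \<mu>)"
    using assms by (intro poly_mapping_eqI) (auto simp: lookup_add lookup_update lookup_single when_def in_keys_iff)
qed

lemma split_two_variables:
  fixes \<mu> :: "'v \<Rightarrow>\<^sub>0 nat"
  assumes "v \<in> keys \<mu>" "w \<in> keys \<mu>" "v \<noteq> w"
  obtains \<mu>' where "\<mu> = single v 1 + single w 1 + \<mu>'"
proof -
  obtain \<mu>1 where 1: "\<mu> = single v 1 + \<mu>1" using assms(1) by (rule split_variable)
  then have "w \<in> keys \<mu>1" using assms(2,3) by (auto simp: keys_add_nat split: if_splits)
  then obtain \<mu>2 where "\<mu>1 = single w 1 + \<mu>2" by (rule split_variable)
  then show ?thesis using 1 that[of \<mu>2] by (simp add: add.assoc)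
qed

section \<open>Leading monomials\<close>

text \<open>The order on exponent vectors is lexicographic with the smallest index most significant.
  It is total and compatible with addition, so leading exponents add up in products of polynomials
  over a field.\<close>

definition leads :: "(nat \<Rightarrow>\<^sub>0 nat) \<Rightarrow> ((nat \<Rightarrow>\<^sub>0 nat) \<Rightarrow>\<^sub>0 'k::comm_ring_1) \<Rightarrow> bool" where
  "leads e p \<longleftrightarrow> (\<exists>c q. c \<noteq> 0 \<and> p = single e c + q \<and> (\<forall>\<mu>\<in>keys q. \<mu> < e))"

lemma leads_single: "c \<noteq> 0 \<Longrightarrow> leads e (single e c)"
  unfolding leads_def by (intro exI[of _ c] exI[of _ 0]) simp

lemma leads_one: "leads 0 1"
  using leads_single[of 1 0] by simp

lemma leads_add_lower:
  assumes "leads e p" "\<And>\<mu>. \<mu> \<in> keys q \<Longrightarrow> \<mu> < e"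
  shows "leads e (p + q)"
proof -
  obtain c r where *: "c \<noteq> 0" "p = single e c + r" "\<forall>\<mu>\<in>keys r. \<mu> < e"
    using assms(1) by (auto simp: leads_def)
  have "\<mu> < e" if "\<mu> \<in> keys (r + q)" for \<mu>
    using subsetD[OF Poly_Mapping.keys_add that] *(3) assms(2) by auto
  then show ?thesis
    unfolding leads_def using * by (intro exI[of _ c] exI[of _ "r + q"]) (simp add: add.assoc)
qed

lemma leads_lookup: "leads e p \<Longrightarrow> lookup p e \<noteq> 0"
  by (auto simp: leads_def lookup_add in_keys_iff)

lemma leads_keys_le: "leads e p \<Longrightarrow> \<mu> \<in> keys p \<Longrightarrow> \<mu> \<le> e"
  by (auto simp: leads_def dest!: subsetD[OF Poly_Mapping.keys_add] split: if_splits intro: less_imp_le)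

lemma leads_mult:
  fixes p q :: "(nat \<Rightarrow>\<^sub>0 nat) \<Rightarrow>\<^sub>0 'k::field"
  assumes "leads e p" "leads f q"
  shows "leads (e + f) (p * q)"
proof -
  obtain c p' where p: "c \<noteq> 0" "p = single e c + p'" "\<forall>\<mu>\<in>keys p'. \<mu> < e"
    using assms(1) by (auto simp: leads_def)
  obtain d q' where q: "d \<noteq> 0" "q = single f d + q'" "\<forall>\<mu>\<in>keys q'. \<mu> < f"
    using assms(2) by (auto simp: leads_def)
  have "p * q = single (e + f) (c * d) + (p' * q + single e c * q')"
    by (simp add: p(2) q(2) mult_single algebra_simps)
  moreover have "leads (e + f) (single (e + f) (c * d) + (p' * q + single e c * q'))"
  proof (rule leads_add_lower)
    fix \<mu> assume "\<mu> \<in> keys (p' * q + single e c * q')"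
    from subsetD[OF Poly_Mapping.keys_add this]
    consider "\<mu> \<in> keys (p' * q)" | "\<mu> \<in> keys (single e c * q')"
      by auto
    then show "\<mu> < e + f"
    proof cases
      case 1
      from subsetD[OF keys_mult this]
      obtain a b where "\<mu> = a + b" "a \<in> keys p'" "b \<in> keys q" by auto
      then show ?thesis using p(3) leads_keys_le[OF assms(2)] by (auto intro: add_less_le_mono)
    next
      case 2
      from subsetD[OF keys_mult this]
      obtain a b where "\<mu> = a + b" "a \<in> keys (single e c)"
        "b \<in> keys q'" by auto
      then show ?thesis using q(3) by (auto split: if_splits)
    qed
  qed (use p(1) q(1) in \<open>auto intro: leads_single\<close>)
  ultimately show ?thesis by simp
qed

lemma leads_power: "leads e (p :: (nat \<Rightarrow>\<^sub>0 nat) \<Rightarrow>\<^sub>0 'k::field) \<Longrightarrow> leads (of_nat k * e) (p ^ k)"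
  by (induction k) (auto simp: leads_one distrib_right intro: leads_mult)

lemma leads_prod:
  fixes f :: "'i \<Rightarrow> ((nat \<Rightarrow>\<^sub>0 nat) \<Rightarrow>\<^sub>0 'k::field)"
  shows "(\<And>i. i \<in> A \<Longrightarrow> leads (e i) (f i)) \<Longrightarrow> leads (\<Sum>i\<in>A. e i) (\<Prod>i\<in>A. f i)"
  by (induction A rule: infinite_finite_induct) (auto simp: leads_one intro: leads_mult)

lemma leads_meval:
  fixes X :: "'v \<Rightarrow> ((nat \<Rightarrow>\<^sub>0 nat) \<Rightarrow>\<^sub>0 'k::field)"
  assumes "\<And>v. v \<in> keys \<mu> \<Longrightarrow> leads (e v) (X v)"
  shows "leads (linear_weight e \<mu>) (meval X \<mu>)"
  unfolding linear_weight_def meval_def by (intro leads_prod leads_power assms)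

text \<open>The largest leading exponent is attained by a single monomial of \<open>p\<close>,
  because of injectivity, so its coefficient cannot cancel after each \<open>g v\<close> is
  expressed by the independent family \<open>h\<close> through \<open>X v\<close>.\<close>

lemma linear_independence_by_leading_monomials:
  fixes emb :: "'k::field \<Rightarrow> 'f::field" and X :: "'v \<Rightarrow> ((nat \<Rightarrow>\<^sub>0 nat) \<Rightarrow>\<^sub>0 'k)"
  assumes hom: "coeff_hom emb" and ind: "alg_indep emb H h"
    and X: "\<And>v. v \<in> S \<Longrightarrow> pvars (X v) \<subseteq> H" "\<And>v. v \<in> S \<Longrightarrow> peval emb h (X v) = g v"
      "\<And>v. v \<in> S \<Longrightarrow> leads (e v) (X v)"
    and inj: "inj_on (linear_weight e) (keys p)"
    and p: "pvars p \<subseteq> S" "peval emb g p = 0"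
  shows "p = 0"
proof (rule ccontr)
  interpret coeff_hom emb by (rule hom)
  assume "p \<noteq> 0"
  define q where "q = peval (single 0) X p"
  have "peval emb h q = peval emb (\<lambda>v. peval emb h (X v)) p"
    by (simp add: q_def peval_substitute)
  also have "\<dots> = peval emb g p" by (rule peval_cong) (use X(2) p(1) in auto)
  finally have "peval emb h q = 0" by (simp add: p(2))
  moreover have "pvars q \<subseteq> H" unfolding q_def by (rule pvars_peval) (use X(1) p(1) in auto)
  ultimately have "q = 0" by (intro alg_indepD[OF ind])
  let ?L = "linear_weight e" and ?K = "keys p"
  have "?K \<noteq> {}" using \<open>p \<noteq> 0\<close> by (metis lookup_zero in_keys_iff poly_mapping_eqI empty_iff)
  then have "Max (?L ` ?K) \<in> ?L ` ?K" by (intro Max_in) auto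
  then obtain \<mu> where \<mu>: "\<mu> \<in> ?K" "?L \<mu> = Max (?L ` ?K)" by auto
  have lead: "leads (?L \<nu>) (meval X \<nu>)" if "\<nu> \<in> ?K" for \<nu>
    by (rule leads_meval) (use X(3) p(1) that in \<open>auto simp: pvars_def\<close>)
  have lower: "lookup (meval X \<nu>) (?L \<mu>) = 0" if \<nu>: "\<nu> \<in> ?K - {\<mu>}" for \<nu>
  proof -
    have "?L \<nu> \<le> ?L \<mu>" unfolding \<mu>(2) using \<nu> by (intro Max_ge) auto
    moreover have "?L \<nu> \<noteq> ?L \<mu>" using inj_onD[OF inj] \<nu> \<mu>(1) by auto
    ultimately have "\<not> ?L \<mu> \<le> ?L \<nu>" by simp
    then show ?thesis using leads_keys_le[OF lead[of \<nu>]] \<nu> by (auto simp: in_keys_iff)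
  qed
  have scale: "lookup (single 0 c * r) k = c * lookup r k"
    for c :: 'k and r :: "(nat \<Rightarrow>\<^sub>0 nat) \<Rightarrow>\<^sub>0 'k" and k
    by (simp add: mult_map_scale_conv_mult[symmetric] Poly_Mapping.map.rep_eq when_def)
  have "lookup q (?L \<mu>) =
      (\<Sum>\<nu>\<in>?K. lookup p \<nu> * lookup (meval X \<nu>) (?L \<mu>))"
    by (simp add: q_def peval_def lookup_sum scale)
  also have "\<dots> = lookup p \<mu> * lookup (meval X \<mu>) (?L \<mu>)"
    using \<mu>(1) lower by (subst sum.remove[of _ \<mu>]) auto
  finally show False
    using \<open>q = 0\<close> \<mu>(1) leads_lookup[OF lead[OF \<mu>(1)]] by (simp add: in_keys_iff)
qed

text \<open>Dividing by a common variable gives an induction on the degree. What is left to each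
  type is to find one common variable of two standard monomials with the same leading exponent. The
  assumption \<open>nz\<close> serves the end of the induction, where one monomial has become
  1.\<close>

lemma linear_weight_inj_by_cancellation:
  fixes e :: "'v \<Rightarrow> (nat \<Rightarrow>\<^sub>0 nat)"
  assumes common: "\<And>\<mu> \<nu>. \<mu> \<in> M \<Longrightarrow> \<nu> \<in> M \<Longrightarrow> \<mu> \<noteq> 0 \<Longrightarrow> linear_weight e \<mu> = linear_weight e \<nu> \<Longrightarrow>
      keys \<mu> \<inter> keys \<nu> \<noteq> {}"
    and sub: "\<And>\<mu> \<nu>. \<mu> + \<nu> \<in> M \<Longrightarrow> \<nu> \<in> M"
    and nz: "\<And>\<mu> v. \<mu> \<in> M \<Longrightarrow> v \<in> keys \<mu> \<Longrightarrow> e v \<noteq> 0"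
  shows "inj_on (linear_weight e) M"
proof -
  have "\<mu> = \<nu>" if "\<mu> \<in> M" "\<nu> \<in> M" "linear_weight e \<mu> = linear_weight e \<nu>" for \<mu> \<nu>
    using that
  proof (induction "linear_weight (\<lambda>_. 1 :: nat) \<mu>" arbitrary: \<mu> \<nu> rule: less_induct)
    case less
    show ?case
    proof (cases "\<mu> = 0")
      case True
      have "v \<notin> keys \<nu>" for v
      proof
        assume v: "v \<in> keys \<nu>"
        then obtain \<nu>' where "\<nu> = single v 1 + \<nu>'" by (rule split_variable)
        then have "e v + linear_weight e \<nu>' = 0" using less.prems(3) True by simp
        then have "lookup (e v) i = 0" for i
          by (metis add_is_0 lookup_add lookup_zero)
        then show False using nz[OF less.prems(2) v] poly_mapping_eqI[of "e v" 0] by simp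
      qed
      then have "\<nu> = 0" by (intro poly_mapping_eqI) (simp add: in_keys_iff)
      then show ?thesis using True by simp
    next
      case False
      then obtain v where v: "v \<in> keys \<mu>" "v \<in> keys \<nu>"
        using common less.prems by auto
      obtain \<mu>' where \<mu>': "\<mu> = single v 1 + \<mu>'" using v(1) by (rule split_variable)
      obtain \<nu>' where \<nu>': "\<nu> = single v 1 + \<nu>'" using v(2) by (rule split_variable)
      have "\<mu>' = \<nu>'"
        by (rule less.hyps) (use less.prems \<mu>' \<nu>' sub[of "single v 1"] in auto)
      then show ?thesis by (simp add: \<mu>' \<nu>')
    qed
  qed
  then show ?thesis by (intro inj_onI)
qed

section \<open>Groebner degenerations\<close>

lemma ring_poly_ring: "cring (poly_ring S :: (('v \<Rightarrow>\<^sub>0 nat) \<Rightarrow>\<^sub>0 'k::comm_ring_1) ring)"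
proof (rule cringI)
  show "abelian_group (poly_ring S :: (('v \<Rightarrow>\<^sub>0 nat) \<Rightarrow>\<^sub>0 'k) ring)"
  proof (rule abelian_groupI)
    fix p :: "('v \<Rightarrow>\<^sub>0 nat) \<Rightarrow>\<^sub>0 'k" assume "p \<in> carrier (poly_ring S)"
    then show "\<exists>q\<in>carrier (poly_ring S). q \<oplus>\<^bsub>poly_ring S\<^esub> p = \<zero>\<^bsub>poly_ring S\<^esub>"
      by (intro bexI[of _ "- p"]) (auto simp: poly_ring_def)
  qed (auto simp: poly_ring_def add_ac intro: subsetD[OF pvars_addI])
  show "comm_monoid (poly_ring S :: (('v \<Rightarrow>\<^sub>0 nat) \<Rightarrow>\<^sub>0 'k) ring)"
    by (rule comm_monoidI) (auto simp: poly_ring_def mult_ac intro: subsetD[OF pvars_multI])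
qed (auto simp: poly_ring_def distrib_right)

text \<open>Additive inverses are covered by multiplication, \<open>- p\<close> being
  \<open>- 1 * p\<close>. Ideals are handled below through this elementary form.\<close>

lemma poly_ring_ideal_iff:
  fixes J :: "(('v \<Rightarrow>\<^sub>0 nat) \<Rightarrow>\<^sub>0 'k::comm_ring_1) set"
  shows "ideal J (poly_ring S) \<longleftrightarrow> (\<forall>p\<in>J. pvars p \<subseteq> S) \<and> 0 \<in> J \<and> (\<forall>p\<in>J. \<forall>q\<in>J. p + q \<in> J) \<and>
    (\<forall>p\<in>J. \<forall>q. pvars q \<subseteq> S \<longrightarrow> q * p \<in> J)" (is "_ \<longleftrightarrow> ?R")
proof
  interpret R: cring "poly_ring S :: (('v \<Rightarrow>\<^sub>0 nat) \<Rightarrow>\<^sub>0 'k) ring" by (rule ring_poly_ring)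
  {
    assume "ideal J (poly_ring S)"
    then interpret ideal J "poly_ring S" .
    show ?R
      using a_subset additive_subgroup.zero_closed[OF additive_subgroup_axioms] a_closed I_l_closed
      by (auto simp: poly_ring_def)
  }
  assume R: ?R
  show "ideal J (poly_ring S)"
  proof (rule idealI)
    show "ring (poly_ring S :: (('v \<Rightarrow>\<^sub>0 nat) \<Rightarrow>\<^sub>0 'k) ring)" by (rule R.ring_axioms)
    show "subgroup J (add_monoid (poly_ring S))"
    proof (rule R.add.subgroupI)
      fix p assume p: "p \<in> J"
      have "\<ominus>\<^bsub>poly_ring S\<^esub> p = - p"
        by (rule R.minus_equality) (use R p in \<open>auto simp: poly_ring_def\<close>)
      moreover have "- 1 * p \<in> J" using R p by (metis pvars_one pvars_uminus empty_subsetI)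
      ultimately show "\<ominus>\<^bsub>poly_ring S\<^esub> p \<in> J" by simp
    qed (use R in \<open>auto simp: poly_ring_def\<close>)
  qed (use R in \<open>auto simp: poly_ring_def mult.commute\<close>)
qed

lemma lookup_initial_form:
  "lookup (initial_form \<omega> p) \<mu> =
    (if \<forall>\<nu>\<in>keys p. weight \<omega> \<nu> \<le> weight \<omega> \<mu> then lookup p \<mu> else 0)"
proof -
  let ?T = "{\<mu>\<in>keys p. \<forall>\<nu>\<in>keys p. weight \<omega> \<nu> \<le> weight \<omega> \<mu>}"
  have "lookup (initial_form \<omega> p) \<mu> = (\<Sum>\<nu>\<in>?T. if \<nu> = \<mu> then lookup p \<nu> else 0)"
    by (simp add: initial_form_def lookup_sum lookup_single when_def)
  also have "\<dots> = (if \<mu> \<in> ?T then lookup p \<mu> else 0)"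
    by (simp add: sum.delta)
  finally show ?thesis by (auto simp: in_keys_iff)
qed

lemma keys_initial_form:
  "keys (initial_form \<omega> p) =
    {\<mu>\<in>keys p. \<forall>\<nu>\<in>keys p. weight \<omega> \<nu> \<le> weight \<omega> \<mu>}"
  by (auto simp: in_keys_iff lookup_initial_form split: if_splits)

text \<open>The Groebner argument with the seed abstracted away; \<open>bad\<close> stands for
  incompatibility. As \<open>bad v w\<close> forces \<open>v \<noteq> w\<close>, two bad variables
  in the support of a monomial can be split off together.\<close>

locale incompatibility =
  fixes emb :: "'k::field \<Rightarrow> 'f::field" and S :: "'f set" and bad :: "'f \<Rightarrow> 'f \<Rightarrow> bool"
  assumes emb: "field_embedding emb" and finite_S: "finite S"
    and bad: "bad v w \<Longrightarrow> v \<in> S" "bad v w \<Longrightarrow> w \<in> S" "bad v w \<Longrightarrow> v \<noteq> w"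
begin

sublocale coeff_hom emb
  using emb by (rule field_embedding_coeff_hom)

definition std :: "('f \<Rightarrow>\<^sub>0 nat) \<Rightarrow> bool" where
  "std \<mu> \<longleftrightarrow> (\<forall>v\<in>keys \<mu>. \<forall>w\<in>keys \<mu>. \<not> bad v w)"

text \<open>A monomial ideal contains a polynomial exactly if it contains all of its monomials, so
  membership becomes a condition on \<open>keys\<close>.\<close>

definition bad_ideal :: "(('f \<Rightarrow>\<^sub>0 nat) \<Rightarrow>\<^sub>0 'k) set" where
  "bad_ideal = {p. pvars p \<subseteq> S \<and> (\<forall>\<mu>\<in>keys p. \<not> std \<mu>)}"

definition relations :: "(('f \<Rightarrow>\<^sub>0 nat) \<Rightarrow>\<^sub>0 'k) set" where
  "relations = {p. pvars p \<subseteq> S \<and> peval emb (\<lambda>v. v) p = 0}"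

lemma not_std_add: "\<not> std \<mu> \<Longrightarrow> \<not> std (\<nu> + \<mu>)"
  by (auto simp: std_def keys_add_nat)

lemma not_std_split:
  assumes "\<not> std \<mu>"
  obtains v w \<nu> where "bad v w" "\<mu> = single v 1 + single w 1 + \<nu>"
proof -
  obtain v w where vw: "v \<in> keys \<mu>" "w \<in> keys \<mu>" "bad v w"
    using assms by (auto simp: std_def)
  obtain \<nu> where "\<mu> = single v 1 + single w 1 + \<nu>"
    using vw(1,2) bad(3)[OF vw(3)] by (rule split_two_variables)
  then show ?thesis using vw(3) that by simp
qed

lemma not_std_pair: "bad v w \<Longrightarrow> \<not> std (single v 1 + single w 1)"
  by (auto simp: std_def keys_add_nat)

lemma pvar_mult_pvar:
  "pvar v * pvar w = (single (single v 1 + single w 1) 1 :: ('f \<Rightarrow>\<^sub>0 nat) \<Rightarrow>\<^sub>0 'k)"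
  by (simp add: pvar_def mult_single)

lemma ideal_bad_ideal: "ideal bad_ideal (poly_ring S)"
  unfolding poly_ring_ideal_iff
proof (intro conjI ballI allI impI)
  fix p q assume p: "p \<in> bad_ideal" and q: "q \<in> bad_ideal"
  have "\<not> std \<mu>" if "\<mu> \<in> keys (p + q)" for \<mu>
    using subsetD[OF Poly_Mapping.keys_add that] p q by (auto simp: bad_ideal_def)
  then show "p + q \<in> bad_ideal" using p q by (simp add: bad_ideal_def pvars_addI)
next
  fix p q :: "('f \<Rightarrow>\<^sub>0 nat) \<Rightarrow>\<^sub>0 'k"
  assume p: "p \<in> bad_ideal" and q: "pvars q \<subseteq> S"
  have "\<not> std \<mu>" if "\<mu> \<in> keys (q * p)" for \<mu>
    using subsetD[OF keys_mult that] p not_std_add by (auto simp: bad_ideal_def)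
  then show "q * p \<in> bad_ideal" using p q by (simp add: bad_ideal_def pvars_multI)
qed (auto simp: bad_ideal_def)

lemma ideal_contains_bad_ideal:
  assumes J: "ideal J (poly_ring S)" and gens: "\<And>v w. bad v w \<Longrightarrow> pvar v * pvar w \<in> J"
  shows "bad_ideal \<subseteq> J"
proof
  fix p assume p: "p \<in> bad_ideal"
  have J0: "0 \<in> J" and Jadd: "\<And>p q. p \<in> J \<Longrightarrow> q \<in> J \<Longrightarrow> p + q \<in> J"
    and Jmult: "\<And>p q. p \<in> J \<Longrightarrow> pvars q \<subseteq> S \<Longrightarrow> q * p \<in> J"
    using J unfolding poly_ring_ideal_iff by simp_all
  have mono: "single \<mu> c \<in> J" if \<mu>: "\<not> std \<mu>" "keys \<mu> \<subseteq> S" for \<mu> c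
  proof -
    obtain v w \<nu> where vw: "bad v w" "\<mu> = single v 1 + single w 1 + \<nu>"
      using \<mu>(1) by (rule not_std_split)
    have "single \<mu> c = single \<nu> c * (pvar v * pvar w)"
      by (simp add: vw(2) pvar_mult_pvar mult_single add.commute)
    moreover have "pvars (single \<nu> c) \<subseteq> S"
      by (rule order_trans[OF pvars_single_subset]) (use \<mu>(2) in \<open>auto simp: vw(2) keys_add_nat\<close>)
    ultimately show ?thesis using Jmult[OF gens[OF vw(1)]] by simp
  qed
  have sum: "(\<Sum>i\<in>A. f i) \<in> J" if "\<And>i. i \<in> A \<Longrightarrow> f i \<in> J" for A and f :: "('f \<Rightarrow>\<^sub>0 nat) \<Rightarrow> (('f \<Rightarrow>\<^sub>0 nat) \<Rightarrow>\<^sub>0 'k)"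
    using that by (induction A rule: infinite_finite_induct) (auto simp: J0 Jadd)
  have "(\<Sum>\<mu>\<in>keys p. single \<mu> (lookup p \<mu>)) \<in> J"
    by (intro sum mono) (use p in \<open>auto simp: bad_ideal_def pvars_def\<close>)
  then show "p \<in> J" by (simp flip: poly_mapping_sum_singles)
qed

lemma bad_ideal_eq: "Idl\<^bsub>poly_ring S\<^esub> {pvar v * pvar w | v w. bad v w} = bad_ideal"
proof -
  interpret R: cring "poly_ring S :: (('f \<Rightarrow>\<^sub>0 nat) \<Rightarrow>\<^sub>0 'k) ring" by (rule ring_poly_ring)
  let ?G = "{pvar v * pvar w | v w. bad v w} :: (('f \<Rightarrow>\<^sub>0 nat) \<Rightarrow>\<^sub>0 'k) set"
  have G: "?G \<subseteq> bad_ideal"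
    using not_std_pair bad(1,2)
    by (auto simp: bad_ideal_def pvar_mult_pvar[simplified] pvars_def keys_add_nat split: if_splits)
  have carr: "?G \<subseteq> carrier (poly_ring S)"
    using G by (auto simp: bad_ideal_def poly_ring_def)
  show ?thesis
  proof
    show "Idl\<^bsub>poly_ring S\<^esub> ?G \<subseteq> bad_ideal"
      by (rule R.genideal_minimal[OF ideal_bad_ideal G])
    show "bad_ideal \<subseteq> Idl\<^bsub>poly_ring S\<^esub> ?G"
      by (rule ideal_contains_bad_ideal[OF R.genideal_ideal[OF carr]])
         (rule subsetD[OF R.genideal_self[OF carr]], auto)
  qed
qed

lemma keys_polynomial: "pvars p \<subseteq> S \<Longrightarrow> \<mu> \<in> keys p \<Longrightarrow> keys \<mu> \<subseteq> S"
  by (auto simp: pvars_def)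

lemma pvars_initial_form: "pvars (initial_form \<omega> p) \<subseteq> pvars p"
  by (auto simp: pvars_def keys_initial_form)

text \<open>The induction runs on \<open>rk\<close> because the real-valued \<open>wt\<close> need
  not be well-founded. Standard monomials are returned unchanged, which makes their coefficients
  readable from the normal form of a polynomial.\<close>

lemma straightening:
  fixes wt :: "('f \<Rightarrow>\<^sub>0 nat) \<Rightarrow> real" and rk :: "'f \<Rightarrow> nat"
  assumes wt: "\<And>\<mu> \<nu>. wt (\<mu> + \<nu>) = wt \<mu> + wt \<nu>"
    and red: "\<And>v w. bad v w \<Longrightarrow> \<exists>q. pvars q \<subseteq> S \<and> v * w = peval emb (\<lambda>v. v) q \<and>
      (\<forall>\<nu>\<in>keys q. linear_weight rk \<nu> < rk v + rk w \<and>
         wt \<nu> < wt (single v 1 + single w 1))"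
  shows "keys \<mu> \<subseteq> S \<Longrightarrow> \<exists>q. pvars q \<subseteq> S \<and> peval emb (\<lambda>v. v) q = meval (\<lambda>v. v) \<mu> \<and>
    (\<forall>\<nu>\<in>keys q. std \<nu>) \<and>
    (if std \<mu> then q = single \<mu> 1 else \<forall>\<nu>\<in>keys q. wt \<nu> < wt \<mu>)"
proof (induction "linear_weight rk \<mu>" arbitrary: \<mu> rule: less_induct)
  case less
  show ?case
  proof (cases "std \<mu>")
    case True
    then show ?thesis using less.prems
      by (intro exI[of _ "single \<mu> 1"])
         (auto simp: peval_single hom_one intro: subsetD[OF pvars_single_subset, THEN subsetD[rotated]])
  next
    case False
    obtain v w \<rho> where vw: "bad v w" and \<mu>: "\<mu> = single v 1 + single w 1 + \<rho>"
      using False by (rule not_std_split)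
    obtain q where q: "pvars q \<subseteq> S" "v * w = peval emb (\<lambda>v. v) q"
      "\<And>\<nu>. \<nu> \<in> keys q \<Longrightarrow> linear_weight rk \<nu> < rk v + rk w"
      "\<And>\<nu>. \<nu> \<in> keys q \<Longrightarrow> wt \<nu> < wt (single v 1 + single w 1)"
      using red[OF vw] by auto
    have \<rho>: "keys \<rho> \<subseteq> S" using less.prems by (auto simp: \<mu> keys_add_nat)
    let ?P = "\<lambda>\<nu> r. pvars r \<subseteq> S \<and> peval emb (\<lambda>v. v) r = meval (\<lambda>v. v) (\<nu> + \<rho>) \<and>
      (\<forall>\<kappa>\<in>keys r. std \<kappa>) \<and>
      (if std (\<nu> + \<rho>) then r = single (\<nu> + \<rho>) 1
       else \<forall>\<kappa>\<in>keys r. wt \<kappa> < wt (\<nu> + \<rho>))"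
    have "\<forall>\<nu>\<in>keys q. \<exists>r. ?P \<nu> r"
    proof
      fix \<nu> assume \<nu>: "\<nu> \<in> keys q"
      show "\<exists>r. ?P \<nu> r"
        by (rule less.hyps) (use q(3)[OF \<nu>] keys_polynomial[OF q(1) \<nu>] \<rho> in \<open>auto simp: \<mu> keys_add_nat\<close>)
    qed
    from bchoice[OF this] obtain r where r: "\<forall>\<nu>\<in>keys q. ?P \<nu> (r \<nu>)" by blast
    \<comment> \<open>Inside the monomial, \<open>v * w\<close> is replaced by its reduction
      \<open>q\<close>, and each resulting monomial \<open>\<nu> + \<rho>\<close> by its normal
      form.\<close>
    define R where "R = (\<Sum>\<nu>\<in>keys q. single 0 (lookup q \<nu>) * r \<nu>)"
    have keysR: "\<exists>\<nu>\<in>keys q. \<kappa> \<in> keys (r \<nu>)" if \<kappa>: "\<kappa> \<in> keys R" for \<kappa>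
    proof -
      obtain \<nu> where \<nu>: "\<nu> \<in> keys q"
        "\<kappa> \<in> keys (single 0 (lookup q \<nu>) * r \<nu>)"
        using subsetD[OF Poly_Mapping.keys_sum \<kappa>[unfolded R_def]] by auto
      from subsetD[OF keys_mult \<nu>(2)] \<nu>(1) show ?thesis by (auto split: if_splits)
    qed
    have lower: "wt \<kappa> \<le> wt (\<nu> + \<rho>)" if "\<nu> \<in> keys q" "\<kappa> \<in> keys (r \<nu>)" for \<nu> \<kappa>
      using r[rule_format, OF that(1)] that(2) by (auto split: if_splits)
    have "pvars R \<subseteq> S" unfolding R_def by (intro pvars_sum pvars_multI pvars_constI) (use r in blast)
    moreover have "peval emb (\<lambda>v. v) R = meval (\<lambda>v. v) \<mu>"
    proof -
      have "peval emb (\<lambda>v. v) R =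
          (\<Sum>\<nu>\<in>keys q. emb (lookup q \<nu>) * meval (\<lambda>v. v) (\<nu> + \<rho>))"
        using r by (simp add: R_def peval_sum peval_mult peval_single)
      also have "\<dots> = peval emb (\<lambda>v. v) q * meval (\<lambda>v. v) \<rho>"
        by (simp add: peval_def meval_add sum_distrib_right mult.assoc)
      finally show ?thesis by (simp add: \<mu> meval_add meval_single flip: q(2))
    qed
    moreover have "\<forall>\<kappa>\<in>keys R. std \<kappa>"
    proof
      fix \<kappa> assume "\<kappa> \<in> keys R"
      then obtain \<nu> where "\<nu> \<in> keys q" "\<kappa> \<in> keys (r \<nu>)" using keysR by auto
      then show "std \<kappa>" using r by simp
    qed
    moreover have "\<forall>\<kappa>\<in>keys R. wt \<kappa> < wt \<mu>"
    proof
      fix \<kappa> assume "\<kappa> \<in> keys R"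
      then obtain \<nu> where \<nu>: "\<nu> \<in> keys q" "\<kappa> \<in> keys (r \<nu>)" using keysR by auto
      from lower[OF \<nu>] q(4)[OF \<nu>(1)] show "wt \<kappa> < wt \<mu>" by (simp add: \<mu> wt)
    qed
    ultimately show ?thesis using False by (intro exI[of _ R]) simp
  qed
qed

text \<open>Suppose that a term of largest weight in a relation is standard. Its coefficient
  survives in the normal form of the relation, as other standard monomials stay where they are and
  nonstandard ones contribute smaller weights only; but the normal form is zero by
  \<open>LI\<close>. Conversely, subtracting its reduction from a bad product gives a relation whose
  initial form is this product.\<close>

lemma initial_ideal_eq_bad_ideal:
  fixes \<omega> :: "'f \<Rightarrow>\<^sub>0 real" and rk :: "'f \<Rightarrow> nat"
  assumes red: "\<And>v w. bad v w \<Longrightarrow> \<exists>q. pvars q \<subseteq> S \<and> v * w = peval emb (\<lambda>v. v) q \<and>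
      (\<forall>\<nu>\<in>keys q. linear_weight rk \<nu> < rk v + rk w \<and>
         weight \<omega> \<nu> < weight \<omega> (single v 1 + single w 1))"
    and LI: "\<And>p. p \<in> relations \<Longrightarrow> (\<And>\<mu>. \<mu> \<in> keys p \<Longrightarrow> std \<mu>) \<Longrightarrow> p = 0"
  shows "initial_ideal S \<omega> relations = bad_ideal"
proof -
  interpret R: cring "poly_ring S :: (('f \<Rightarrow>\<^sub>0 nat) \<Rightarrow>\<^sub>0 'k) ring" by (rule ring_poly_ring)
  have init: "initial_form \<omega> p \<in> bad_ideal" if p: "p \<in> relations" for p
  proof -
    let ?K = "keys p" and ?wt = "linear_weight (lookup \<omega>)"
    have pS: "pvars p \<subseteq> S" and p0: "peval emb (\<lambda>v. v) p = 0" using p by (auto simp: relations_def)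
    let ?P = "\<lambda>\<mu> q. pvars q \<subseteq> S \<and> peval emb (\<lambda>v. v) q = meval (\<lambda>v. v) \<mu> \<and>
      (\<forall>\<nu>\<in>keys q. std \<nu>) \<and>
      (if std \<mu> then q = single \<mu> 1 else \<forall>\<nu>\<in>keys q. weight \<omega> \<nu> < weight \<omega> \<mu>)"
    have "\<forall>\<mu>\<in>?K. \<exists>q. ?P \<mu> q"
      by (intro ballI straightening[OF _ red] keys_polynomial[OF pS]) (simp_all add: weight_eq)
    from bchoice[OF this] obtain r where r: "\<forall>\<mu>\<in>?K. ?P \<mu> (r \<mu>)" by blast
    define R where "R = (\<Sum>\<mu>\<in>?K. single 0 (lookup p \<mu>) * r \<mu>)"
    have "pvars R \<subseteq> S" unfolding R_def by (intro pvars_sum pvars_multI pvars_constI) (use r in blast)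
    moreover have "peval emb (\<lambda>v. v) R = peval emb (\<lambda>v. v) p"
      using r by (simp add: R_def peval_sum peval_mult peval_single) (simp add: peval_def)
    ultimately have "R \<in> relations" by (simp add: relations_def p0)
    have "R = 0"
    proof (rule LI[OF \<open>R \<in> relations\<close>])
      fix \<kappa> assume "\<kappa> \<in> keys R"
      from subsetD[OF Poly_Mapping.keys_sum this[unfolded R_def]]
      obtain \<mu> where \<mu>: "\<mu> \<in> ?K" "\<kappa> \<in> keys (single 0 (lookup p \<mu>) * r \<mu>)"
        by auto
      from subsetD[OF keys_mult \<mu>(2)] r \<mu>(1) show "std \<kappa>" by (auto split: if_splits)
    qed
    have "\<not> std \<mu>" if \<mu>: "\<mu> \<in> ?K" "\<forall>\<nu>\<in>?K. weight \<omega> \<nu> \<le> weight \<omega> \<mu>" for \<mu>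
    proof
      assume "std \<mu>"
      have scale: "lookup (single 0 c * q) k = c * lookup q k"
        for c :: 'k and q :: "('f \<Rightarrow>\<^sub>0 nat) \<Rightarrow>\<^sub>0 'k" and k
        by (simp add: mult_map_scale_conv_mult[symmetric] Poly_Mapping.map.rep_eq when_def)
      \<comment> \<open>The two ways in which another monomial of \<open>p\<close> fails to
        contribute to the coefficient of \<open>\<mu>\<close>.\<close>
      have other: "lookup (r \<nu>) \<mu> = 0" if \<nu>: "\<nu> \<in> ?K - {\<mu>}" for \<nu>
      proof (cases "std \<nu>")
        case True
        then have "r \<nu> = single \<nu> 1" using r \<nu> by simp
        then show ?thesis using \<nu> by (simp add: lookup_single)
      next
        case False
        then have "\<forall>\<kappa>\<in>keys (r \<nu>). weight \<omega> \<kappa> < weight \<omega> \<nu>" using r \<nu> by simp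
        moreover have "weight \<omega> \<nu> \<le> weight \<omega> \<mu>" using \<mu>(2) \<nu> by simp
        ultimately have "\<mu> \<notin> keys (r \<nu>)" by (meson not_less)
        then show ?thesis by (simp add: in_keys_iff)
      qed
      have "lookup R \<mu> = (\<Sum>\<nu>\<in>?K. lookup p \<nu> * lookup (r \<nu>) \<mu>)"
        by (simp add: R_def lookup_sum scale)
      also have "\<dots> = lookup p \<mu> * lookup (r \<mu>) \<mu>"
        using \<mu>(1) other by (subst sum.remove[of _ \<mu>]) auto
      also have "r \<mu> = single \<mu> 1" using r \<mu>(1) \<open>std \<mu>\<close> by simp
      finally show False using \<open>R = 0\<close> \<mu>(1) by (simp add: in_keys_iff)
    qed
    then show ?thesis using pS unfolding bad_ideal_def
      by (auto simp: keys_initial_form pvars_def)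
  qed
  have carr: "initial_form \<omega> ` relations \<subseteq> carrier (poly_ring S)"
    using init by (auto simp: bad_ideal_def poly_ring_def)
  show ?thesis
  proof
    show "initial_ideal S \<omega> relations \<subseteq> bad_ideal"
      unfolding initial_ideal_def by (rule R.genideal_minimal[OF ideal_bad_ideal]) (use init in auto)
    show "bad_ideal \<subseteq> initial_ideal S \<omega> relations"
      unfolding initial_ideal_def
    proof (rule ideal_contains_bad_ideal[OF R.genideal_ideal[OF carr]])
      fix v w assume vw: "bad v w"
      let ?\<mu> = "single v 1 + single w 1 :: 'f \<Rightarrow>\<^sub>0 nat"
      obtain q where q: "pvars q \<subseteq> S" "v * w = peval emb (\<lambda>v. v) q"
        "\<And>\<nu>. \<nu> \<in> keys q \<Longrightarrow> weight \<omega> \<nu> < weight \<omega> ?\<mu>"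
        using red[OF vw] by auto
      define p where "p = pvar v * pvar w - q"
      have "p \<in> relations"
        unfolding relations_def p_def using bad(1,2)[OF vw] q(1,2)
        by (simp add: pvars_diffI pvars_multI pvars_pvarI peval_diff peval_mult)
      moreover have "initial_form \<omega> p = pvar v * pvar w"
      proof (rule poly_mapping_eqI)
        fix \<kappa>
        have q0: "lookup q ?\<mu> = 0" using q(3)[of ?\<mu>] by (auto simp: in_keys_iff)
        have lp: "lookup p \<kappa> = (if \<kappa> = ?\<mu> then 1 else - lookup q \<kappa>)" for \<kappa>
          using q0 by (simp add: p_def pvar_mult_pvar lookup_minus lookup_single when_def)
        have le: "weight \<omega> \<nu> \<le> weight \<omega> ?\<mu>" if "\<nu> \<in> keys p" for \<nu>
          using q(3)[of \<nu>] that by (auto simp: in_keys_iff lp split: if_splits)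
        have top: "?\<mu> \<in> keys p" by (simp add: in_keys_iff lp)
        show "lookup (initial_form \<omega> p) \<kappa> = lookup (pvar v * pvar w) \<kappa>"
        proof (cases "\<kappa> = ?\<mu>")
          case True
          then show ?thesis using le by (simp add: lookup_initial_form lp pvar_mult_pvar)
        next
          case False
          have "lookup q \<kappa> = 0" if "\<forall>\<nu>\<in>keys p. weight \<omega> \<nu> \<le> weight \<omega> \<kappa>"
            using that[rule_format, OF top] q(3)[of \<kappa>] by (auto simp: in_keys_iff)
          then show ?thesis
            using False by (simp add: lookup_initial_form lp pvar_mult_pvar lookup_single when_def)
        qed
      qed
      ultimately have "pvar v * pvar w \<in> initial_form \<omega> ` relations" by (metis image_eqI)
      then show "pvar v * pvar w \<in> Idl\<^bsub>poly_ring S\<^esub> (initial_form \<omega> ` relations)"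
        by (rule subsetD[OF R.genideal_self[OF carr]])
    qed
  qed
qed

text \<open>The only nonstandard monomial of the relation \<open>v w - q\<close> is
  \<open>v w\<close>. Its initial form consists of nonstandard monomials, so \<open>v w\<close> has
  the largest weight.\<close>

lemma initial_ideal_weights:
  assumes eq: "initial_ideal S \<omega> relations = bad_ideal"
    and vw: "bad v w" and q: "pvars q \<subseteq> S" "v * w = peval emb (\<lambda>v. v) q"
    and std: "\<And>\<nu>. \<nu> \<in> keys q \<Longrightarrow> std \<nu>" and \<nu>: "\<nu> \<in> keys q"
  shows "weight \<omega> \<nu> \<le> weight \<omega> (single v 1 + single w 1)"
proof -
  interpret R: cring "poly_ring S :: (('f \<Rightarrow>\<^sub>0 nat) \<Rightarrow>\<^sub>0 'k) ring" by (rule ring_poly_ring)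
  let ?\<mu> = "single v 1 + single w 1 :: 'f \<Rightarrow>\<^sub>0 nat"
  define p where "p = pvar v * pvar w - q"
  have p: "p \<in> relations"
    unfolding relations_def p_def using bad(1,2)[OF vw] q(1,2)
    by (simp add: pvars_diffI pvars_multI pvars_pvarI peval_diff peval_mult)
  have "\<not> std ?\<mu>" by (rule not_std_pair[OF vw])
  have key: "\<kappa> \<in> keys p \<longleftrightarrow> \<kappa> = ?\<mu> \<or> \<kappa> \<in> keys q" for \<kappa>
  proof (cases "\<kappa> = ?\<mu>")
    case True
    then have "lookup q \<kappa> = 0" using std[of \<kappa>] \<open>\<not> std ?\<mu>\<close> by (auto simp: in_keys_iff)
    then show ?thesis using True by (simp add: in_keys_iff p_def pvar_mult_pvar lookup_minus)
  next
    case False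
    then show ?thesis by (simp add: in_keys_iff p_def pvar_mult_pvar lookup_minus lookup_single)
  qed
  have "initial_form \<omega> ` relations \<subseteq> carrier (poly_ring S)"
    by (auto simp: relations_def poly_ring_def dest: subsetD[OF pvars_initial_form])
  from subsetD[OF R.genideal_self[OF this] imageI[OF p]] have "initial_form \<omega> p \<in> bad_ideal"
    using eq by (simp add: initial_ideal_def)
  then have bad_top: "\<not> std \<kappa>" if "\<kappa> \<in> keys (initial_form \<omega> p)" for \<kappa>
    using that by (simp add: bad_ideal_def)
  have "Max (weight \<omega> ` keys p) \<in> weight \<omega> ` keys p"
    by (intro Max_in) (use key \<nu> in auto)
  then obtain \<kappa> where \<kappa>: "\<kappa> \<in> keys p" "weight \<omega> \<kappa> = Max (weight \<omega> ` keys p)" by auto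
  have max: "weight \<omega> \<rho> \<le> weight \<omega> \<kappa>" if "\<rho> \<in> keys p" for \<rho>
    unfolding \<kappa>(2) by (intro Max_ge) (use that in auto)
  then have "\<kappa> \<in> keys (initial_form \<omega> p)" using \<kappa>(1) by (simp add: keys_initial_form)
  then have "\<kappa> = ?\<mu>" using bad_top std \<kappa>(1) key by auto
  then show ?thesis using max[of \<nu>] \<nu> key by simp
qed

end

section \<open>Continuity on the weight space, and the lineality space\<close>

lemma lookup_scaleR: "lookup (r *\<^sub>R a) k = r *\<^sub>R lookup a k"
proof -
  have "finite {i. r *\<^sub>R lookup a i \<noteq> 0}"
    by (rule finite_subset[of _ "keys a"]) (auto simp: in_keys_iff)
  then show ?thesis by (simp add: scaleR_poly_mapping_def)
qed

lemma norm_lookup_le: "norm (lookup a k) \<le> norm a"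
proof -
  have eq: "norm a = (\<Sum>i\<in>keys a. norm (lookup a i))"
    by (simp add: norm_poly_mapping_def dist_poly_mapping_def)
  show ?thesis
  proof (cases "k \<in> keys a")
    case True
    then show ?thesis unfolding eq by (intro member_le_sum) auto
  qed (simp add: in_keys_iff)
qed

lemma bounded_linear_lookup: "bounded_linear (\<lambda>a. lookup a k)"
  by (rule bounded_linear_intro[where K = 1])
     (auto simp: lookup_add lookup_scaleR norm_lookup_le)

lemma continuous_on_weight: "continuous_on A (\<lambda>\<omega>. weight \<omega> \<mu>)"
  unfolding weight_def by (intro continuous_intros bounded_linear.continuous_on[OF bounded_linear_lookup])

lemma weight_add: "weight (a + b) \<mu> = weight a \<mu> + weight b \<mu>"
  by (simp add: weight_def lookup_add distrib_left sum.distrib)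

lemma weight_scaleR: "weight (r *\<^sub>R a) \<mu> = r * weight a \<mu>"
  by (simp add: weight_def lookup_scaleR sum_distrib_left mult_ac)

lemma weight_uminus: "weight (- a) \<mu> = - weight a \<mu>"
  using weight_scaleR[of "-1" a \<mu>] by simp

lemma closed_weight_le: "closed {\<omega>. weight \<omega> \<mu> \<le> weight \<omega> \<nu>}"
  by (intro closed_Collect_le continuous_on_weight)

lemma closed_support: "closed {\<omega> :: 'v \<Rightarrow>\<^sub>0 real. keys \<omega> \<subseteq> S}"
proof -
  have "{\<omega> :: 'v \<Rightarrow>\<^sub>0 real. keys \<omega> \<subseteq> S} = (\<Inter>v\<in>-S. {\<omega>. lookup \<omega> v = 0})"
    by (auto simp: in_keys_iff)
  also have "closed \<dots>"
    by (intro closed_INT ballI closed_Collect_eq bounded_linear.continuous_on[OF bounded_linear_lookup]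
        continuous_on_id continuous_on_const)
  finally show ?thesis .
qed

text \<open>Adding \<open>u \<in> U\<close> to a positive multiple of one interior weight stays in the interior, and the
  multiple may tend to zero.\<close>

theorem (in incompatibility) lineality_space_eq:
  fixes rk :: "'f \<Rightarrow> nat" and U :: "('f \<Rightarrow>\<^sub>0 real) set"
  assumes U: "subspace U" "\<And>u. u \<in> U \<Longrightarrow> keys u \<subseteq> S"
    and red: "\<And>v w. bad v w \<Longrightarrow> \<exists>q. pvars q \<subseteq> S \<and> v * w = peval emb (\<lambda>v. v) q \<and>
      (\<forall>\<nu>\<in>keys q. linear_weight rk \<nu> < rk v + rk w \<and>
         (\<forall>u\<in>U. weight u \<nu> = weight u (single v 1 + single w 1)))"
    and LI: "\<And>p. p \<in> relations \<Longrightarrow> (\<And>\<mu>. \<mu> \<in> keys p \<Longrightarrow> std \<mu>) \<Longrightarrow> p = 0"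
    and solve: "\<And>\<omega>. keys \<omega> \<subseteq> S \<Longrightarrow>
      (\<And>v w q \<nu>. bad v w \<Longrightarrow> pvars q \<subseteq> S \<Longrightarrow> v * w = peval emb (\<lambda>v. v) q \<Longrightarrow>
        (\<And>\<mu>. \<mu> \<in> keys q \<Longrightarrow> std \<mu>) \<Longrightarrow> \<nu> \<in> keys q \<Longrightarrow>
        weight \<omega> \<nu> = weight \<omega> (single v 1 + single w 1)) \<Longrightarrow> \<omega> \<in> U"
  shows "lineality_space (closure {\<omega>. keys \<omega> \<subseteq> S \<and> initial_ideal S \<omega> relations = bad_ideal}) = U"
proof -
  let ?G = "{\<omega>. keys \<omega> \<subseteq> S \<and> initial_ideal S \<omega> relations = bad_ideal}"
  let ?pair = "\<lambda>v w. single v 1 + single w 1 :: 'f \<Rightarrow>\<^sub>0 nat"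
  \<comment> \<open>The rank, read as a weight vector, makes every reduction strictly decreasing,
    whereas the vectors of \<open>U\<close> do not distinguish its two sides.\<close>
  define W where "W = (\<Sum>v\<in>S. single v (real (rk v)))"
  have lW: "lookup W v = (if v \<in> S then real (rk v) else 0)" for v
    using finite_S by (simp add: W_def lookup_sum lookup_single when_def)
  have wW: "weight W \<mu> = real (linear_weight rk \<mu>)" if "keys \<mu> \<subseteq> S" for \<mu>
    unfolding weight_def linear_weight_def of_nat_sum
    by (rule sum.cong) (use that in \<open>auto simp: lW\<close>)
  have G: "t *\<^sub>R W + u \<in> ?G" if t: "0 < t" and u: "u \<in> U" for t u
  proof -
    have "keys (t *\<^sub>R W + u) \<subseteq> S"
    proof
      fix v assume "v \<in> keys (t *\<^sub>R W + u)"
      then show "v \<in> S" using U(2)[OF u]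
        by (auto simp: in_keys_iff lookup_add lookup_scaleR lW split: if_splits)
    qed
    moreover have "initial_ideal S (t *\<^sub>R W + u) relations = bad_ideal"
    proof (rule initial_ideal_eq_bad_ideal[OF _ LI])
      fix v w assume vw: "bad v w"
      obtain q where q: "pvars q \<subseteq> S" "v * w = peval emb (\<lambda>v. v) q"
        "\<forall>\<nu>\<in>keys q. linear_weight rk \<nu> < rk v + rk w \<and>
          (\<forall>u\<in>U. weight u \<nu> = weight u (?pair v w))"
        using red[OF vw] by auto
      have "keys (?pair v w) \<subseteq> S"
        using bad(1,2)[OF vw] by (auto simp: keys_add_nat)
      from wW[OF this] have pair: "weight W (?pair v w) = real (rk v + rk w)" by simp
      have "weight (t *\<^sub>R W + u) \<nu> < weight (t *\<^sub>R W + u) (?pair v w)"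
        if \<nu>: "\<nu> \<in> keys q" for \<nu>
        using q(3)[rule_format, OF \<nu>] u t wW[OF keys_polynomial[OF q(1) \<nu>]]
        by (simp only: weight_add weight_scaleR pair) simp
      with q show "\<exists>q. pvars q \<subseteq> S \<and> v * w = peval emb (\<lambda>v. v) q \<and>
        (\<forall>\<nu>\<in>keys q. linear_weight rk \<nu> < rk v + rk w \<and>
          weight (t *\<^sub>R W + u) \<nu> < weight (t *\<^sub>R W + u) (?pair v w))"
        by (intro exI[of _ q]) simp
    qed
    ultimately show ?thesis by simp
  qed
  have sub: "u \<in> closure ?G" if u: "u \<in> U" for u
    unfolding closure_approachable
  proof (intro allI impI)
    fix e :: real assume e: "0 < e"
    define t where "t = e / (2 * (norm W + 1))"
    have pos: "0 < norm W + 1" using norm_ge_zero[of W] by linarith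
    have t: "0 < t" using e pos by (simp add: t_def)
    have "t * norm W < t * (2 * (norm W + 1))"
      using t pos by (intro mult_strict_left_mono) auto
    also have "\<dots> = e" using pos by (simp add: t_def)
    finally have "dist (t *\<^sub>R W + u) u < e" using t by (simp add: dist_norm)
    then show "\<exists>y\<in>?G. dist y u < e" using G[OF t u] by (intro bexI[of _ "t *\<^sub>R W + u"])
  qed
  show ?thesis
  proof
    show "U \<subseteq> lineality_space (closure ?G)"
    proof
      fix u assume u: "u \<in> U"
      then have "- u \<in> U" by (rule subspace_neg[OF U(1)])
      from sub[OF this] have "u \<in> uminus ` closure ?G" by (intro image_eqI[of _ _ "- u"]) simp_all
      then show "u \<in> lineality_space (closure ?G)" using sub[OF u] by (simp add: lineality_space_def)
    qed
    show "lineality_space (closure ?G) \<subseteq> U"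
    proof
      fix \<omega> assume "\<omega> \<in> lineality_space (closure ?G)"
      then have \<omega>: "\<omega> \<in> closure ?G" "- \<omega> \<in> closure ?G" by (auto simp: lineality_space_def)
      have "closure ?G \<subseteq> {\<omega>. keys \<omega> \<subseteq> S}"
        by (intro closure_minimal closed_support) auto
      then have "keys \<omega> \<subseteq> S" using \<omega>(1) by auto
      then show "\<omega> \<in> U"
      proof (rule solve)
        fix v w q \<nu>
        assume *: "bad v w" "pvars q \<subseteq> S" "v * w = peval emb (\<lambda>v. v) q"
          "\<And>\<mu>. \<mu> \<in> keys q \<Longrightarrow> std \<mu>" "\<nu> \<in> keys q"
        \<comment> \<open>This half-space is closed and so contains the whole cone. Holding for both
          \<open>\<omega>\<close> and \<open>- \<omega>\<close>, the inequality becomes an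
          equation.\<close>
        have "?G \<subseteq> {\<omega>. weight \<omega> \<nu> \<le> weight \<omega> (?pair v w)}"
          using initial_ideal_weights[OF _ *] by auto
        then have le: "closure ?G \<subseteq> {\<omega>. weight \<omega> \<nu> \<le> weight \<omega> (?pair v w)}"
          by (intro closure_minimal closed_weight_le)
        from subsetD[OF le \<omega>(1)] subsetD[OF le \<omega>(2)]
        show "weight \<omega> \<nu> = weight \<omega> (?pair v w)" by (simp add: weight_uminus)
      qed
    qed
  qed
qed

section \<open>The abstract setting applied to a seed\<close>

lemma relation_ideal_eq:
  "relation_ideal emb n m s = {p. pvars p \<subseteq> all_vars n m s \<and> peval emb (\<lambda>v. v) p = 0}"
  by (auto simp: relation_ideal_def a_kernel_def kernel_def poly_ring_def cluster_algebra_def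
      eval_poly_eq_peval)

definition incompatible :: "nat \<Rightarrow> nat \<Rightarrow> 'f::field seed \<Rightarrow> 'f \<Rightarrow> 'f \<Rightarrow> bool" where
  "incompatible n m s v w \<longleftrightarrow> v \<in> cluster_vars n m s \<and> w \<in> cluster_vars n m s \<and>
    \<not> (\<exists>X\<in>clusters n m s. v \<in> X \<and> w \<in> X)"

lemma incompatibility_seed:
  assumes "field_embedding emb" "finite (all_vars n m s)"
  shows "incompatibility emb (all_vars n m s) (incompatible n m s)"
proof
  \<comment> \<open>Every cluster variable lies in some cluster and is therefore compatible with
    itself.\<close>
  show "v \<noteq> w" if "incompatible n m s v w" for v w
    using that by (auto simp: incompatible_def cluster_vars_def)
qed (use assms in \<open>auto simp: incompatible_def all_vars_def\<close>)

lemma groebner_cone_eq: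
  assumes "incompatibility emb (all_vars n m s) (incompatible n m s)"
  shows "groebner_cone emb n m s = closure {\<omega>. keys \<omega> \<subseteq> all_vars n m s \<and>
    initial_ideal (all_vars n m s) \<omega> (incompatibility.relations emb (all_vars n m s)) =
    incompatibility.bad_ideal (all_vars n m s) (incompatible n m s)}"
proof -
  interpret incompatibility emb "all_vars n m s" "incompatible n m s" by (rule assms)
  have "(incompatibility_ideal n m s :: (('b \<Rightarrow>\<^sub>0 nat) \<Rightarrow>\<^sub>0 'a) set) = bad_ideal"
    unfolding bad_ideal_eq[symmetric] incompatibility_ideal_def incompatible_def ..
  then show ?thesis by (simp add: groebner_cone_def relation_ideal_eq relations_def)
qed

lemma cluster_alg_indep:
  fixes emb :: "'k::field_char_0 \<Rightarrow> 'f::field"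
  assumes "field_embedding emb" "is_seed emb n m s" "X \<in> clusters n m s"
    and "inj_on G H" "G ` H \<subseteq> X \<union> frozen_vars n m s"
  shows "alg_indep emb H G"
proof -
  interpret coeff_hom emb using assms(1) by (rule field_embedding_coeff_hom)
  obtain t where t: "t \<in> seeds n m s" "X = seed_var t ` {..<n}"
    using assms(3) by (auto simp: clusters_def)
  note props = seed_properties[OF assms(1,2) t(1)]
  have "frozen_vars n m s = seed_var t ` {n..<m}"
    unfolding frozen_vars_def by (rule image_cong) (use props(3) in auto)
  moreover have "n \<le> m" using assms(2) by (simp add: is_seed_def)
  ultimately have "X \<union> frozen_vars n m s = seed_var t ` {..<m}"
    by (simp add: t(2) ivl_disj_un_one(2) flip: image_Un)
  then show ?thesis using assms(4,5) by (intro alg_indep_family[OF props(1)]) auto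
qed

section \<open>Fan coordinates\<close>

text \<open>Index \<open>0\<close> is for the common factor, \<open>j\<close> and
  \<open>H + j\<close> are for the two coordinates of vertex \<open>j\<close>. The gaps belong to
  the vertices \<open>1\<close> and \<open>H + 1\<close>, whose coordinates are constant.\<close>

definition fan_index :: "nat \<Rightarrow> nat set" where
  "fan_index H = {0} \<union> {2..H} \<union> {H + 2..2 * H}"

text \<open>\<open>\<tau> ^ d\<close> is the Pluecker coordinate of the two extreme vertices of the fan, \<open>p j\<close> and \<open>q j\<close> those
  of the \<open>j\<close>-th vertex with the first and the last one, and \<open>c j\<close> those of consecutive vertices.\<close>

lemma fan_alg_indep:
  fixes emb :: "'k::field_char_0 \<Rightarrow> 'f::field" and \<tau> :: 'f
  assumes emb: "field_embedding emb"
    and ind: "alg_indep emb (fan_index H) (\<lambda>i. if i = 0 then \<tau> else if i \<le> H then c i else p (i - H))"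
    and H: "2 \<le> H" and qH: "q H = c H"
    and q: "\<And>j. 2 \<le> j \<Longrightarrow> j < H \<Longrightarrow> p (Suc j) * q j = p j * q (Suc j) + \<tau> ^ d * c j"
  shows "alg_indep emb (fan_index H)
    (\<lambda>i. if i = 0 then \<tau> else if i \<le> H then q i / \<tau> ^ d else p (i - H) / \<tau> ^ d)"
proof -
  interpret coeff_hom emb using emb by (rule field_embedding_coeff_hom)
  note moebius = alg_indep_moebius[OF coeff_hom_axioms field_embedding_infinite[OF emb]]
  \<comment> \<open>In \<open>?F k\<close> the entries \<open>c i\<close> with
    \<open>k \<le> i\<close> have been exchanged for \<open>q i\<close>. The exchange proceeds from
    the top down, since Ptolemy's relation yields \<open>q j\<close> from \<open>q (Suc j)\<close>
    and \<open>c j\<close>, starting with \<open>q H = c H\<close>.\<close>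
  let ?F = "\<lambda>k i. if i = 0 then \<tau> else if i \<le> H then if k \<le> i then q i else c i else p (i - H)"
  have change: "alg_indep emb (fan_index H) (?F j)"
    if j: "2 \<le> j" "j < H" and IH: "alg_indep emb (fan_index H) (?F (Suc j))" for j
  proof -
    have mem: "j \<in> fan_index H" "Suc j \<in> fan_index H - {j}" "0 \<in> fan_index H - {j}"
      "H + j \<in> fan_index H - {j}" "H + Suc j \<in> fan_index H - {j}"
      using j by (auto simp: fan_index_def)
    have p_nz: "p (Suc j) \<noteq> 0"
      using alg_indep_nonzero[OF IH, of "H + Suc j"] mem j by simp
    have D_nz: "\<tau> \<noteq> 0" using alg_indep_nonzero[OF IH, of 0] mem by simp
    have "alg_indep emb (fan_index H) ((?F (Suc j))(j := q j))"
    \<comment> \<open>Solving \<open>q\<close> for \<open>q j\<close> gives an affine function of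
      \<open>c j\<close> with slope \<open>\<tau> ^ d / p (Suc j)\<close>.\<close>
    proof (rule moebius[where a = "pvar 0 ^ d" and b = "pvar (H + j) * pvar (Suc j)" and c = 0
          and d = "pvar (H + Suc j)", OF IH mem(1)])
      show "pvars (pvar 0 ^ d :: (nat \<Rightarrow>\<^sub>0 nat) \<Rightarrow>\<^sub>0 'k) \<subseteq> fan_index H - {j}"
        by (intro pvars_power pvars_pvarI mem)
      show "pvars (pvar (H + j) * pvar (Suc j) :: (nat \<Rightarrow>\<^sub>0 nat) \<Rightarrow>\<^sub>0 'k) \<subseteq> fan_index H - {j}"
        by (intro pvars_multI pvars_pvarI mem)
      show "pvars (pvar (H + Suc j) :: (nat \<Rightarrow>\<^sub>0 nat) \<Rightarrow>\<^sub>0 'k) \<subseteq> fan_index H - {j}"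
        by (intro pvars_pvarI mem)
    qed (use j p_nz D_nz q[OF j] in \<open>simp_all add: peval_mult peval_power algebra_simps\<close>)
    moreover have "(?F (Suc j))(j := q j) = ?F j"
      using j by (auto simp: fun_eq_iff)
    ultimately show ?thesis by simp
  qed
  have "alg_indep emb (fan_index H) (?F k)" if "k \<le> H" "2 \<le> k" for k
    using that
  proof (induction k rule: inc_induct)
    case base
    have "?F H = (\<lambda>i. if i = 0 then \<tau> else if i \<le> H then c i else p (i - H))"
      using qH by (auto simp: fun_eq_iff)
    then show ?case using ind by simp
  next
    case (step k)
    then show ?case using change[of k] by simp
  qed
  then have ind2: "alg_indep emb (fan_index H) (?F 2)" using H by simp
  let ?J = "{2..H} \<union> {H + 2..2 * H}"
  \<comment> \<open>Division by \<open>\<tau> ^ d\<close> is a Moebius map too, applied to one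
    member after the other.\<close>
  have "alg_indep emb (fan_index H) (\<lambda>i. if i \<in> T then ?F 2 i / \<tau> ^ d else ?F 2 i)"
    if "finite T" "T \<subseteq> ?J" for T
    using that
  proof (induction T rule: finite_induct)
    case empty
    then show ?case using ind2 by simp
  next
    case (insert k T)
    let ?G = "\<lambda>i. if i \<in> T then ?F 2 i / \<tau> ^ d else ?F 2 i"
    have IH: "alg_indep emb (fan_index H) ?G" using insert by simp
    have k: "k \<in> fan_index H" "0 \<in> fan_index H - {k}" using insert.prems by (auto simp: fan_index_def)
    have "0 \<notin> T" using insert.prems by auto
    then have D_nz: "\<tau> \<noteq> 0" using alg_indep_nonzero[OF IH, of 0] k by simp
    have "alg_indep emb (fan_index H) (?G(k := ?G k / \<tau> ^ d))"
    proof (rule moebius[where a = 1 and b = 0 and c = 0 and d = "pvar 0 ^ d", OF IH k(1)])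
      show "pvars (pvar 0 ^ d :: (nat \<Rightarrow>\<^sub>0 nat) \<Rightarrow>\<^sub>0 'k) \<subseteq> fan_index H - {k}"
        by (intro pvars_power pvars_pvarI k)
    qed (use D_nz \<open>0 \<notin> T\<close> in \<open>simp_all add: peval_power\<close>)
    moreover have "?G(k := ?G k / \<tau> ^ d) = (\<lambda>i. if i \<in> insert k T then ?F 2 i / \<tau> ^ d else ?F 2 i)"
      using insert.hyps(2) by (intro ext) simp
    ultimately show ?case by simp
  qed
  from this[of ?J] have "alg_indep emb (fan_index H) (\<lambda>i. if i \<in> ?J then ?F 2 i / \<tau> ^ d else ?F 2 i)"
    by simp
  then show ?thesis
    by (subst alg_indep_cong[of _ _ "\<lambda>i. if i \<in> ?J then ?F 2 i / \<tau> ^ d else ?F 2 i"])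
       (auto simp: fan_index_def)
qed

text \<open>Vertex \<open>1\<close> has coordinates \<open>(0, 1)\<close> and vertex \<open>H + 1\<close> has coordinates \<open>(1, 0)\<close>. The variables are
  numbered so that the lexicographic order prefers \<open>\<beta>\<^sub>i\<close> to \<open>\<beta>\<^sub>j\<close> for \<open>i < j\<close> and every \<open>\<beta>\<^sub>i\<close> to every
  \<open>\<alpha>\<^sub>j\<close>.\<close>

definition beta :: "nat \<Rightarrow> nat \<Rightarrow> ((nat \<Rightarrow>\<^sub>0 nat) \<Rightarrow>\<^sub>0 'k::comm_ring_1)" where
  "beta H j = (if j = 1 then 1 else if j = Suc H then 0 else pvar j)"

definition alpha :: "nat \<Rightarrow> nat \<Rightarrow> ((nat \<Rightarrow>\<^sub>0 nat) \<Rightarrow>\<^sub>0 'k::comm_ring_1)" where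
  "alpha H j = (if j = 1 then 0 else if j = Suc H then 1 else pvar (H + j))"

definition beta_exp :: "nat \<Rightarrow> nat \<Rightarrow> (nat \<Rightarrow>\<^sub>0 nat)" where
  "beta_exp H j = (if j = 1 \<or> j = Suc H then 0 else single j 1)"

definition alpha_exp :: "nat \<Rightarrow> nat \<Rightarrow> (nat \<Rightarrow>\<^sub>0 nat)" where
  "alpha_exp H j = (if j = 1 \<or> j = Suc H then 0 else single (H + j) 1)"

lemma poly_mapping_lessI:
  fixes a b :: "nat \<Rightarrow>\<^sub>0 nat"
  assumes "lookup a k < lookup b k"
    "\<And>i. i < k \<Longrightarrow> lookup a i = lookup b i"
  shows "a < b"
  using assms by (auto simp: less_poly_mapping.rep_eq less_fun_def)

lemma leads_pvar: "leads (single i 1) (pvar i)"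
  unfolding pvar_def by (rule leads_single) simp

lemma leads_beta: "1 \<le> j \<Longrightarrow> j \<le> H \<Longrightarrow> leads (beta_exp H j) (beta H j)"
  using leads_pvar leads_one by (auto simp: beta_exp_def beta_def)

lemma leads_alpha: "2 \<le> j \<Longrightarrow> j \<le> Suc H \<Longrightarrow> leads (alpha_exp H j) (alpha H j)"
  using leads_pvar leads_one by (auto simp: alpha_exp_def alpha_def)

lemma keys_pvar: "\<mu> \<in> keys (pvar i) \<Longrightarrow> \<mu> = single i 1"
  by (simp add: pvar_def split: if_splits)

lemma keys_alpha: "\<mu> \<in> keys (alpha H j) \<Longrightarrow> \<mu> = alpha_exp H j \<and> j \<noteq> 1"
  by (auto simp: alpha_def alpha_exp_def dest!: keys_pvar split: if_splits)

lemma keys_beta: "1 \<le> H \<Longrightarrow> \<mu> \<in> keys (beta H j) \<Longrightarrow> \<mu> = beta_exp H j \<and> j \<noteq> Suc H"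
  by (auto simp: beta_def beta_exp_def dest!: keys_pvar split: if_splits)

lemma keys_multD:
  assumes "\<mu> \<in> keys (p * q)"
  obtains a b where "\<mu> = a + b" "a \<in> keys p" "b \<in> keys q"
  using subsetD[OF keys_mult assms] by auto

text \<open>The most significant variable in sight is number \<open>i\<close>, and only the first
  product contains it. For \<open>i = 1\<close> it is missing, but then \<open>alpha H 1 = 0\<close>
  removes the second product.\<close>

lemma leads_minor:
  assumes "1 \<le> i" "i < j" "j \<le> Suc H"
  shows "leads (beta_exp H i + alpha_exp H j)
    (beta H i * alpha H j - alpha H i * beta H j :: (nat \<Rightarrow>\<^sub>0 nat) \<Rightarrow>\<^sub>0 'k::field)"
proof -
  have "leads (beta_exp H i + alpha_exp H j) (beta H i * alpha H j + - (alpha H i * beta H j)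
      :: (nat \<Rightarrow>\<^sub>0 nat) \<Rightarrow>\<^sub>0 'k::field)"
  proof (rule leads_add_lower)
    fix \<mu> assume "\<mu> \<in> keys (- (alpha H i * beta H j :: (nat \<Rightarrow>\<^sub>0 nat) \<Rightarrow>\<^sub>0 'k))"
    then have "\<mu> \<in> keys (alpha H i * beta H j :: (nat \<Rightarrow>\<^sub>0 nat) \<Rightarrow>\<^sub>0 'k)"
      by (simp add: in_keys_iff)
    then have "\<mu> = alpha_exp H i + beta_exp H j" "i \<noteq> 1" "j \<noteq> Suc H"
      using assms by (auto elim!: keys_multD dest!: keys_alpha keys_beta[rotated])
    then show "\<mu> < beta_exp H i + alpha_exp H j"
      using assms by (intro poly_mapping_lessI[of _ i])
        (auto simp: alpha_exp_def beta_exp_def lookup_add lookup_single when_def)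
  qed (use assms in \<open>intro leads_mult leads_beta leads_alpha, auto\<close>)
  then show ?thesis by simp
qed

text \<open>Meant for the arcs that run to the antipodal half: both ends show up through \<beta>.
  The constant \<open>c\<close> is 0 in type C and 2 in type B.\<close>

lemma leads_beta_beta:
  fixes c :: "'k::field"
  assumes "1 \<le> i" "i \<le> j" "j \<le> H" "c = 0 \<or> i < j"
  shows "leads (beta_exp H i + beta_exp H j)
    (beta H i * beta H j + (alpha H i * alpha H j + single 0 c * (alpha H i * beta H j)))"
proof (rule leads_add_lower)
  fix \<mu> assume "\<mu> \<in> keys
    (alpha H i * alpha H j + single 0 c * (alpha H i * beta H j) :: (nat \<Rightarrow>\<^sub>0 nat) \<Rightarrow>\<^sub>0 'k)"
  from subsetD[OF Poly_Mapping.keys_add this]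
  consider "\<mu> \<in> keys (alpha H i * alpha H j :: (nat \<Rightarrow>\<^sub>0 nat) \<Rightarrow>\<^sub>0 'k)"
    | "\<mu> \<in> keys (single 0 c * (alpha H i * beta H j))"
    by auto
  then have "i \<noteq> 1 \<and> (\<mu> = alpha_exp H i + alpha_exp H j \<or> i < j \<and> \<mu> = alpha_exp H i + beta_exp H j)"
  proof cases
    case 1
    then show ?thesis by (auto elim!: keys_multD dest!: keys_alpha)
  next
    case 2
    then have "c \<noteq> 0" by auto
    then show ?thesis using 2 assms by (auto elim!: keys_multD dest!: keys_alpha keys_beta[rotated] split: if_splits)
  qed
  then show "\<mu> < beta_exp H i + beta_exp H j"
    using assms by (intro poly_mapping_lessI[of _ i])
      (auto simp: alpha_exp_def beta_exp_def lookup_add lookup_single when_def)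
qed (use assms in \<open>intro leads_mult leads_beta, auto\<close>)

lemma leads_beta_alpha:
  assumes "1 \<le> i" "i \<le> H"
  shows "leads (beta_exp H i) (beta H i + alpha H i :: (nat \<Rightarrow>\<^sub>0 nat) \<Rightarrow>\<^sub>0 'k::field)"
proof (rule leads_add_lower)
  fix \<mu> assume "\<mu> \<in> keys (alpha H i :: (nat \<Rightarrow>\<^sub>0 nat) \<Rightarrow>\<^sub>0 'k)"
  then have "\<mu> = alpha_exp H i" "i \<noteq> 1" using keys_alpha by auto
  then show "\<mu> < beta_exp H i"
    using assms by (intro poly_mapping_lessI[of _ i])
      (auto simp: alpha_exp_def beta_exp_def lookup_add lookup_single when_def)
qed (use assms in \<open>intro leads_beta\<close>)

lemma pvars_beta: "1 \<le> j \<Longrightarrow> j \<le> Suc H \<Longrightarrow> pvars (beta H j) \<subseteq> fan_index H"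
  by (auto simp: beta_def fan_index_def intro!: pvars_pvarI)

lemma pvars_alpha: "1 \<le> j \<Longrightarrow> j \<le> Suc H \<Longrightarrow> pvars (alpha H j) \<subseteq> fan_index H"
  by (auto simp: alpha_def fan_index_def intro!: pvars_pvarI)

section \<open>Noncrossing arcs with prescribed endpoints\<close>

text \<open>An arc that opens at \<open>i\<close> closes no earlier than \<open>j\<close> by
  minimality, and no later because it would cross the arc from \<open>i'\<close> to
  \<open>j\<close>.\<close>

lemma innermost_arc:
  fixes R :: "nat \<Rightarrow> nat \<Rightarrow> bool"
  assumes nc: "\<And>i j k l. R i j \<Longrightarrow> R k l \<Longrightarrow> \<not> (i < k \<and> k < j \<and> j < l)"
    and j: "R i' j" "\<And>k l. R k l \<Longrightarrow> j \<le> l"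
    and i: "i' \<le> i" "i < j" "i = i' \<or> (\<exists>k. R i k)"
  shows "R i j"
proof (cases "i = i'")
  case False
  then obtain k where k: "R i k" using i(3) by auto
  then have "j \<le> k" by (rule j(2))
  then show ?thesis using nc[OF j(1) k] False i k by (cases "j = k") auto
qed (use j in simp)

text \<open>Openings at 1 and closings at \<open>N\<close> are not compared, as leading monomials do
  not show them. They can still be controlled: no arc opens before 1 or closes after
  \<open>N\<close>.\<close>

lemma common_arc:
  fixes R R' :: "nat \<Rightarrow> nat \<Rightarrow> bool"
  assumes R: "\<And>i j. R i j \<Longrightarrow> 1 \<le> i \<and> i < j \<and> j \<le> N" and R': "\<And>i j. R' i j \<Longrightarrow> 1 \<le> i \<and> i < j \<and> j \<le> N"
    and nc: "\<And>i j k l. R i j \<Longrightarrow> R k l \<Longrightarrow> \<not> (i < k \<and> k < j \<and> j < l)"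
    and nc': "\<And>i j k l. R' i j \<Longrightarrow> R' k l \<Longrightarrow> \<not> (i < k \<and> k < j \<and> j < l)"
    and op: "\<And>i. 2 \<le> i \<Longrightarrow> i < N \<Longrightarrow> (\<exists>j. R i j) \<longleftrightarrow> (\<exists>j. R' i j)"
    and cl: "\<And>j. 2 \<le> j \<Longrightarrow> j < N \<Longrightarrow> (\<exists>i. R i j) \<longleftrightarrow> (\<exists>i. R' i j)"
    and ne: "R a b" "R' a' b'"
  shows "\<exists>i j. R i j \<and> R' i j"
proof -
  define j where "j = (LEAST j. \<exists>i. R i j)"
  have "\<exists>i. R i j" unfolding j_def by (rule LeastI[of _ b]) (use ne in blast)
  then obtain i1 where i1: "R i1 j" by blast
  have min: "j \<le> l" if "R k l" for k l
    unfolding j_def by (rule Least_le) (use that in blast)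
  have min': "j \<le> l" if "R' k l" for k l
  proof (cases "l < N")
    case True
    then have "\<exists>i. R i l" using cl[of l] R'[OF that] that by (metis One_nat_def Suc_1 Suc_leI le_less_trans)
    then show ?thesis using min by blast
  qed (use R'[OF that] R[OF i1] in simp)
  have "\<exists>i. R' i j"
  proof (cases "j < N")
    case True
    then show ?thesis using cl[of j] R[OF i1] i1 by (metis One_nat_def Suc_1 Suc_leI le_less_trans)
  next
    case False
    then have "j = b'" using min'[OF ne(2)] R'[OF ne(2)] by simp
    then show ?thesis using ne(2) by blast
  qed
  then obtain i2 where i2: "R' i2 j" by blast
  \<comment> \<open>The vertex 1 is always a candidate. If it is the largest one, both arcs that
    close at \<open>j\<close> open at 1.\<close>
  define M where "M = insert 1 {i\<in>{2..<j}. \<exists>k. R i k}"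
  define i where "i = Max M"
  have "finite M" "M \<noteq> {}" by (auto simp: M_def)
  then have iM: "i \<in> M" and i_max: "\<And>k. k \<in> M \<Longrightarrow> k \<le> i" by (auto simp: i_def)
  have jN: "j \<le> N" using R[OF i1] by simp
  have "i1 \<in> M" using R[OF i1] i1 by (force simp: M_def)
  moreover have "i2 \<in> M"
  proof (cases "i2 = 1")
    case False
    then have "\<exists>k. R i2 k" using op[of i2] R'[OF i2] i2 by fastforce
    then show ?thesis using False R'[OF i2] by (auto simp: M_def)
  qed (simp add: M_def)
  ultimately have le: "i1 \<le> i" "i2 \<le> i" using i_max by auto
  have "i < j" using iM R[OF i1] by (auto simp: M_def)
  moreover have "i = i1 \<or> (\<exists>k. R i k)"
    using iM le R[OF i1] by (auto simp: M_def)
  moreover have "i = i2 \<or> (\<exists>k. R' i k)"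
    using iM le R'[OF i2] op[of i] jN by (auto simp: M_def)
  ultimately have "R i j" "R' i j"
    using innermost_arc[of R i1 j i, OF nc i1 min le(1)]
      innermost_arc[of R' i2 j i, OF nc' i2 min' le(2)] by auto
  then show ?thesis by blast
qed

text \<open>Here \<open>P i j\<close> models an arc within one half of the polygon and
  \<open>Q i j\<close> an arc from \<open>i\<close> to the antipode of \<open>j\<close>, both of
  whose ends look like openings; this explains \<open>op\<close>. No \<open>Q\<close> arc ends
  strictly below a \<open>P\<close> arc, so if there are \<open>P\<close> arcs, the argument for an
  innermost arc applies to them. Otherwise the intervals of the \<open>Q\<close> arcs are nested,
  and the widest one joins the extreme marked vertices.\<close>

lemma common_pair:
  fixes P P' Q Q' :: "nat \<Rightarrow> nat \<Rightarrow> bool"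
  defines "op \<equiv> \<lambda>P Q i. (\<exists>j. P i j) \<or> (\<exists>j. Q i j) \<or> (\<exists>j. Q j i)"
  assumes P: "\<And>i j. P i j \<Longrightarrow> i < j" and P': "\<And>i j. P' i j \<Longrightarrow> i < j"
    and Q: "\<And>i j. Q i j \<Longrightarrow> i \<le> j \<and> j \<le> h" and Q': "\<And>i j. Q' i j \<Longrightarrow> i \<le> j \<and> j \<le> h"
    and PP: "\<And>i j k l. P i j \<Longrightarrow> P k l \<Longrightarrow> \<not> (i < k \<and> k < j \<and> j < l)"
    and PP': "\<And>i j k l. P' i j \<Longrightarrow> P' k l \<Longrightarrow> \<not> (i < k \<and> k < j \<and> j < l)"
    and PQ: "\<And>i j k l. P i j \<Longrightarrow> Q k l \<Longrightarrow> \<not> (i < k \<and> k < j) \<and> \<not> (i < l \<and> l < j)"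
    and PQ': "\<And>i j k l. P' i j \<Longrightarrow> Q' k l \<Longrightarrow> \<not> (i < k \<and> k < j) \<and> \<not> (i < l \<and> l < j)"
    and QQ: "\<And>i j k l. Q i j \<Longrightarrow> Q k l \<Longrightarrow> \<not> (i < k \<and> j < l)"
    and QQ': "\<And>i j k l. Q' i j \<Longrightarrow> Q' k l \<Longrightarrow> \<not> (i < k \<and> j < l)"
    and op: "\<And>i. op P Q i \<longleftrightarrow> op P' Q' i"
    and cl: "\<And>j. (\<exists>i. P i j) \<longleftrightarrow> (\<exists>i. P' i j)"
    and ne: "P a b \<or> Q a b"
  shows "(\<exists>i j. P i j \<and> P' i j) \<or> (\<exists>i j. Q i j \<and> Q' i j)"
proof (cases "\<exists>i j. P i j")
  case True
  define j where "j = (LEAST j. \<exists>i. P i j)"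
  have ex: "\<exists>i. P i j" unfolding j_def by (rule LeastI_ex) (use True in blast)
  then obtain i1 where i1: "P i1 j" by blast
  obtain i2 where i2: "P' i2 j" using ex cl by blast
  have min: "j \<le> l" if "P k l" for k l
    unfolding j_def by (rule Least_le) (use that in blast)
  have min': "j \<le> l" if kl: "P' k l" for k l
  proof -
    obtain k' where "P k' l" using kl cl[of l] by blast
    then show ?thesis by (rule min)
  qed
  define M where "M = {i\<in>{..<j}. op P Q i}"
  define i where "i = Max M"
  have "op P Q i1" using i1 by (auto simp: op_def)
  then have 1: "i1 \<in> M" using P[OF i1] by (simp add: M_def)
  have "op P' Q' i2" using i2 by (auto simp: op_def)
  then have 2: "i2 \<in> M" using P'[OF i2] op by (simp add: M_def)
  have fin: "finite M" by (simp add: M_def)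
  then have iM: "i \<in> M" unfolding i_def using 1 by (intro Max_in) auto
  have le: "i1 \<le> i" "i2 \<le> i" unfolding i_def using fin 1 2 by auto
  have ij: "i < j" "op P Q i" "op P' Q' i" using iM op by (auto simp: M_def)
  \<comment> \<open>A marked vertex strictly between \<open>i1\<close> and \<open>j\<close> is no
    end of a \<open>Q\<close> arc, hence a genuine opening.\<close>
  have "i = i1 \<or> (\<exists>k. P i k)"
    using ij le(1) PQ[OF i1] unfolding op_def by (metis le_neq_implies_less)
  moreover have "i = i2 \<or> (\<exists>k. P' i k)"
    using ij le(2) PQ'[OF i2] unfolding op_def by (metis le_neq_implies_less)
  ultimately have "P i j" "P' i j"
    using innermost_arc[of P i1 j i, OF PP i1 min le(1) ij(1)]
      innermost_arc[of P' i2 j i, OF PP' i2 min' le(2) ij(1)] by auto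
  then show ?thesis by blast
next
  case False
  then have noP': "\<not> P' i j" for i j using cl[of j] False by blast
  \<comment> \<open>An arc at the smallest mark and an arc at the largest one cross, unless one of
    them joins the two marks.\<close>
  have Q_extreme: "Q i k"
    if Q: "\<And>i j. Q i j \<Longrightarrow> i \<le> j" and QQ: "\<And>i j k l. Q i j \<Longrightarrow> Q k l \<Longrightarrow> \<not> (i < k \<and> j < l)"
      and i: "(\<exists>j. Q i j) \<or> (\<exists>j. Q j i)" and k: "(\<exists>j. Q k j) \<or> (\<exists>j. Q j k)"
      and bounds: "\<And>l j. Q l j \<Longrightarrow> i \<le> l \<and> j \<le> k" for Q and i k :: nat
  proof -
    obtain q where q: "Q i q" using i bounds Q by (metis antisym)
    obtain p where p: "Q p k" using k bounds Q by (metis antisym)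
    have "p = i \<or> q = k" using QQ[OF q p] bounds[OF q] bounds[OF p] by (metis le_neq_implies_less)
    then show ?thesis using p q by auto
  qed
  define M where "M = {i. op P Q i}"
  have opQ: "op P Q i \<longleftrightarrow> (\<exists>j. Q i j) \<or> (\<exists>j. Q j i)" for i using False by (auto simp: op_def)
  have opQ': "op P Q i \<longleftrightarrow> (\<exists>j. Q' i j) \<or> (\<exists>j. Q' j i)" for i
    unfolding op using noP' by (auto simp: op_def)
  have "M \<subseteq> {..h}" using Q by (fastforce simp: M_def opQ)
  then have fin: "finite M" by (rule finite_subset) simp
  have "M \<noteq> {}" using ne False by (auto simp: M_def opQ)
  then have mem: "Min M \<in> M" "Max M \<in> M" using fin by auto
  have mem_op: "op P Q (Min M)" "op P Q (Max M)" using mem by (auto simp: M_def)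
  have b: "Min M \<le> l \<and> j \<le> Max M" if "op P Q l" "op P Q j" for l j
    using that fin by (auto simp: M_def)
  have "Q (Min M) (Max M)"
  proof (rule Q_extreme)
    show "Min M \<le> l \<and> j \<le> Max M" if "Q l j" for l j
      by (rule b) (use that opQ[of l] opQ[of j] in blast)+
    show "i \<le> j" if "Q i j" for i j using Q[OF that] by simp
    show "(\<exists>j. Q (Min M) j) \<or> (\<exists>j. Q j (Min M))" using mem_op(1) unfolding opQ .
    show "(\<exists>j. Q (Max M) j) \<or> (\<exists>j. Q j (Max M))" using mem_op(2) unfolding opQ .
  qed (rule QQ)
  moreover have "Q' (Min M) (Max M)"
  proof (rule Q_extreme)
    show "Min M \<le> l \<and> j \<le> Max M" if "Q' l j" for l j
      by (rule b) (use that opQ'[of l] opQ'[of j] in blast)+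
    show "i \<le> j" if "Q' i j" for i j using Q'[OF that] by simp
    show "(\<exists>j. Q' (Min M) j) \<or> (\<exists>j. Q' j (Min M))" using mem_op(1) unfolding opQ' .
    show "(\<exists>j. Q' (Max M) j) \<or> (\<exists>j. Q' j (Max M))" using mem_op(2) unfolding opQ' .
  qed (rule QQ')
  ultimately show ?thesis by blast
qed

section \<open>Polygons\<close>

text \<open>Rotating a list of length 4 depends on the number of steps modulo 4 only.\<close>

lemma ccw4:
  "ccw N [a, b, c, d] \<longleftrightarrow> {a, b, c, d} \<subseteq> {1..N} \<and>
    (a < b \<and> b < c \<and> c < d \<or> b < c \<and> c < d \<and> d < a \<or> c < d \<and> d < a \<and> a < b \<or> d < a \<and> a < b \<and> b < c)"
proof -
  let ?s = "\<lambda>k. sorted_wrt (<) (rotate k [a, b, c, d])"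
  have "(\<exists>k. ?s k) \<longleftrightarrow> (\<exists>k<4. ?s k)"
  proof
    assume "\<exists>k. ?s k"
    then obtain k where "?s k" by blast
    then have "?s (k mod 4)" using rotate_conv_mod[of k "[a, b, c, d]"] by simp
    then show "\<exists>k<4. ?s k" by (intro exI[of _ "k mod 4"]) simp
  qed blast
  also have "\<dots> \<longleftrightarrow> ?s 0 \<or> ?s 1 \<or> ?s 2 \<or> ?s 3"
  proof -
    have "k < 4 \<longleftrightarrow> k = 0 \<or> k = 1 \<or> k = 2 \<or> k = 3" for k :: nat by auto
    then show ?thesis by metis
  qed
  also have "?s 0 \<longleftrightarrow> a < b \<and> b < c \<and> c < d" by auto
  also have "?s 1 \<longleftrightarrow> b < c \<and> c < d \<and> d < a" by auto
  also have "?s 2 \<longleftrightarrow> c < d \<and> d < a \<and> a < b" by (auto simp: rotate_def numeral_eq_Suc)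
  also have "?s 3 \<longleftrightarrow> d < a \<and> a < b \<and> b < c" by (auto simp: rotate_def numeral_eq_Suc)
  finally show ?thesis unfolding ccw_def by simp
qed

lemma crossing_iff:
  assumes "p < q" "r < s"
  shows "crossing N {p, q} {r, s} \<longleftrightarrow>
    {p, q, r, s} \<subseteq> {1..N} \<and> (p < r \<and> r < q \<and> q < s \<or> r < p \<and> p < s \<and> s < q)" (is "_ \<longleftrightarrow> ?R")
proof
  assume "crossing N {p, q} {r, s}"
  then obtain a b c d where *: "ccw N [a, b, c, d]" "{p, q} = {a, c}" "{r, s} = {b, d}"
    by (auto simp: crossing_def)
  from *(2,3) have "(p = a \<and> q = c \<or> p = c \<and> q = a) \<and> (r = b \<and> s = d \<or> r = d \<and> s = b)"
    by (simp add: doubleton_eq_iff)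
  then show ?R using *(1) assms unfolding ccw4 by auto
next
  assume R: ?R
  then consider "p < r \<and> r < q \<and> q < s" | "r < p \<and> p < s \<and> s < q" by blast
  then show "crossing N {p, q} {r, s}"
  proof cases
    case 1
    then have "ccw N [p, r, q, s]" using R by (simp add: ccw4)
    then show ?thesis unfolding crossing_def by blast
  next
    case 2
    then have "ccw N [p, s, q, r]" using R by (simp add: ccw4)
    then show ?thesis unfolding crossing_def by (metis insert_commute)
  qed
qed

lemma crossing_commute: "crossing N l l' \<Longrightarrow> crossing N l' l"
proof -
  assume "crossing N l l'"
  then obtain a b c d where "ccw N [a, b, c, d]" "l = {a, c}" "l' = {b, d}" by (auto simp: crossing_def)
  then have "ccw N [b, c, d, a]" "l' = {b, d}" "l = {c, a}" by (auto simp: ccw4)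
  then show ?thesis unfolding crossing_def by blast
qed

lemma crossing_obtain:
  assumes "crossing N l l'"
  obtains a b c d where "1 \<le> a" "a < b" "b < c" "c < d" "d \<le> N"
    "l = {a, c} \<and> l' = {b, d} \<or> l = {b, d} \<and> l' = {a, c}"
proof -
  obtain a b c d where "ccw N [a, b, c, d]" "l = {a, c}" "l' = {b, d}"
    using assms by (auto simp: crossing_def)
  then show ?thesis
    unfolding ccw4 using that[of a b c d] that[of b c d a] that[of c d a b] that[of d a b c]
    by (auto simp: insert_commute)
qed

lemma polygon_edge_iff:
  assumes "1 \<le> i" "i < j" "j \<le> N"
  shows "{i, j} \<in> polygon_edges N \<longleftrightarrow> j = Suc i \<or> i = 1 \<and> j = N"
proof
  assume "{i, j} \<in> polygon_edges N"
  then obtain k where "k \<in> {1..N}" "{i, j} = {k, k mod N + 1}" by (auto simp: polygon_edges_def)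
  then show "j = Suc i \<or> i = 1 \<and> j = N"
    using assms by (cases "k = N") (auto simp: doubleton_eq_iff)
next
  assume "j = Suc i \<or> i = 1 \<and> j = N"
  then show "{i, j} \<in> polygon_edges N"
  proof
    assume "j = Suc i"
    then have "{i, j} = {i, i mod N + 1}" using assms by simp
    then show ?thesis unfolding polygon_edges_def using assms by (intro image_eqI[of _ _ i]) auto
  next
    assume "i = 1 \<and> j = N"
    then have "{i, j} = {N, N mod N + 1}" by auto
    then show ?thesis unfolding polygon_edges_def using assms by (intro image_eqI[of _ _ N]) auto
  qed
qed

lemma polygon_segments:
  assumes "2 \<le> N"
  shows "polygon_diagonals N \<union> polygon_edges N = {{i, j} | i j. 1 \<le> i \<and> i < j \<and> j \<le> N}"
proof -
  have eq: "{{i, j} | i j. i \<in> {1..N} \<and> j \<in> {1..N} \<and> i \<noteq> j} = {{i, j} | i j. 1 \<le> i \<and> i < j \<and> j \<le> N}"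
  proof (intro equalityI subsetI)
    fix l assume "l \<in> {{i, j} | i j. i \<in> {1..N} \<and> j \<in> {1..N} \<and> i \<noteq> j}"
    then obtain i j where "l = {i, j}" "i \<in> {1..N}" "j \<in> {1..N}" "i \<noteq> j" by blast
    then have "l = {min i j, max i j} \<and> 1 \<le> min i j \<and> min i j < max i j \<and> max i j \<le> N"
      by (auto simp: min_def max_def)
    then show "l \<in> {{i, j} | i j. 1 \<le> i \<and> i < j \<and> j \<le> N}" by blast
  next
    fix l assume "l \<in> {{i, j} | i j. 1 \<le> i \<and> i < j \<and> j \<le> N}"
    then obtain i j where "l = {i, j}" "1 \<le> i" "i < j" "j \<le> N" by blast
    then have "l = {i, j} \<and> i \<in> {1..N} \<and> j \<in> {1..N} \<and> i \<noteq> j" by simp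
    then show "l \<in> {{i, j} | i j. i \<in> {1..N} \<and> j \<in> {1..N} \<and> i \<noteq> j}" by blast
  qed
  have sub: "polygon_edges N \<subseteq> {{i, j} | i j. i \<in> {1..N} \<and> j \<in> {1..N} \<and> i \<noteq> j}"
  proof
    fix l assume "l \<in> polygon_edges N"
    then obtain k where k: "k \<in> {1..N}" "l = {k, k mod N + 1}" by (auto simp: polygon_edges_def)
    have "k mod N + 1 \<in> {1..N}" "k \<noteq> k mod N + 1" using k(1) assms by (cases "k = N"; simp)+
    then show "l \<in> {{i, j} | i j. i \<in> {1..N} \<and> j \<in> {1..N} \<and> i \<noteq> j}" using k by blast
  qed
  have un: "A - B \<union> B = A" if "B \<subseteq> A" for A B :: "nat set set" using that by blast
  show ?thesis unfolding polygon_diagonals_def un[OF sub] by (rule eq)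
qed

lemma polygon_diagonal_iff:
  assumes "1 \<le> i" "i < j" "j \<le> N"
  shows "{i, j} \<in> polygon_diagonals N \<longleftrightarrow> \<not> (j = Suc i \<or> i = 1 \<and> j = N)"
proof -
  have "{i, j} \<in> polygon_diagonals N \<union> polygon_edges N"
    using assms by (subst polygon_segments) (simp, blast)
  moreover have "{i, j} \<in> polygon_diagonals N \<Longrightarrow> {i, j} \<notin> polygon_edges N"
    by (simp add: polygon_diagonals_def)
  ultimately show ?thesis using polygon_edge_iff[OF assms] by blast
qed

lemma crossing_diagonal:
  assumes "crossing N l l'" shows "l \<in> polygon_diagonals N"
proof -
  obtain a b c d where *: "1 \<le> a" "a < b" "b < c" "c < d" "d \<le> N"
    "l = {a, c} \<and> l' = {b, d} \<or> l = {b, d} \<and> l' = {a, c}"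
    using assms by (rule crossing_obtain)
  have "{a, c} \<in> polygon_diagonals N" "{b, d} \<in> polygon_diagonals N"
    using * by (subst polygon_diagonal_iff; simp)+
  then show ?thesis using *(6) by auto
qed

lemma finite_polygon_diagonals: "finite (polygon_diagonals N)"
proof (rule finite_subset)
  show "polygon_diagonals N \<subseteq> Pow {1..N}" by (auto simp: polygon_diagonals_def)
qed simp

lemma finite_polygon_edges: "finite (polygon_edges N)"
  by (simp add: polygon_edges_def)

lemma noncrossing_maximal:
  assumes "finite \<T>" "T \<in> \<T>"
  obtains T' where "T' \<in> \<T>" "T \<subseteq> T'" "\<And>T''. T'' \<in> \<T> \<Longrightarrow> T' \<subseteq> T'' \<Longrightarrow> T'' = T'"
  using finite_has_maximal2[OF assms] by (metis (no_types))

lemma noncrossing_extends_to_triangulation: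
  assumes "noncrossing N T"
  obtains T' where "triangulation N T'" "T \<subseteq> T'"
proof -
  have "{T. noncrossing N T} \<subseteq> Pow (polygon_diagonals N)" by (auto simp: noncrossing_def)
  then have "finite {T. noncrossing N T}"
    by (rule finite_subset) (simp add: finite_polygon_diagonals)
  then obtain T' where "T' \<in> {T. noncrossing N T}" "T \<subseteq> T'"
    "\<And>T''. T'' \<in> {T. noncrossing N T} \<Longrightarrow> T' \<subseteq> T'' \<Longrightarrow> T'' = T'"
    by (rule noncrossing_maximal[of _ T]) (use assms in simp, blast)
  then show ?thesis by (intro that[of T']) (auto simp: triangulation_def)
qed

text \<open>Independence concerns the set of values, so injectivity of \<open>E\<close> has to be
  derived first: equal members would satisfy a relation with coefficients 1 and -1.\<close>

lemma independent_familyI: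
  fixes E :: "'i \<Rightarrow> 'b::real_vector"
  assumes fin: "finite I" and ind: "\<And>f. (\<Sum>i\<in>I. f i *\<^sub>R E i) = 0 \<Longrightarrow> \<forall>i\<in>I. f i = 0"
  shows "independent (E ` I)"
proof -
  have inj: "inj_on E I"
  proof (rule inj_onI)
    fix i j assume ij: "i \<in> I" "j \<in> I" "E i = E j"
    show "i = j"
    proof (rule ccontr)
      assume ne: "i \<noteq> j"
      let ?f = "\<lambda>k. (if k = i then 1 else 0) - (if k = j then 1 else 0) :: real"
      have "(\<Sum>k\<in>I. ?f k *\<^sub>R E k) = (\<Sum>k\<in>I. (if k = i then E k else 0)) - (\<Sum>k\<in>I. (if k = j then E k else 0))"
        unfolding sum_subtractf[symmetric] by (rule sum.cong) (auto simp: scaleR_diff_left)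
      then have "(\<Sum>k\<in>I. ?f k *\<^sub>R E k) = 0" using fin ij by simp
      from ind[OF this] show False using ij ne by auto
    qed
  qed
  have "\<forall>v\<in>E ` I. u v = 0" if "(\<Sum>v\<in>E ` I. u v *\<^sub>R v) = 0" for u
  proof -
    have "(\<Sum>i\<in>I. u (E i) *\<^sub>R E i) = 0" using that by (simp add: sum.reindex[OF inj])
    from ind[OF this] show ?thesis by auto
  qed
  then show ?thesis using fin by (subst dependent_finite) auto
qed

text \<open>If the two monomials coincide, the coefficient is 2, which is nonzero in characteristic
  0.\<close>

lemma keys_two_terms:
  "keys (single \<mu> 1 + single \<nu> (1 :: 'k::field_char_0)) = {\<mu>, \<nu>}"
  by (auto simp: in_keys_iff lookup_add lookup_single when_def split: if_splits)

lemma lookup_linear_weight: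
  "lookup (linear_weight e \<mu> :: nat \<Rightarrow>\<^sub>0 nat) k =
    linear_weight (\<lambda>v. lookup (e v) k) \<mu>"
  by (rule linear_weight_hom) (auto simp: lookup_add)

section \<open>Type A\<close>

text \<open>If \<open>p\<close>, \<open>q\<close>, \<open>r\<close>, \<open>t\<close> are the
  successive lengths between the four vertices, with sum \<open>N\<close>, then the two gaps are
  \<open>2 q t\<close> and \<open>2 p r\<close>.\<close>

lemma quadrilateral_weight:
  fixes a b c d N :: nat
  assumes "a < b" "b < c" "c < d" "d < N + a"
  defines "f \<equiv> \<lambda>t. t * (N - t)"
  shows "f (b - a) + f (d - c) < f (c - a) + f (d - b)" "f (d - a) + f (c - b) < f (c - a) + f (d - b)"
proof -
  obtain p q r t where len: "b = a + p" "c = a + p + q" "d = a + p + q + r" "N = p + q + r + t"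
    and pos: "0 < p" "0 < q" "0 < r" "0 < t"
  proof (rule that)
    show "b = a + (b - a)" "c = a + (b - a) + (c - b)" "d = a + (b - a) + (c - b) + (d - c)"
      "N = (b - a) + (c - b) + (d - c) + (N + a - d)" using assms by auto
  qed (use assms in auto)
  have "p * (q + r + t) + r * (p + q + t) < (p + q) * (r + t) + (q + r) * (p + t)"
    "(p + q + r) * t + q * (p + r + t) < (p + q) * (r + t) + (q + r) * (p + t)"
    using pos by (simp_all add: algebra_simps)
  then show "f (b - a) + f (d - c) < f (c - a) + f (d - b)" "f (d - a) + f (c - b) < f (c - a) + f (d - b)"
    unfolding f_def len by (simp_all add: algebra_simps)
qed

locale type_A_model =
  fixes emb :: "'k::field_char_0 \<Rightarrow> 'f::field" and n m :: nat and s :: "'f seed" and x :: "nat set \<Rightarrow> 'f"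
  assumes emb: "field_embedding emb" and n: "1 \<le> n" and model: "polygon_model_A emb n m s x"
begin

abbreviation "L \<equiv> polygon_diagonals (n + 3) \<union> polygon_edges (n + 3)"
abbreviation "S \<equiv> all_vars n m s"

lemma seed: "is_seed emb n m s"
  and inj: "inj_on x L"
  and cluster_vars_eq: "cluster_vars n m s = x ` polygon_diagonals (n + 3)"
  and frozen_vars_eq: "frozen_vars n m s = x ` polygon_edges (n + 3)"
  and clusters_eq: "clusters n m s = {x ` T | T. triangulation (n + 3) T}"
  and relations_eq: "(exchange_relations n m s :: (('f \<Rightarrow>\<^sub>0 nat) \<Rightarrow>\<^sub>0 'k) set) = relations_A n x"
  using model unfolding polygon_model_A_def by simp_all

lemma S_eq: "S = x ` L"
  by (auto simp: all_vars_def cluster_vars_eq frozen_vars_eq)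

lemma L_eq: "L = {{i, j} | i j. 1 \<le> i \<and> i < j \<and> j \<le> n + 3}"
  by (rule polygon_segments) simp

lemma L_I: "1 \<le> i \<Longrightarrow> i < j \<Longrightarrow> j \<le> n + 3 \<Longrightarrow> {i, j} \<in> L"
  unfolding L_eq by blast

lemma arc_in_S: "1 \<le> i \<Longrightarrow> i < j \<Longrightarrow> j \<le> n + 3 \<Longrightarrow> x {i, j} \<in> S"
  unfolding S_eq by (intro imageI L_I)

lemma S_cases:
  assumes "v \<in> S"
  obtains i j where "1 \<le> i" "i < j" "j \<le> n + 3" "v = x {i, j}"
  using assms unfolding S_eq L_eq by blast

text \<open>Two noncrossing diagonals extend to a triangulation, whose labels form a cluster.
  Conversely, by injectivity of \<open>x\<close>, a cluster with both labels comes from a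
  triangulation with both diagonals.\<close>

lemma incompatible_iff:
  assumes "l \<in> L" "l' \<in> L"
  shows "incompatible n m s (x l) (x l') \<longleftrightarrow> crossing (n + 3) l l'"
proof
  assume inc: "incompatible n m s (x l) (x l')"
  then have mem: "l \<in> polygon_diagonals (n + 3)" "l' \<in> polygon_diagonals (n + 3)"
    using assms inj_on_eq_iff[OF inj] by (auto simp: incompatible_def cluster_vars_eq)
  show "crossing (n + 3) l l'"
  proof (rule ccontr)
    assume nc: "\<not> crossing (n + 3) l l'"
    have self: "\<not> crossing (n + 3) k k" for k
      by (auto simp: doubleton_eq_iff elim!: crossing_obtain)
    have "noncrossing (n + 3) {l, l'}"
      using mem nc self crossing_commute[of "n + 3" l' l] by (auto simp: noncrossing_def)
    then obtain T where "triangulation (n + 3) T" "{l, l'} \<subseteq> T"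
      by (rule noncrossing_extends_to_triangulation)
    then show False using inc unfolding incompatible_def clusters_eq by blast
  qed
next
  assume cr: "crossing (n + 3) l l'"
  have "l \<in> polygon_diagonals (n + 3)" "l' \<in> polygon_diagonals (n + 3)"
    using crossing_diagonal cr crossing_commute by blast+
  moreover have "l \<notin> T \<or> l' \<notin> T" if T: "triangulation (n + 3) T" "x l \<in> x ` T" "x l' \<in> x ` T" for T
    using T cr by (auto simp: triangulation_def noncrossing_def)
  moreover have "k \<in> T" if "triangulation (n + 3) T" "x k \<in> x ` T" "k \<in> L" for k T
  proof -
    have "T \<subseteq> L" using that(1) by (auto simp: triangulation_def noncrossing_def)
    then show ?thesis using that inj by (auto simp: inj_on_eq_iff subset_iff)
  qed
  ultimately show "incompatible n m s (x l) (x l')"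
    using assms unfolding incompatible_def cluster_vars_eq clusters_eq by blast
qed

lemma incompatible_arcs_iff:
  assumes "1 \<le> i" "i < j" "j \<le> n + 3" "1 \<le> k" "k < l" "l \<le> n + 3"
  shows "incompatible n m s (x {i, j}) (x {k, l}) \<longleftrightarrow> i < k \<and> k < j \<and> j < l \<or> k < i \<and> i < l \<and> l < j"
  unfolding incompatible_iff[OF L_I[OF assms(1-3)] L_I[OF assms(4-6)]] crossing_iff[OF assms(2,5)]
  using assms by auto

lemma incompatible_cases:
  assumes "incompatible n m s v w"
  obtains a b c d where "1 \<le> a" "a < b" "b < c" "c < d" "d \<le> n + 3"
    "v = x {a, c} \<and> w = x {b, d} \<or> v = x {b, d} \<and> w = x {a, c}"
proof -
  obtain l l' where l: "l \<in> L" "l' \<in> L" "v = x l" "w = x l'"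
    using assms by (auto simp: incompatible_def cluster_vars_eq)
  then have "crossing (n + 3) l l'" using assms incompatible_iff by simp
  then obtain a b c d where "1 \<le> a" "a < b" "b < c" "c < d" "d \<le> n + 3"
    "l = {a, c} \<and> l' = {b, d} \<or> l = {b, d} \<and> l' = {a, c}"
    by (rule crossing_obtain)
  then show ?thesis using l by (intro that[of a b c d]) auto
qed

sublocale incompatibility emb S "incompatible n m s"
proof (rule incompatibility_seed[OF emb])
  show "finite S" unfolding S_eq
    by (simp add: finite_polygon_diagonals finite_polygon_edges)
qed

lemma ptolemy:
  assumes "1 \<le> a" "a < b" "b < c" "c < d" "d \<le> n + 3"
  shows "x {a, c} * x {b, d} = x {a, b} * x {c, d} + x {a, d} * x {b, c}"
proof -
  let ?p = "pvar (x {a, c}) * pvar (x {b, d}) - pvar (x {a, b}) * pvar (x {c, d})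
    - pvar (x {a, d}) * pvar (x {b, c}) :: ('f \<Rightarrow>\<^sub>0 nat) \<Rightarrow>\<^sub>0 'k"
  have "ccw (n + 3) [a, b, c, d]" using assms by (simp add: ccw4)
  then have "?p \<in> relations_A n x" unfolding relations_A_def Let_def by blast
  then have "?p \<in> exchange_relations n m s" by (simp add: relations_eq)
  from exchange_relation_vanishes[OF emb seed this] show ?thesis
    by (simp add: peval_diff peval_mult diff_eq_eq add.commute)
qed

text \<open>Endpoints are recovered by inverting the labelling; the values are meaningful on
  \<open>S\<close> only.\<close>

definition lo :: "'f \<Rightarrow> nat" where "lo v = Min (inv_into L x v)"
definition hi :: "'f \<Rightarrow> nat" where "hi v = Max (inv_into L x v)"

lemma lo_hi:
  assumes "1 \<le> i" "i < j" "j \<le> n + 3"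
  shows "lo (x {i, j}) = i" "hi (x {i, j}) = j"
  using inv_into_f_f[OF inj L_I[OF assms]] assms by (simp_all add: lo_def hi_def)

definition fan :: "nat \<Rightarrow> 'f" where
  "fan i = (if i = 0 then x {1, n + 3} else if i \<le> n + 2 then x {i, n + 3} / x {1, n + 3}
    else x {1, i - (n + 2)} / x {1, n + 3})"

lemma alg_indep_fan: "alg_indep emb (fan_index (n + 2)) fan"
proof -
  let ?H = "n + 2"
  \<comment> \<open>The fan triangulation at vertex 1 together with edges. \<open>{1, n + 3}\<close>
    is the common factor, \<open>{i, Suc i}\<close> are edges, and among the arcs at 1 only
    \<open>{1, 2}\<close> is an edge.\<close>
  define lab :: "nat \<Rightarrow> nat set" where "lab = (\<lambda>i. if i = 0 then {1, n + 3} else if i \<le> ?H then {i, Suc i} else {1, i - ?H})"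
  let ?T = "{{1, j} | j. 3 \<le> j \<and> j \<le> n + 2}"
  have "\<not> crossing (n + 3) {1, j} {1, k}" if "3 \<le> j" "3 \<le> k" for j k
    using that by (subst crossing_iff) auto
  moreover have "{1, j} \<in> polygon_diagonals (n + 3)" if "3 \<le> j" "j \<le> n + 2" for j
    using that L_I[of 1 j] polygon_diagonal_iff[of 1 j "n + 3"] by auto
  ultimately have "noncrossing (n + 3) ?T" unfolding noncrossing_def by blast
  then obtain T where T: "triangulation (n + 3) T" "?T \<subseteq> T"
    by (rule noncrossing_extends_to_triangulation)
  have lab_L: "lab i \<in> L" if "i \<in> fan_index ?H" for i
    using that L_I[of 1 "n + 3"] L_I[of i "Suc i"] L_I[of 1 "i - ?H"] by (auto simp: fan_index_def lab_def)
  have lab_mem: "lab i \<in> T \<union> polygon_edges (n + 3)" if i: "i \<in> fan_index ?H" for i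
  proof -
    consider "i = 0" | "2 \<le> i" "i \<le> ?H" | "i = ?H + 2" | "?H + 3 \<le> i" "i \<le> 2 * ?H"
      using i by (fastforce simp: fan_index_def)
    then show ?thesis
    proof cases
      case 4
      then have "{1, i - ?H} \<in> ?T" by (intro CollectI exI[of _ "i - ?H"]) auto
      then show ?thesis using 4 T(2) by (auto simp: lab_def)
    qed (use polygon_edge_iff[of 1 "n + 3" "n + 3"] polygon_edge_iff[of i "Suc i" "n + 3"]
          polygon_edge_iff[of 1 2 "n + 3"] in \<open>auto simp: numeral_2_eq_2 lab_def\<close>)
  qed
  have "inj_on lab (fan_index ?H)"
    by (rule inj_onI) (auto simp: fan_index_def lab_def doubleton_eq_iff split: if_splits)
  moreover have "lab ` fan_index ?H \<subseteq> L" using lab_L by blast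
  ultimately have "inj_on (\<lambda>i. x (lab i)) (fan_index ?H)"
    using comp_inj_on[OF _ inj_on_subset[OF inj]] by (simp add: comp_def)
  moreover have "(\<lambda>i. x (lab i)) ` fan_index ?H \<subseteq> x ` T \<union> frozen_vars n m s"
    using lab_mem unfolding frozen_vars_eq by blast
  moreover have "x ` T \<in> clusters n m s" unfolding clusters_eq using T(1) by blast
  ultimately have "alg_indep emb (fan_index ?H) (\<lambda>i. x (lab i))"
    by (intro cluster_alg_indep[OF emb seed])
  also have "(\<lambda>i. x (lab i)) =
      (\<lambda>i. if i = 0 then x {1, n + 3} else if i \<le> ?H then x {i, Suc i} else x {1, i - ?H})"
    by (auto simp: lab_def)
  finally have "alg_indep emb (fan_index ?H)
      (\<lambda>i. if i = 0 then x {1, n + 3} else if i \<le> ?H then x {i, Suc i} else x {1, i - ?H})" .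
  from fan_alg_indep[OF emb this, of "\<lambda>i. x {i, n + 3}" 1]
  have "alg_indep emb (fan_index ?H) (\<lambda>i. if i = 0 then x {1, n + 3}
      else if i \<le> ?H then x {i, n + 3} / x {1, n + 3} ^ 1 else x {1, i - ?H} / x {1, n + 3} ^ 1)"
    using ptolemy[of 1 _ "Suc _" "n + 3"] by (simp add: numeral_3_eq_3)
  then show ?thesis unfolding power_one_right fan_def[abs_def] .
qed

definition coord :: "'f \<Rightarrow> ((nat \<Rightarrow>\<^sub>0 nat) \<Rightarrow>\<^sub>0 'k)" where
  "coord v = pvar 0 * (beta (n + 2) (lo v) * alpha (n + 2) (hi v) - alpha (n + 2) (lo v) * beta (n + 2) (hi v))"

definition lead :: "'f \<Rightarrow> (nat \<Rightarrow>\<^sub>0 nat)" where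
  "lead v = single 0 1 + (beta_exp (n + 2) (lo v) + alpha_exp (n + 2) (hi v))"

lemma leads_coord: "v \<in> S \<Longrightarrow> leads (lead v) (coord v)"
  unfolding lead_def coord_def
  by (erule S_cases, intro leads_mult leads_pvar leads_minor) (simp_all add: lo_hi)

lemma pvars_coord: "v \<in> S \<Longrightarrow> pvars (coord v) \<subseteq> fan_index (n + 2)"
  unfolding coord_def
  by (erule S_cases, intro pvars_multI pvars_diffI pvars_pvarI pvars_alpha pvars_beta)
     (simp_all add: lo_hi fan_index_def)

lemma eval_coord: "v \<in> S \<Longrightarrow> peval emb fan (coord v) = v"
proof (erule S_cases)
  fix i j assume ij: "1 \<le> i" "i < j" "j \<le> n + 3" and v: "v = x {i, j}"
  have iN: "1 \<le> i" "i \<le> n + 3" and jN: "1 \<le> j" "j \<le> n + 3" using ij by auto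
  have nz: "x {1, n + 3} \<noteq> 0"
    using alg_indep_nonzero[OF alg_indep_fan, of 0] by (simp add: fan_index_def fan_def)
  have b: "peval emb fan (beta (n + 2) k) = (if k = 1 then 1 else if k = n + 3 then 0 else x {k, n + 3} / x {1, n + 3})"
    if "1 \<le> k" "k \<le> n + 3" for k
    using that by (auto simp: beta_def fan_def)
  have a: "peval emb fan (alpha (n + 2) k) = (if k = 1 then 0 else if k = n + 3 then 1 else x {1, k} / x {1, n + 3})"
    if "1 \<le> k" "k \<le> n + 3" for k
    using that by (auto simp: alpha_def fan_def)
  have "peval emb fan (coord v) = x {1, n + 3} *
    (peval emb fan (beta (n + 2) i) * peval emb fan (alpha (n + 2) j)
     - peval emb fan (alpha (n + 2) i) * peval emb fan (beta (n + 2) j))"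
    using ij by (simp add: v coord_def lo_hi peval_mult peval_diff) (simp add: fan_def)
  also have "\<dots> = v"
  proof (cases "i = 1 \<or> j = n + 3")
    case True
    then show ?thesis unfolding a[OF iN] a[OF jN] b[OF iN] b[OF jN] using ij nz by (auto simp: v)
  next
    case False
    \<comment> \<open>Divided by the square of \<open>x {1, n + 3}\<close>, this is the formula that
      makes \<open>x {i, j}\<close> a multiple of a minor.\<close>
    then have "x {1, j} * x {i, n + 3} = x {1, i} * x {j, n + 3} + x {1, n + 3} * x {i, j}"
      using ij by (intro ptolemy) auto
    then show ?thesis unfolding a[OF iN] a[OF jN] b[OF iN] b[OF jN] using ij False nz
      by (simp add: v field_simps)
  qed
  finally show ?thesis .
qed

lemma lead_lookup:
  assumes "2 \<le> k" "k \<le> n + 2" "v \<in> S"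
  shows "lookup (lead v) k = (if lo v = k then 1 else 0)"
    "lookup (lead v) (n + 2 + k) = (if hi v = k then 1 else 0)"
  using assms(3)
  by (rule S_cases, use assms(1,2) in \<open>auto simp: lead_def lookup_add lookup_single beta_exp_def
      alpha_exp_def when_def lo_hi\<close>)+

lemma linear_weight_lead_inj:
  "inj_on (linear_weight lead) {\<mu>. keys \<mu> \<subseteq> S \<and> std \<mu>}"
proof (rule linear_weight_inj_by_cancellation)
  fix \<mu> \<nu> :: "'f \<Rightarrow>\<^sub>0 nat"
  assume \<mu>: "\<mu> \<in> {\<mu>. keys \<mu> \<subseteq> S \<and> std \<mu>}" and \<nu>: "\<nu> \<in> {\<mu>. keys \<mu> \<subseteq> S \<and> std \<mu>}"
    and nz: "\<mu> \<noteq> 0" and eq: "linear_weight lead \<mu> = linear_weight lead \<nu>"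
  define R where "R \<kappa> i j \<longleftrightarrow> 1 \<le> i \<and> i < j \<and> j \<le> n + 3 \<and> x {i, j} \<in> keys \<kappa>"
    for \<kappa> :: "'f \<Rightarrow>\<^sub>0 nat" and i j
  have vis: "(\<exists>v\<in>keys \<mu>. 0 < lookup (lead v) k) \<longleftrightarrow>
      (\<exists>v\<in>keys \<nu>. 0 < lookup (lead v) k)" for k
    using arg_cong[OF eq, of "\<lambda>e. 0 < lookup e k"]
    unfolding lookup_linear_weight linear_weight_nat_pos_iff by blast
  have ex: "(\<exists>v\<in>keys \<kappa>. P v) \<longleftrightarrow> (\<exists>i j. R \<kappa> i j \<and> P (x {i, j}))"
    if keys: "keys \<kappa> \<subseteq> S" for \<kappa> P
  proof
    assume "\<exists>v\<in>keys \<kappa>. P v"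
    then obtain v where v: "v \<in> keys \<kappa>" "P v" by blast
    from subsetD[OF keys v(1)] obtain i j where "1 \<le> i" "i < j" "j \<le> n + 3" "v = x {i, j}"
      by (rule S_cases)
    then have "R \<kappa> i j \<and> P (x {i, j})" using v by (simp add: R_def)
    then show "\<exists>i j. R \<kappa> i j \<and> P (x {i, j})" by blast
  qed (auto simp: R_def)
  have op: "(\<exists>j. R \<kappa> i j) \<longleftrightarrow> (\<exists>v\<in>keys \<kappa>. 0 < lookup (lead v) i)"
    if "2 \<le> i" "i < n + 3" "keys \<kappa> \<subseteq> S" for \<kappa> i
  proof -
    have "0 < lookup (lead (x {k, j})) i \<longleftrightarrow> k = i" if "R \<kappa> k j" for k j
      using \<open>2 \<le> i\<close> \<open>i < n + 3\<close> that by (subst lead_lookup(1)) (auto simp: R_def lo_hi arc_in_S)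
    then show ?thesis unfolding ex[OF that(3)] by blast
  qed
  have cl: "(\<exists>i. R \<kappa> i j) \<longleftrightarrow> (\<exists>v\<in>keys \<kappa>. 0 < lookup (lead v) (n + 2 + j))"
    if "2 \<le> j" "j < n + 3" "keys \<kappa> \<subseteq> S" for \<kappa> j
  proof -
    have "0 < lookup (lead (x {i, k})) (n + 2 + j) \<longleftrightarrow> k = j" if "R \<kappa> i k" for i k
      using \<open>2 \<le> j\<close> \<open>j < n + 3\<close> that by (subst lead_lookup(2)) (auto simp: R_def lo_hi arc_in_S)
    then show ?thesis unfolding ex[OF that(3)] by blast
  qed
  have nc: "\<not> (i < k \<and> k < j \<and> j < l)"
    if "R \<kappa> i j" "R \<kappa> k l" "std \<kappa>" for \<kappa> i j k l
    using that incompatible_arcs_iff[of i j k l] unfolding R_def std_def by auto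
  \<comment> \<open>The common factor divides every coordinate polynomial, so a nontrivial monomial
    is recognized at index \<open>0\<close> of its leading exponent; hence \<open>\<nu>\<close> is
    nontrivial as well.\<close>
  have deg: "0 < lookup (lead v) 0" for v by (simp add: lead_def lookup_add)
  obtain u where "u \<in> keys \<mu>" using nz by (metis poly_mapping_eqI lookup_zero in_keys_iff)
  then obtain w where "w \<in> keys \<nu>" using vis[of 0] deg by blast
  obtain a b where "R \<mu> a b" using ex[of \<mu> "\<lambda>_. True"] \<mu> \<open>u \<in> _\<close> by blast
  obtain a' b' where "R \<nu> a' b'" using ex[of \<nu> "\<lambda>_. True"] \<nu> \<open>w \<in> _\<close> by blast
  have "\<exists>i j. R \<mu> i j \<and> R \<nu> i j"
  proof (rule common_arc[where N = "n + 3"])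
    show "R \<mu> a b" "R \<nu> a' b'" by fact+
    show "(\<exists>j. R \<mu> i j) \<longleftrightarrow> (\<exists>j. R \<nu> i j)" if "2 \<le> i" "i < n + 3" for i
      using op[OF that, of \<mu>] op[OF that, of \<nu>] vis[of i] \<mu> \<nu> by simp
    show "(\<exists>i. R \<mu> i j) \<longleftrightarrow> (\<exists>i. R \<nu> i j)" if "2 \<le> j" "j < n + 3" for j
      using cl[OF that, of \<mu>] cl[OF that, of \<nu>] vis[of "n + 2 + j"] \<mu> \<nu> by simp
    show "1 \<le> i \<and> i < j \<and> j \<le> n + 3" if "R \<mu> i j" for i j using that by (simp add: R_def)
    show "1 \<le> i \<and> i < j \<and> j \<le> n + 3" if "R \<nu> i j" for i j using that by (simp add: R_def)
    show "\<not> (i < k \<and> k < j \<and> j < l)" if "R \<mu> i j" "R \<mu> k l" for i j k l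
      by (rule nc[OF that]) (use \<mu> in simp)
    show "\<not> (i < k \<and> k < j \<and> j < l)" if "R \<nu> i j" "R \<nu> k l" for i j k l
      by (rule nc[OF that]) (use \<nu> in simp)
  qed
  then show "keys \<mu> \<inter> keys \<nu> \<noteq> {}" by (auto simp: R_def)
next
  fix \<mu> and v :: 'f
  have "lookup (lead v) 0 \<noteq> 0" by (simp add: lead_def lookup_add)
  then show "lead v \<noteq> 0" by auto
qed (auto simp: keys_add_nat std_def)

lemma standard_monomials_independent:
  assumes "p \<in> relations" "\<And>\<mu>. \<mu> \<in> keys p \<Longrightarrow> std \<mu>"
  shows "p = 0"
proof (rule linear_independence_by_leading_monomials[OF coeff_hom_axioms alg_indep_fan
      pvars_coord eval_coord leads_coord])
  show "inj_on (linear_weight lead) (keys p)"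
    by (rule inj_on_subset[OF linear_weight_lead_inj])
       (use assms keys_polynomial in \<open>auto simp: relations_def\<close>)
qed (use assms in \<open>auto simp: relations_def\<close>)

text \<open>The span of \<open>K_A\<close> in coordinates. Ptolemy's relations are homogeneous for
  such weights because all three products involve the same four vertices.\<close>

definition vertex_weights :: "('f \<Rightarrow>\<^sub>0 real) set" where
  "vertex_weights = {\<omega>. keys \<omega> \<subseteq> S \<and>
    (\<exists>f. \<forall>i j. 1 \<le> i \<and> i < j \<and> j \<le> n + 3 \<longrightarrow> lookup \<omega> (x {i, j}) = f i + f j)}"

lemma lookup_E_A:
  "lookup (E_A n x k) v = (if v \<in> S \<and> (k = lo v \<or> k = hi v) then 1 else 0)"
proof -
  have fin: "finite L" by (simp add: finite_polygon_diagonals finite_polygon_edges)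
  have "lookup (E_A n x k) v = (\<Sum>l\<in>{l\<in>L. k \<in> l}. if x l = v then 1 else 0)"
    by (simp add: E_A_def lookup_sum lookup_single when_def)
  also have "\<dots> = (if \<exists>l\<in>L. k \<in> l \<and> x l = v then 1 else 0)"
  proof (cases "\<exists>l\<in>L. k \<in> l \<and> x l = v")
    case True
    then obtain l where l: "l \<in> L" "k \<in> l" "x l = v" by blast
    have "(\<Sum>l'\<in>{l\<in>L. k \<in> l}. if x l' = v then 1 else 0) = (\<Sum>l'\<in>{l\<in>L. k \<in> l}. if l' = l then 1 else 0 :: real)"
      using l inj by (intro sum.cong) (auto simp: inj_on_eq_iff)
    then show ?thesis using True l fin by simp
  qed (auto intro: sum.neutral)
  also have "(\<exists>l\<in>L. k \<in> l \<and> x l = v) \<longleftrightarrow> v \<in> S \<and> (k = lo v \<or> k = hi v)"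
  proof
    assume "\<exists>l\<in>L. k \<in> l \<and> x l = v"
    then obtain l where l: "l \<in> L" "k \<in> l" "x l = v" by blast
    from l(1) obtain i j where "1 \<le> i" "i < j" "j \<le> n + 3" "l = {i, j}" unfolding L_eq by blast
    then show "v \<in> S \<and> (k = lo v \<or> k = hi v)" using l by (auto simp: lo_hi arc_in_S)
  next
    assume v: "v \<in> S \<and> (k = lo v \<or> k = hi v)"
    then obtain i j where ij: "1 \<le> i" "i < j" "j \<le> n + 3" "v = x {i, j}" by (auto elim: S_cases)
    then have "k \<in> {i, j}" using v by (auto simp: lo_hi)
    then show "\<exists>l\<in>L. k \<in> l \<and> x l = v" using ij(4) by (intro bexI[OF _ L_I[OF ij(1-3)]]) simp
  qed
  finally show ?thesis .
qed

lemma span_K_A: "span (K_A n x) = vertex_weights"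
proof
  have "subspace vertex_weights"
    unfolding subspace_def
  proof (intro conjI ballI allI)
    show "0 \<in> vertex_weights" by (auto simp: vertex_weights_def intro: exI[of _ "\<lambda>_. 0"])
  next
    fix a b assume "a \<in> vertex_weights" "b \<in> vertex_weights"
    then obtain f g where "keys a \<subseteq> S" "keys b \<subseteq> S"
      "\<forall>i j. 1 \<le> i \<and> i < j \<and> j \<le> n + 3 \<longrightarrow> lookup a (x {i, j}) = f i + f j"
      "\<forall>i j. 1 \<le> i \<and> i < j \<and> j \<le> n + 3 \<longrightarrow> lookup b (x {i, j}) = g i + g j"
      unfolding vertex_weights_def by blast
    then show "a + b \<in> vertex_weights"
      unfolding vertex_weights_def
      by (auto simp: lookup_add intro!: exI[of _ "\<lambda>i. f i + g i"] dest!: subsetD[OF Poly_Mapping.keys_add])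
  next
    fix c a assume "a \<in> vertex_weights"
    then obtain f where "keys a \<subseteq> S"
      "\<forall>i j. 1 \<le> i \<and> i < j \<and> j \<le> n + 3 \<longrightarrow> lookup a (x {i, j}) = f i + f j"
      unfolding vertex_weights_def by blast
    then show "c *\<^sub>R a \<in> vertex_weights"
      unfolding vertex_weights_def
      by (auto simp: lookup_scaleR in_keys_iff distrib_left intro!: exI[of _ "\<lambda>i. c * f i"])
  qed
  moreover have "E_A n x k \<in> vertex_weights" for k
    unfolding vertex_weights_def
    by (auto simp: lookup_E_A in_keys_iff lo_hi arc_in_S split: if_splits
        intro!: exI[of _ "\<lambda>i. if i = k then 1 else 0"])
  ultimately show "span (K_A n x) \<subseteq> vertex_weights"
    by (intro span_minimal) (auto simp: K_A_def)
  show "vertex_weights \<subseteq> span (K_A n x)"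
  proof
    fix \<omega> assume "\<omega> \<in> vertex_weights"
    then obtain f where f: "keys \<omega> \<subseteq> S"
      "\<And>i j. 1 \<le> i \<Longrightarrow> i < j \<Longrightarrow> j \<le> n + 3 \<Longrightarrow> lookup \<omega> (x {i, j}) = f i + f j"
      unfolding vertex_weights_def by blast
    have "\<omega> = (\<Sum>k\<in>{1..n + 3}. f k *\<^sub>R E_A n x k)"
    proof (rule poly_mapping_eqI)
      fix v
      show "lookup \<omega> v = lookup (\<Sum>k\<in>{1..n + 3}. f k *\<^sub>R E_A n x k) v"
      proof (cases "v \<in> S")
        case True
        then obtain i j where ij: "1 \<le> i" "i < j" "j \<le> n + 3" "v = x {i, j}" by (rule S_cases)
        have "lookup (\<Sum>k\<in>{1..n + 3}. f k *\<^sub>R E_A n x k) v =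
            (\<Sum>k\<in>{1..n + 3}. (if k = i then f k else 0) + (if k = j then f k else 0))"
          unfolding lookup_sum lookup_scaleR lookup_E_A
          by (rule sum.cong) (use ij True in \<open>auto simp: lo_hi\<close>)
        also have "\<dots> = f i + f j" using ij by (simp add: sum.distrib)
        finally show ?thesis using ij f(2) by simp
      next
        case False
        then have "lookup \<omega> v = 0" using f(1) by (auto simp: in_keys_iff)
        then show ?thesis using False by (simp add: lookup_sum lookup_scaleR lookup_E_A)
      qed
    qed
    moreover have "(\<Sum>k\<in>{1..n + 3}. f k *\<^sub>R E_A n x k) \<in> span (K_A n x)"
      by (intro span_sum span_scale span_base) (simp add: K_A_def)
    ultimately show "\<omega> \<in> span (K_A n x)" by (simp only:)
  qed
qed

lemma independent_K_A: "independent (K_A n x)"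
  unfolding K_A_def
proof (rule independent_familyI)
  fix f assume z: "(\<Sum>k\<in>{1..n + 3}. f k *\<^sub>R E_A n x k) = 0"
  have add: "f i + f j = 0" if ij: "1 \<le> i" "i < j" "j \<le> n + 3" for i j
  proof -
    have "0 = lookup (\<Sum>k\<in>{1..n + 3}. f k *\<^sub>R E_A n x k) (x {i, j})"
      unfolding z by simp
    also have "\<dots> = (\<Sum>k\<in>{1..n + 3}. (if k = i then f k else 0) + (if k = j then f k else 0))"
      unfolding lookup_sum lookup_scaleR lookup_E_A
      by (rule sum.cong) (use ij arc_in_S in \<open>auto simp: lo_hi\<close>)
    also have "\<dots> = f i + f j" using ij by (simp add: sum.distrib)
    finally show ?thesis by simp
  qed
  \<comment> \<open>In the triangle 1, 2, 3 all three pairwise sums vanish.\<close>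
  have "f 1 = 0" using add[of 1 2] add[of 1 3] add[of 2 3] by simp
  show "\<forall>k\<in>{1..n + 3}. f k = 0"
  proof
    fix k assume "k \<in> {1..n + 3}"
    then show "f k = 0" using \<open>f 1 = 0\<close> add[of 1 k] by (cases "k = 1") auto
  qed
qed simp

lemma lineality: "lineality_space (groebner_cone emb n m s) = vertex_weights"
  unfolding groebner_cone_eq[OF incompatibility_axioms]
proof (rule lineality_space_eq[where rk = "\<lambda>v. (hi v - lo v) * (n + 3 - (hi v - lo v))"])
  show "subspace vertex_weights" unfolding span_K_A[symmetric] by (rule subspace_span)
  show "keys u \<subseteq> S" if "u \<in> vertex_weights" for u
    using that by (auto simp: vertex_weights_def)
  show "p = 0" if "p \<in> relations" "\<And>\<mu>. \<mu> \<in> keys p \<Longrightarrow> std \<mu>" for p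
    using that by (rule standard_monomials_independent)
next
  let ?rk = "\<lambda>v. (hi v - lo v) * (n + 3 - (hi v - lo v))"
  fix v w assume "incompatible n m s v w"
  then obtain a b c d where *: "1 \<le> a" "a < b" "b < c" "c < d" "d \<le> n + 3"
    and vw: "v = x {a, c} \<and> w = x {b, d} \<or> v = x {b, d} \<and> w = x {a, c}"
    by (rule incompatible_cases)
  let ?p = "pvar (x {a, b}) * pvar (x {c, d}) + pvar (x {a, d}) * pvar (x {b, c}) :: ('f \<Rightarrow>\<^sub>0 nat) \<Rightarrow>\<^sub>0 'k"
  have keys: "keys ?p =
    {single (x {a, b}) 1 + single (x {c, d}) 1,
     single (x {a, d}) 1 + single (x {b, c}) 1}"
    unfolding pvar_mult_pvar keys_two_terms ..
  have ord: "a < c" "b < d" "a < d" "1 \<le> b" "1 \<le> c" "b \<le> n + 3" "c \<le> n + 3"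
    using * by auto
  note lh = lo_hi[OF *(1,2) ord(6)] lo_hi[OF *(1) ord(1,7)] lo_hi[OF *(1) ord(3) *(5)]
    lo_hi[OF ord(4) *(3) ord(7)] lo_hi[OF ord(4) ord(2) *(5)] lo_hi[OF ord(5) *(4,5)]
  have "d < n + 3 + a" using * by simp
  note quad = quadrilateral_weight[OF *(2-4) this]
  have lower: "linear_weight ?rk \<nu> < ?rk (x {a, c}) + ?rk (x {b, d})" if "\<nu> \<in> keys ?p" for \<nu>
    using that unfolding keys insert_iff empty_iff
    by (elim disjE FalseE; hypsubst; simp only: linear_weight_add linear_weight_single of_nat_1 mult_1 lh quad)
  have homog: "weight u \<nu> = weight u (single v 1 + single w 1)"
    if u: "u \<in> vertex_weights" and \<nu>: "\<nu> \<in> keys ?p" for u \<nu>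
  proof -
    obtain f where f: "\<And>i j. 1 \<le> i \<Longrightarrow> i < j \<Longrightarrow> j \<le> n + 3 \<Longrightarrow> lookup u (x {i, j}) = f i + f j"
      using u unfolding vertex_weights_def by blast
    note fs = f[OF *(1,2) ord(6)] f[OF *(1) ord(1,7)] f[OF *(1) ord(3) *(5)]
      f[OF ord(4) *(3) ord(7)] f[OF ord(4) ord(2) *(5)] f[OF ord(5) *(4,5)]
    show ?thesis using \<nu> vw unfolding keys weight_eq by (auto simp: fs)
  qed
  have "pvars ?p \<subseteq> S" using * by (intro pvars_addI pvars_multI pvars_pvarI arc_in_S) auto
  moreover have "v * w = peval emb (\<lambda>v. v) ?p"
    using vw ptolemy[OF *] by (auto simp: peval_add peval_mult mult.commute)
  ultimately show "\<exists>q. pvars q \<subseteq> S \<and> v * w = peval emb (\<lambda>v. v) q \<and>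
      (\<forall>\<nu>\<in>keys q. linear_weight ?rk \<nu> < ?rk v + ?rk w \<and>
        (\<forall>u\<in>vertex_weights. weight u \<nu> = weight u (single v 1 + single w 1)))"
    using vw lower homog by (intro exI[of _ ?p]) (auto simp only: add.commute)
next
  fix \<omega> :: "'f \<Rightarrow>\<^sub>0 real"
  assume keys: "keys \<omega> \<subseteq> S"
    and eq: "\<And>v w q \<nu>. incompatible n m s v w \<Longrightarrow> pvars q \<subseteq> S \<Longrightarrow> v * w = peval emb (\<lambda>v. v) q \<Longrightarrow>
        (\<And>\<mu>. \<mu> \<in> keys q \<Longrightarrow> std \<mu>) \<Longrightarrow> \<nu> \<in> keys q \<Longrightarrow>
        weight \<omega> \<nu> = weight \<omega> (single v 1 + single w 1)"
  define d where "d i j = lookup \<omega> (x {i, j})" for i j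
  \<comment> \<open>Only the crossings of an arc at 1 with an arc at \<open>n + 3\<close> are used.
    Both products on the right-hand side are noncrossing, hence standard.\<close>
  have rel: "d 1 i + d j (n + 3) = d 1 j + d i (n + 3)" "d 1 (n + 3) + d i j = d 1 j + d i (n + 3)"
    if ij: "1 < i" "i < j" "j < n + 3" for i j
  proof -
    let ?q = "pvar (x {1, i}) * pvar (x {j, n + 3}) + pvar (x {1, n + 3}) * pvar (x {i, j}) :: ('f \<Rightarrow>\<^sub>0 nat) \<Rightarrow>\<^sub>0 'k"
    let ?\<mu> = "single (x {1, i}) 1 + single (x {j, n + 3}) 1 :: 'f \<Rightarrow>\<^sub>0 nat"
    let ?\<nu> = "single (x {1, n + 3}) 1 + single (x {i, j}) 1 :: 'f \<Rightarrow>\<^sub>0 nat"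
    have K: "keys ?q = {?\<mu>, ?\<nu>}" unfolding pvar_mult_pvar keys_two_terms ..
    have inc: "incompatible n m s (x {1, j}) (x {i, n + 3})"
      using ij by (subst incompatible_arcs_iff) auto
    have pv: "pvars ?q \<subseteq> S" using ij by (intro pvars_addI pvars_multI pvars_pvarI arc_in_S) auto
    have ev: "x {1, j} * x {i, n + 3} = peval emb (\<lambda>v. v) ?q"
      using ptolemy[of 1 i j "n + 3"] ij by (simp add: peval_add peval_mult)
    have st: "std \<kappa>" if "\<kappa> \<in> keys ?q" for \<kappa>
      using that ij unfolding K by (auto simp: std_def keys_add_nat incompatible_arcs_iff)
    from eq[OF inc pv ev st, of ?\<mu>] eq[OF inc pv ev st, of ?\<nu>]
    show "d 1 i + d j (n + 3) = d 1 j + d i (n + 3)" "d 1 (n + 3) + d i j = d 1 j + d i (n + 3)"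
      unfolding K weight_eq by (simp_all add: d_def)
  qed
  \<comment> \<open>The first relation makes \<open>d 1 j - d j (n + 3)\<close> independent of
    \<open>j\<close>; it has to be \<open>f 1 - f (n + 3)\<close>.\<close>
  define \<kappa> where "\<kappa> = d 1 2 - d 2 (n + 3)"
  have diff: "d j (n + 3) = d 1 j - \<kappa>" if "1 < j" "j < n + 3" for j
    using that rel(1)[of 2 j] by (cases "j = 2") (auto simp: \<kappa>_def)
  \<comment> \<open>The values at 1 and \<open>n + 3\<close> are forced by their sum
    \<open>d 1 (n + 3)\<close> and their difference \<open>\<kappa>\<close>, the others by the arcs
    at 1.\<close>
  define f where "f i = (if i = 1 then (d 1 (n + 3) + \<kappa>) / 2 else if i = n + 3 then (d 1 (n + 3) - \<kappa>) / 2
    else d 1 i - (d 1 (n + 3) + \<kappa>) / 2)" for i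
  have "d i j = f i + f j" if ij: "1 \<le> i" "i < j" "j \<le> n + 3" for i j
  proof (cases "i = 1 \<or> j = n + 3")
    case True
    then show ?thesis using ij diff[of i] by (auto simp: f_def field_simps)
  next
    case False
    then show ?thesis using ij rel(2)[of i j] diff[of i] by (auto simp: f_def field_simps)
  qed
  then show "\<omega> \<in> vertex_weights"
    using keys unfolding vertex_weights_def d_def by blast
qed

theorem basis_A: "is_basis (K_A n x) (lineality_space (groebner_cone emb n m s))"
  unfolding is_basis_def lineality using independent_K_A span_K_A by simp

end

section \<open>Types B and C\<close>

declare add_2_eq_Suc [simp del] add_2_eq_Suc' [simp del]

section \<open>The antipodal map and symmetric triangulations\<close>

lemma antipode_antipode: "a \<in> {1..2 * n + 2} \<Longrightarrow> antipode n (antipode n a) = a"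
  by (auto simp: antipode_def)

lemma image_antipode_antipode: "l \<subseteq> {1..2 * n + 2} \<Longrightarrow> antipode n ` antipode n ` l = l"
  unfolding image_image using antipode_antipode by force

text \<open>The antipodal map is the rotation by \<open>n + 1\<close> steps, which respects cyclic
  order. The five cases count how many of the four vertices pass the end of the numbering.\<close>

lemma crossing_antipode:
  assumes "crossing (2 * n + 2) l l'"
  shows "crossing (2 * n + 2) (antipode n ` l) (antipode n ` l')"
proof -
  obtain a b c d where *: "1 \<le> a" "a < b" "b < c" "c < d" "d \<le> 2 * n + 2"
    and l: "l = {a, c} \<and> l' = {b, d} \<or> l = {b, d} \<and> l' = {a, c}"
    using assms by (rule crossing_obtain)
  let ?o = "antipode n"
  consider "n + 1 < a" | "a \<le> n + 1" "n + 1 < b" | "b \<le> n + 1" "n + 1 < c"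
    | "c \<le> n + 1" "n + 1 < d" | "d \<le> n + 1" by linarith
  then have "ccw (2 * n + 2) [?o a, ?o b, ?o c, ?o d]"
  proof cases
    case 1
    then have eqs: "?o a = a - (n + 1)" "?o b = b - (n + 1)" "?o c = c - (n + 1)" "?o d = d - (n + 1)"
      using * by (simp_all add: antipode_def)
    have "?o a < ?o b" "?o b < ?o c" "?o c < ?o d" "1 \<le> ?o a" "?o d \<le> 2 * n + 2"
      unfolding eqs using 1 * by linarith+
    then show ?thesis unfolding ccw4 by simp
  next
    case 2
    then have eqs: "?o a = a + (n + 1)" "?o b = b - (n + 1)" "?o c = c - (n + 1)" "?o d = d - (n + 1)"
      using * by (simp_all add: antipode_def)
    have "?o b < ?o c" "?o c < ?o d" "?o d < ?o a" "1 \<le> ?o b" "?o a \<le> 2 * n + 2"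
      unfolding eqs using 2 * by linarith+
    then show ?thesis unfolding ccw4 by simp
  next
    case 3
    then have eqs: "?o a = a + (n + 1)" "?o b = b + (n + 1)" "?o c = c - (n + 1)" "?o d = d - (n + 1)"
      using * by (simp_all add: antipode_def)
    have "?o c < ?o d" "?o d < ?o a" "?o a < ?o b" "1 \<le> ?o c" "?o b \<le> 2 * n + 2"
      unfolding eqs using 3 * by linarith+
    then show ?thesis unfolding ccw4 by simp
  next
    case 4
    then have eqs: "?o a = a + (n + 1)" "?o b = b + (n + 1)" "?o c = c + (n + 1)" "?o d = d - (n + 1)"
      using * by (simp_all add: antipode_def)
    have "?o d < ?o a" "?o a < ?o b" "?o b < ?o c" "1 \<le> ?o d" "?o c \<le> 2 * n + 2"
      unfolding eqs using 4 * by linarith+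
    then show ?thesis unfolding ccw4 by simp
  next
    case 5
    then have eqs: "?o a = a + (n + 1)" "?o b = b + (n + 1)" "?o c = c + (n + 1)" "?o d = d + (n + 1)"
      using * by (simp_all add: antipode_def)
    have "?o a < ?o b" "?o b < ?o c" "?o c < ?o d" "1 \<le> ?o a" "?o d \<le> 2 * n + 2"
      unfolding eqs using 5 * by linarith+
    then show ?thesis unfolding ccw4 by simp
  qed
  then have "crossing (2 * n + 2) {?o a, ?o c} {?o b, ?o d}" unfolding crossing_def by blast
  moreover from crossing_commute[OF this] have "crossing (2 * n + 2) {?o b, ?o d} {?o a, ?o c}" .
  ultimately show ?thesis using l by auto
qed

lemma crossing_antipode_iff:
  assumes "l \<subseteq> {1..2 * n + 2}" "l' \<subseteq> {1..2 * n + 2}"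
  shows "crossing (2 * n + 2) (antipode n ` l) l' \<longleftrightarrow> crossing (2 * n + 2) l (antipode n ` l')"
  using crossing_antipode[of n "antipode n ` l" l'] crossing_antipode[of n l "antipode n ` l'"]
  unfolding image_antipode_antipode[OF assms(1)] image_antipode_antipode[OF assms(2)] by blast

text \<open>Geometrically, antipodal segments are parallel or equal.\<close>

lemma not_crossing_antipode: "\<not> crossing (2 * n + 2) l (antipode n ` l)"
proof
  assume "crossing (2 * n + 2) l (antipode n ` l)"
  then obtain a b c d where *: "1 \<le> a" "a < b" "b < c" "c < d" "d \<le> 2 * n + 2"
    and l: "l = {a, c} \<and> antipode n ` l = {b, d} \<or> l = {b, d} \<and> antipode n ` l = {a, c}"
    by (rule crossing_obtain)
  have "antipode n a \<in> {b, d}" "antipode n c \<in> {b, d}" "antipode n b \<in> {a, c} \<or> antipode n a \<in> {b, d}"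
    if "antipode n ` {a, c} = {b, d}" using that by blast+
  moreover have "antipode n b \<in> {a, c}" "antipode n d \<in> {a, c}"
    if "antipode n ` {b, d} = {a, c}" using that by blast+
  ultimately show False using l * by (auto simp: antipode_def split: if_splits)
qed

lemma polygon_diagonals_range: "l \<in> polygon_diagonals N \<Longrightarrow> l \<subseteq> {1..N}"
  by (auto simp: polygon_diagonals_def)

lemma polygon_edges_range: "2 \<le> N \<Longrightarrow> l \<in> polygon_edges N \<Longrightarrow> l \<subseteq> {1..N}"
  by (auto simp: polygon_edges_def intro!: Suc_leI mod_less_divisor)

lemma antipode_diagonal:
  assumes "l \<in> polygon_diagonals (2 * n + 2)" "1 \<le> n"
  shows "antipode n ` l \<in> polygon_diagonals (2 * n + 2)"
proof -
  have "l \<in> polygon_diagonals (2 * n + 2) \<union> polygon_edges (2 * n + 2)" using assms by simp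
  then obtain i j where ij: "1 \<le> i" "i < j" "j \<le> 2 * n + 2" "l = {i, j}"
    by (subst (asm) polygon_segments) auto
  have nd: "\<not> (j = Suc i \<or> i = 1 \<and> j = 2 * n + 2)"
    using assms(1) polygon_diagonal_iff[OF ij(1-3)] ij(4) by simp
  consider "j \<le> n + 1" | "i \<le> n + 1" "n + 1 < j" | "n + 1 < i" by linarith
  then show ?thesis
  proof cases
    case 1
    then have "antipode n ` l = {i + (n + 1), j + (n + 1)}" using ij by (auto simp: antipode_def)
    then show ?thesis using 1 ij nd by (simp add: polygon_diagonal_iff)
  next
    case 2
    then have "antipode n ` l = {j - (n + 1), i + (n + 1)}" using ij by (auto simp: antipode_def)
    moreover have "{j - (n + 1), i + (n + 1)} \<in> polygon_diagonals (2 * n + 2)"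
      using 2 ij nd by (subst polygon_diagonal_iff) auto
    ultimately show ?thesis by simp
  next
    case 3
    then have "antipode n ` l = {i - (n + 1), j - (n + 1)}" using ij by (auto simp: antipode_def)
    moreover have "{i - (n + 1), j - (n + 1)} \<in> polygon_diagonals (2 * n + 2)"
      using 3 ij nd by (subst polygon_diagonal_iff) auto
    ultimately show ?thesis by simp
  qed
qed

text \<open>A diagonal never crosses its antipode, so a maximal symmetric noncrossing set is maximal among
  all noncrossing sets.\<close>

lemma extends_to_symmetric_triangulation:
  assumes n: "1 \<le> n" and T: "noncrossing (2 * n + 2) T" "(\<lambda>l. antipode n ` l) ` T = T"
  obtains T' where "symmetric_triangulation n T'" "T \<subseteq> T'"
proof -
  let ?N = "2 * n + 2" and ?opp = "\<lambda>l. antipode n ` l"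
  let ?\<T> = "{T. noncrossing ?N T \<and> ?opp ` T = T}"
  have "?\<T> \<subseteq> Pow (polygon_diagonals ?N)" by (auto simp: noncrossing_def)
  then have "finite ?\<T>" by (rule finite_subset) (simp add: finite_polygon_diagonals)
  then obtain T' where "T' \<in> ?\<T>" and sub: "T \<subseteq> T'"
    and max: "\<And>T''. T'' \<in> ?\<T> \<Longrightarrow> T' \<subseteq> T'' \<Longrightarrow> T'' = T'"
    by (rule noncrossing_maximal[of _ T]) (use T in simp, blast)
  then have nc: "noncrossing ?N T'" and sym: "?opp ` T' = T'" by auto
  have "T'' = T'" if T'': "noncrossing ?N T''" "T' \<subseteq> T''" for T''
  proof (rule ccontr)
    assume "T'' \<noteq> T'"
    then obtain l where l: "l \<in> T''" "l \<notin> T'" using T''(2) by blast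
    have diag: "l \<in> polygon_diagonals ?N" using T''(1) l(1) by (auto simp: noncrossing_def)
    note range = polygon_diagonals_range[OF diag]
    have oo: "?opp (?opp l) = l" by (rule image_antipode_antipode[OF range])
    have lt: "\<not> crossing ?N l t" "\<not> crossing ?N t l" if "t \<in> T'" for t
      using T'' l(1) that by (auto simp: noncrossing_def)
    have t_range: "t \<subseteq> {1..?N}" if "t \<in> T'" for t
      by (rule polygon_diagonals_range) (use nc that in \<open>auto simp: noncrossing_def\<close>)
    have opp_t: "?opp t \<in> T'" if "t \<in> T'" for t
      using imageI[OF that, of ?opp] unfolding sym .
    have olt: "\<not> crossing ?N (?opp l) t" "\<not> crossing ?N t (?opp l)" if "t \<in> T'" for t
      using lt[OF opp_t[OF that]] crossing_antipode_iff[OF range t_range[OF that]]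
        crossing_antipode_iff[OF t_range[OF that] range] by auto
    have ll: "\<not> crossing ?N l l"
      using T''(1) l(1) by (auto simp: noncrossing_def)
    have olol: "\<not> crossing ?N (?opp l) (?opp l)"
      using ll crossing_antipode[of n "?opp l" "?opp l"] oo by auto
    have lol: "\<not> crossing ?N l (?opp l)" "\<not> crossing ?N (?opp l) l"
      using not_crossing_antipode[of n l] crossing_commute by blast+
    have "insert l (insert (?opp l) T') \<in> ?\<T>"
    proof (intro CollectI conjI)
      show "noncrossing ?N (insert l (insert (?opp l) T'))"
        unfolding noncrossing_def
      proof (intro conjI ballI)
        show "insert l (insert (?opp l) T') \<subseteq> polygon_diagonals ?N"
          using diag antipode_diagonal[OF diag n] nc by (auto simp: noncrossing_def)
        fix a b assume "a \<in> insert l (insert (?opp l) T')" "b \<in> insert l (insert (?opp l) T')"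
        then show "\<not> crossing ?N a b"
          using lt olt ll olol lol nc unfolding noncrossing_def by blast
      qed
      show "?opp ` insert l (insert (?opp l) T') = insert l (insert (?opp l) T')"
        using sym oo by (simp add: insert_commute)
    qed
    from max[OF this] show False using l(2) by auto
  qed
  then have "symmetric_triangulation n T'"
    using nc sym by (auto simp: symmetric_triangulation_def triangulation_def)
  then show ?thesis using sub by (rule that)
qed

locale type_BC_model =
  fixes emb :: "'k::field_char_0 \<Rightarrow> 'f::field" and n m :: nat and s :: "'f seed"
    and y :: "nat set set \<Rightarrow> 'f" and r :: nat and cartan :: "nat \<Rightarrow> nat \<Rightarrow> nat \<Rightarrow> int"
  assumes emb: "field_embedding emb" and n: "2 \<le> n" and r: "r = 1 \<or> r = 2"
    and model: "polygon_model_BC r cartan emb n m s y"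
begin

abbreviation "h \<equiv> n + 1"
abbreviation "N \<equiv> 2 * n + 2"
abbreviation "L \<equiv> polygon_diagonals N \<union> polygon_edges N"
abbreviation "S \<equiv> all_vars n m s"
abbreviation "opp \<equiv> antipode n"

lemma seed: "is_seed emb n m s"
  and inj: "inj_on y (diagonal_pairs n \<union> edge_pairs n)"
  and cluster_vars_eq: "cluster_vars n m s = y ` diagonal_pairs n"
  and frozen_vars_eq: "frozen_vars n m s = y ` edge_pairs n"
  and clusters_eq: "clusters n m s = {y ` (seg_pair n ` T) | T. symmetric_triangulation n T}"
  and relations_eq: "(exchange_relations n m s :: (('f \<Rightarrow>\<^sub>0 nat) \<Rightarrow>\<^sub>0 'k) set) = relations_BC r n y"
  using model unfolding polygon_model_BC_def by simp_all

lemma pairs_eq: "diagonal_pairs n \<union> edge_pairs n = seg_pair n ` L"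
  by (auto simp: diagonal_pairs_def edge_pairs_def)

lemma S_eq: "S = y ` seg_pair n ` L"
  unfolding pairs_eq[symmetric] by (auto simp: all_vars_def cluster_vars_eq frozen_vars_eq)

lemma L_eq: "L = {{i, j} | i j. 1 \<le> i \<and> i < j \<and> j \<le> N}"
  by (rule polygon_segments) simp

lemma L_I: "1 \<le> i \<Longrightarrow> i < j \<Longrightarrow> j \<le> N \<Longrightarrow> {i, j} \<in> L"
  unfolding L_eq by blast

lemma L_range: "l \<in> L \<Longrightarrow> l \<subseteq> {1..N}"
  using polygon_diagonals_range[of l N] polygon_edges_range[of N l] by auto

lemma seg_pair_eq_iff:
  assumes "l \<subseteq> {1..N}"
  shows "seg_pair n l = seg_pair n l' \<longleftrightarrow> l' = l \<or> l' = opp ` l"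
proof
  assume "seg_pair n l = seg_pair n l'"
  then have "l' \<in> {l, opp ` l}" by (auto simp: seg_pair_def)
  then show "l' = l \<or> l' = opp ` l" by simp
next
  assume "l' = l \<or> l' = opp ` l"
  then show "seg_pair n l = seg_pair n l'"
    using image_antipode_antipode[OF assms] by (auto simp: seg_pair_def)
qed

text \<open>A symmetric triangulation contains with a diagonal also its antipode, so a common
  cluster excludes both crossings. Without them \<open>l\<close>, \<open>l'\<close> and their
  antipodes are noncrossing, every other crossing being antipodal to one of the two, and this
  symmetric set extends to a cluster.\<close>

lemma incompatible_iff:
  assumes "l \<in> L" "l' \<in> L"
  shows "incompatible n m s (y (seg_pair n l)) (y (seg_pair n l')) \<longleftrightarrow>
    crossing N l l' \<or> crossing N l (opp ` l')" (is "?I \<longleftrightarrow> ?C")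
proof -
  note range = L_range[OF assms(1)] L_range[OF assms(2)]
  have pair_diag: "k \<in> polygon_diagonals N" if k: "y (seg_pair n k) \<in> y ` diagonal_pairs n" "k \<in> L" for k
  proof -
    have "seg_pair n k \<in> diagonal_pairs n \<union> edge_pairs n" using k(2) by (simp add: pairs_eq)
    moreover obtain L' where "L' \<in> diagonal_pairs n" "y (seg_pair n k) = y L'" using k(1) by blast
    ultimately have "seg_pair n k \<in> diagonal_pairs n" using inj_on_eq_iff[OF inj] by auto
    then obtain k' where k': "k' \<in> polygon_diagonals N" "seg_pair n k' = seg_pair n k"
      by (auto simp: diagonal_pairs_def)
    then have "k = k' \<or> k = opp ` k'"
      using seg_pair_eq_iff[OF polygon_diagonals_range[OF k'(1)], of k] by simp
    then show ?thesis using k'(1) antipode_diagonal[OF k'(1)] n by auto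
  qed
  show ?thesis
  proof
    assume inc: ?I
    then have diag: "l \<in> polygon_diagonals N" "l' \<in> polygon_diagonals N"
      using pair_diag assms by (auto simp: incompatible_def cluster_vars_eq)
    show ?C
    proof (rule ccontr)
      assume nc: "\<not> ?C"
      let ?T = "{l, opp ` l, l', opp ` l'}"
      have oo: "opp ` opp ` l = l" "opp ` opp ` l' = l'" using range by (simp_all add: image_antipode_antipode)
      have self: "\<not> crossing N k k" for k
        by (auto simp: doubleton_eq_iff elim!: crossing_obtain)
      have anti: "\<not> crossing N k (opp ` k)" "\<not> crossing N (opp ` k) k" for k
        using not_crossing_antipode[of n k] crossing_commute by blast+
      have 1: "\<not> crossing N l l'" "\<not> crossing N l' l" "\<not> crossing N l (opp ` l')" "\<not> crossing N (opp ` l') l"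
        using nc crossing_commute by blast+
      have 2: "\<not> crossing N (opp ` l) l'" "\<not> crossing N l' (opp ` l)"
        using 1 crossing_antipode_iff[OF range] crossing_commute by blast+
      have 3: "\<not> crossing N (opp ` l) (opp ` l')" "\<not> crossing N (opp ` l') (opp ` l)"
        using 1 crossing_antipode[of n "opp ` l" "opp ` l'"] crossing_antipode[of n "opp ` l'" "opp ` l"] oo
        by auto
      have ncT: "noncrossing N ?T"
        unfolding noncrossing_def using 1 2 3 self anti diag antipode_diagonal n by auto
      have symT: "(\<lambda>l. opp ` l) ` ?T = ?T" using oo by auto
      obtain T where T: "symmetric_triangulation n T" "?T \<subseteq> T"
        by (rule extends_to_symmetric_triangulation[OF _ ncT symT]) (use n in simp, blast)
      have "y ` (seg_pair n ` T) \<in> clusters n m s" unfolding clusters_eq using T(1) by blast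
      moreover have "y (seg_pair n l) \<in> y ` (seg_pair n ` T)" "y (seg_pair n l') \<in> y ` (seg_pair n ` T)"
        by (intro imageI; use T(2) in simp)+
      ultimately have "\<exists>X\<in>clusters n m s. y (seg_pair n l) \<in> X \<and> y (seg_pair n l') \<in> X"
        by (intro bexI conjI)
      then show False using inc by (simp add: incompatible_def)
    qed
  next
    assume C: ?C
    have "l' \<in> polygon_diagonals N \<or> opp ` l' \<in> polygon_diagonals N" "l \<in> polygon_diagonals N"
      using C crossing_diagonal[OF crossing_commute] crossing_diagonal by auto
    then have diag: "l' \<in> polygon_diagonals N" "l \<in> polygon_diagonals N"
      using antipode_diagonal[of "opp ` l'" n] n image_antipode_antipode[OF range(2)] by auto
    have both: "k \<in> T \<and> opp ` k \<in> T"
      if T: "symmetric_triangulation n T" and k: "k \<in> L" "y (seg_pair n k) \<in> y ` (seg_pair n ` T)" for k T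
    proof -
      have TL: "T \<subseteq> polygon_diagonals N" and sym: "(\<lambda>l. opp ` l) ` T = T"
        using T by (auto simp: symmetric_triangulation_def triangulation_def noncrossing_def)
      obtain t where t: "t \<in> T" "y (seg_pair n k) = y (seg_pair n t)" using k(2) by blast
      have "seg_pair n k \<in> diagonal_pairs n \<union> edge_pairs n" "seg_pair n t \<in> diagonal_pairs n \<union> edge_pairs n"
        unfolding pairs_eq using k(1) t(1) TL by auto
      then have "seg_pair n k = seg_pair n t" using inj_on_eq_iff[OF inj] t(2) by simp
      then have "t = k \<or> t = opp ` k" using seg_pair_eq_iff[OF L_range[OF k(1)]] by simp
      moreover have "opp ` t \<in> T" using sym t(1) by blast
      ultimately show ?thesis
        using t(1) image_antipode_antipode[OF L_range[OF k(1)]] by auto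
    qed
    have "\<not> (\<exists>X\<in>clusters n m s. y (seg_pair n l) \<in> X \<and> y (seg_pair n l') \<in> X)"
    proof
      assume "\<exists>X\<in>clusters n m s. y (seg_pair n l) \<in> X \<and> y (seg_pair n l') \<in> X"
      then obtain T where T: "symmetric_triangulation n T"
        "y (seg_pair n l) \<in> y ` (seg_pair n ` T)" "y (seg_pair n l') \<in> y ` (seg_pair n ` T)"
        unfolding clusters_eq by blast
      have "noncrossing N T" using T(1) by (simp add: symmetric_triangulation_def triangulation_def)
      then show False
        using C both[OF T(1) assms(1) T(2)] both[OF T(1) assms(2) T(3)] by (auto simp: noncrossing_def)
    qed
    then show ?I using diag by (auto simp: incompatible_def cluster_vars_eq diagonal_pairs_def)
  qed
qed

sublocale incompatibility emb S "incompatible n m s"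
proof (rule incompatibility_seed[OF emb])
  show "finite S" unfolding S_eq
    by (simp add: finite_polygon_diagonals finite_polygon_edges)
qed

text \<open>Normal forms of segment pairs: each is either \<open>P i j\<close> with
  \<open>1 \<le> i < j \<le> h\<close> or \<open>Q i j\<close> with
  \<open>1 \<le> i \<le> j \<le> h\<close>, with unique indices. \<open>Q i i\<close> is a diameter,
  and \<open>Q 1 h\<close> is the edge pair that no \<open>P\<close> represents.\<close>

definition P :: "nat \<Rightarrow> nat \<Rightarrow> 'f" where "P i j = y (seg_pair n {i, j})"
definition Q :: "nat \<Rightarrow> nat \<Rightarrow> 'f" where "Q i j = y (seg_pair n {i, j + h})"

lemma opp_P: "1 \<le> i \<Longrightarrow> i \<le> h \<Longrightarrow> 1 \<le> j \<Longrightarrow> j \<le> h \<Longrightarrow> opp ` {i, j} = {i + h, j + h}"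
  by (auto simp: antipode_def)

lemma opp_Q: "1 \<le> i \<Longrightarrow> i \<le> h \<Longrightarrow> 1 \<le> j \<Longrightarrow> j \<le> h \<Longrightarrow> opp ` {i, j + h} = {j, i + h}"
  by (auto simp: antipode_def)

lemma P_L: "1 \<le> i \<Longrightarrow> i < j \<Longrightarrow> j \<le> h \<Longrightarrow> {i, j} \<in> L"
  by (rule L_I) auto

lemma Q_L: "1 \<le> i \<Longrightarrow> i \<le> h \<Longrightarrow> 1 \<le> j \<Longrightarrow> j \<le> h \<Longrightarrow> {i, j + h} \<in> L"
  by (rule L_I) auto

lemma P_in_S: "1 \<le> i \<Longrightarrow> i < j \<Longrightarrow> j \<le> h \<Longrightarrow> P i j \<in> S"
  unfolding S_eq P_def by (intro imageI P_L)

lemma Q_in_S: "1 \<le> i \<Longrightarrow> i \<le> j \<Longrightarrow> j \<le> h \<Longrightarrow> Q i j \<in> S"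
  unfolding S_eq Q_def by (intro imageI Q_L) auto

lemma Q_commute: "1 \<le> i \<Longrightarrow> i \<le> h \<Longrightarrow> 1 \<le> j \<Longrightarrow> j \<le> h \<Longrightarrow> y (seg_pair n {j, i + h}) = Q i j"
  using seg_pair_eq_iff[of "{i, j + h}" "{j, i + h}"] opp_Q[of i j] by (auto simp: Q_def)

lemma S_cases:
  assumes "v \<in> S"
  obtains (P) i j where "1 \<le> i" "i < j" "j \<le> h" "v = P i j"
  | (Q) i j where "1 \<le> i" "i \<le> j" "j \<le> h" "v = Q i j"
proof -
  obtain a b where ab: "1 \<le> a" "a < b" "b \<le> N" "v = y (seg_pair n {a, b})"
    using assms unfolding S_eq L_eq by blast
  consider "b \<le> h" | "a \<le> h" "h < b" "a \<le> b - h" | "a \<le> h" "h < b" "b - h < a" | "h < a" by linarith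
  then show thesis
  proof cases
    case 1
    then show thesis using ab by (intro P[of a b]) (auto simp: P_def)
  next
    case 2
    then show thesis using ab by (intro Q[of a "b - h"]) (auto simp: Q_def)
  next
    case 3
    have "y (seg_pair n {a, (b - h) + h}) = Q (b - h) a"
      by (rule Q_commute) (use 3 ab in auto)
    then show thesis using 3 ab by (intro Q[of "b - h" a]) auto
  next
    case 4
    have "opp ` {a - h, b - h} = {a, b}" using 4 ab by (subst opp_P) auto
    then have "seg_pair n {a - h, b - h} = seg_pair n {a, b}"
      using 4 ab by (subst seg_pair_eq_iff) auto
    then show thesis using 4 ab by (intro P[of "a - h" "b - h"]) (auto simp: P_def)
  qed
qed

lemma y_eq_iff: "l \<in> L \<Longrightarrow> l' \<in> L \<Longrightarrow> y (seg_pair n l) = y (seg_pair n l') \<longleftrightarrow> l' = l \<or> l' = opp ` l"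
  using inj_on_eq_iff[OF inj, of "seg_pair n l" "seg_pair n l'"] seg_pair_eq_iff[OF L_range, of l l']
  by (simp add: pairs_eq)

lemma P_eq_iff:
  assumes "1 \<le> i" "i < j" "j \<le> h" "1 \<le> k" "k < l" "l \<le> h"
  shows "P i j = P k l \<longleftrightarrow> i = k \<and> j = l"
  unfolding P_def using assms by (subst y_eq_iff[OF P_L P_L]) (auto simp: antipode_def doubleton_eq_iff)

lemma Q_eq_iff:
  assumes "1 \<le> i" "i \<le> j" "j \<le> h" "1 \<le> k" "k \<le> l" "l \<le> h"
  shows "Q i j = Q k l \<longleftrightarrow> i = k \<and> j = l"
  unfolding Q_def using assms by (subst y_eq_iff[OF Q_L Q_L]) (auto simp: antipode_def doubleton_eq_iff)

lemma P_neq_Q: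
  assumes "1 \<le> i" "i < j" "j \<le> h" "1 \<le> k" "k \<le> l" "l \<le> h"
  shows "P i j \<noteq> Q k l"
  unfolding P_def Q_def using assms by (subst y_eq_iff[OF P_L Q_L]) (auto simp: antipode_def doubleton_eq_iff)

lemma incompatible_PP:
  assumes "1 \<le> i" "i < j" "j \<le> h" "1 \<le> k" "k < l" "l \<le> h"
  shows "incompatible n m s (P i j) (P k l) \<longleftrightarrow> i < k \<and> k < j \<and> j < l \<or> k < i \<and> i < l \<and> l < j"
proof -
  have "opp ` {k, l} = {k + h, l + h}" using assms by (intro opp_P) auto
  moreover have "crossing N {i, j} {k, l} \<longleftrightarrow> i < k \<and> k < j \<and> j < l \<or> k < i \<and> i < l \<and> l < j"
    using assms by (subst crossing_iff) auto
  moreover have "\<not> crossing N {i, j} {k + h, l + h}"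
    using assms by (subst crossing_iff) auto
  ultimately show ?thesis unfolding P_def incompatible_iff[OF P_L[OF assms(1-3)] P_L[OF assms(4-6)]] by simp
qed

lemma incompatible_PQ:
  assumes "1 \<le> i" "i < j" "j \<le> h" "1 \<le> k" "k \<le> l" "l \<le> h"
  shows "incompatible n m s (P i j) (Q k l) \<longleftrightarrow> i < k \<and> k < j \<or> i < l \<and> l < j"
proof -
  have kl: "k \<le> h" "1 \<le> l" using assms by auto
  have "opp ` {k, l + h} = {l, k + h}" using assms kl by (intro opp_Q)
  moreover have "crossing N {i, j} {k, l + h} \<longleftrightarrow> i < k \<and> k < j"
    using assms by (subst crossing_iff) auto
  moreover have "crossing N {i, j} {l, k + h} \<longleftrightarrow> i < l \<and> l < j"
    using assms by (subst crossing_iff) auto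
  ultimately show ?thesis
    unfolding P_def Q_def incompatible_iff[OF P_L[OF assms(1-3)] Q_L[OF assms(4) kl assms(6)]] by simp
qed

lemma incompatible_QQ:
  assumes "1 \<le> i" "i \<le> j" "j \<le> h" "1 \<le> k" "k \<le> l" "l \<le> h"
  shows "incompatible n m s (Q i j) (Q k l) \<longleftrightarrow> i < k \<and> j < l \<or> k < i \<and> l < j"
proof -
  have ij: "i \<le> h" "1 \<le> j" and kl: "k \<le> h" "1 \<le> l" using assms by auto
  have "opp ` {k, l + h} = {l, k + h}" using assms kl by (intro opp_Q)
  moreover have "crossing N {i, j + h} {k, l + h} \<longleftrightarrow> i < k \<and> j < l \<or> k < i \<and> l < j"
    using assms by (subst crossing_iff) auto
  moreover have "crossing N {i, j + h} {l, k + h} \<longrightarrow> i < k \<and> j < l \<or> k < i \<and> l < j"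
    using assms by (subst crossing_iff) auto
  ultimately show ?thesis
    unfolding Q_def incompatible_iff[OF Q_L[OF assms(1) ij assms(3)] Q_L[OF assms(4) kl assms(6)]] by auto
qed

lemma incompatible_commute: "incompatible n m s v w \<Longrightarrow> incompatible n m s w v"
  unfolding incompatible_def by blast

text \<open>In \<open>PQ\<close> the first end \<open>k\<close> of the \<open>Q\<close> arc lies
  under the \<open>P\<close> arc; \<open>PQ'\<close> is the remaining case, with only
  \<open>l\<close> under it.\<close>

lemma incompatible_cases:
  assumes "incompatible n m s v w"
  obtains
    (PP) i j k l where "1 \<le> i" "i < k" "k < j" "j < l" "l \<le> h" "{v, w} = {P i j, P k l}"
  | (PQ) i j k l where "1 \<le> i" "i < k" "k < j" "j \<le> h" "k \<le> l" "l \<le> h" "{v, w} = {P i j, Q k l}"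
  | (PQ') i j k l where "1 \<le> k" "k \<le> i" "i < l" "l < j" "j \<le> h" "{v, w} = {P i j, Q k l}"
  | (QQ) i j k l where "1 \<le> i" "i \<le> j" "j < l" "l \<le> h" "i < k" "k \<le> l" "{v, w} = {Q i j, Q k l}"
proof -
  have SS: "v \<in> S" "w \<in> S" using assms bad by auto
  from SS(1) show thesis
  proof (cases rule: S_cases)
    case (P i j)
    note v = P
    from SS(2) show thesis
    proof (cases rule: S_cases)
      case (P k l)
      have "i < k \<and> k < j \<and> j < l \<or> k < i \<and> i < l \<and> l < j"
        using assms incompatible_PP[OF v(1-3) P(1-3)] v(4) P(4) by simp
      then show thesis using v P PP[of i k j l] PP[of k i l j] by auto
    next
      case (Q k l)
      have "i < k \<and> k < j \<or> i < l \<and> l < j"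
        using assms incompatible_PQ[OF v(1-3) Q(1-3)] v(4) Q(4) by simp
      then show thesis using v Q PQ[of i k j l] PQ'[of k i l j] by (cases "i < k \<and> k < j") auto
    qed
  next
    case (Q k l)
    note v = Q
    from SS(2) show thesis
    proof (cases rule: S_cases)
      case (P i j)
      have "i < k \<and> k < j \<or> i < l \<and> l < j"
        using incompatible_commute[OF assms] incompatible_PQ[OF P(1-3) v(1-3)] v(4) P(4) by simp
      then show thesis using v P PQ[of i k j l] PQ'[of k i l j] by (cases "i < k \<and> k < j") auto
    next
      case (Q i j)
      have "k < i \<and> l < j \<or> i < k \<and> j < l"
        using assms incompatible_QQ[OF v(1-3) Q(1-3)] v(4) Q(4) by simp
      then show thesis using v Q QQ[of i j l k] QQ[of k l j i] by auto
    qed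
  qed
qed

end

section \<open>Exchange relations and coordinates in types B and C\<close>

context type_BC_model
begin

abbreviation "d \<equiv> 2 div r"

lemma relation_vanishes: "p \<in> relations_BC r n y \<Longrightarrow> peval emb (\<lambda>v. v) (p :: ('f \<Rightarrow>\<^sub>0 nat) \<Rightarrow>\<^sub>0 'k) = 0"
  by (rule exchange_relation_vanishes[OF emb seed]) (simp add: relations_eq)

lemma exchange_diameters:
  assumes "1 \<le> i" "i < j" "j \<le> h"
  shows "Q i i * Q j j = P i j ^ r + Q i j ^ r"
proof -
  have opp: "opp i = i + h" "opp j = j + h" using assms by (auto simp: antipode_def)
  let ?X = "\<lambda>i j. pvar (y (seg_pair n {i, j})) :: ('f \<Rightarrow>\<^sub>0 nat) \<Rightarrow>\<^sub>0 'k"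
  have "?X i (opp i) * ?X j (opp j) - ?X i j ^ r - ?X i (opp j) ^ r \<in> relations_BC r n y"
    unfolding relations_BC_def Let_def
    by (intro UnI2 CollectI exI[of _ i] exI[of _ j]) (use assms in \<open>auto simp: opp\<close>)
  from relation_vanishes[OF this] show ?thesis
    by (simp add: opp peval_diff peval_mult peval_power P_def Q_def diff_eq_eq add.commute)
qed

lemma exchange_triangle:
  assumes "1 \<le> a" "a < b" "b < c" "c < a + h" "a \<le> h"
  shows "y (seg_pair n {a, c}) * y (seg_pair n {a, opp b}) =
    y (seg_pair n {a, b}) * y (seg_pair n {a, opp c}) + y (seg_pair n {a, a + h}) ^ d * y (seg_pair n {b, c})"
proof -
  have opp: "opp a = a + h" using assms by (auto simp: antipode_def)
  let ?X = "\<lambda>i j. pvar (y (seg_pair n {i, j})) :: ('f \<Rightarrow>\<^sub>0 nat) \<Rightarrow>\<^sub>0 'k"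
  have "ccw N [a, b, c, opp a]" unfolding ccw4 opp using assms by auto
  then have "?X a c * ?X a (opp b) - ?X a b * ?X a (opp c) - ?X a (opp a) ^ d * ?X b c \<in> relations_BC r n y"
    unfolding relations_BC_def Let_def
    by (intro UnI1 UnI2 CollectI exI[of _ a] exI[of _ b] exI[of _ c]) simp
  from relation_vanishes[OF this] show ?thesis
    by (simp add: opp peval_diff peval_mult peval_power diff_eq_eq add.commute)
qed

text \<open>The triangle relation with \<open>a = 1\<close>. If the antipode of 1 is taken as the
  last vertex of the fan, it is Ptolemy's relation, with \<open>Q 1 1 ^ d\<close> for the arc
  between the extreme vertices.\<close>

lemma exchange_first:
  assumes "2 \<le> i" "i < j" "j \<le> h"
  shows "P 1 j * Q 1 i = P 1 i * Q 1 j + Q 1 1 ^ d * P i j"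
proof -
  have "opp i = i + h" "opp j = j + h" using assms by (auto simp: antipode_def)
  then show ?thesis using exchange_triangle[of 1 i j] assms by (simp add: P_def Q_def)
qed

text \<open>The triangle relation with \<open>a = i\<close> and \<open>c\<close> the antipode of 1.
  In type C it determines \<open>Q i j\<close>, for which the relation between diameters gives only
  the square.\<close>

lemma exchange_second:
  assumes "2 \<le> i" "i < j" "j \<le> h"
  shows "Q 1 i * Q i j = P i j * P 1 i + Q i i ^ d * Q 1 j"
proof -
  have "opp j = j + h" "opp (1 + h) = 1" using assms by (auto simp: antipode_def)
  moreover have "y (seg_pair n {i, 1 + h}) = Q 1 i" "y (seg_pair n {j, 1 + h}) = Q 1 j"
    by (rule Q_commute; use assms in simp)+
  moreover have "{i, 1} = {1, i}" by auto
  ultimately show ?thesis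
    using exchange_triangle[of i j "1 + h"] assms by (simp add: P_def Q_def[of i])
qed

definition fan :: "nat \<Rightarrow> 'f" where
  "fan i = (if i = 0 then Q 1 1 else if i \<le> h then Q 1 i / Q 1 1 ^ d else P 1 (i - h) / Q 1 1 ^ d)"

lemma fan_cluster:
  obtains X where "X \<in> clusters n m s" "Q 1 1 \<in> X" "\<And>j. 3 \<le> j \<Longrightarrow> j \<le> h \<Longrightarrow> P 1 j \<in> X"
proof -
  \<comment> \<open>The fan at 1 within one half, its antipodal copy at \<open>1 + h\<close>, and
    the diameter between the two.\<close>
  let ?T = "{l. \<exists>b. l = {1, b} \<and> 3 \<le> b \<and> b \<le> 1 + h \<or> l = {1 + h, b} \<and> h + 3 \<le> b \<and> b \<le> 2 * h \<or> l = {1, 1 + h}}"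
  have diag: "l \<in> polygon_diagonals N" if "l \<in> ?T" for l
    using that n polygon_diagonal_iff[of 1 _ N] polygon_diagonal_iff[of "1 + h" _ N] by auto
  have nc: "\<not> crossing N l l'" if l: "l \<in> ?T" "l' \<in> ?T" for l l'
  proof -
    have "\<exists>b. l = {1, b} \<and> 1 < b \<and> b \<le> 1 + h \<or> l = {1 + h, b} \<and> 1 + h < b" using l(1) by auto
    then obtain b where b: "l = {1, b} \<and> 1 < b \<and> b \<le> 1 + h \<or> l = {1 + h, b} \<and> 1 + h < b" by blast
    have "\<exists>b. l' = {1, b} \<and> 1 < b \<and> b \<le> 1 + h \<or> l' = {1 + h, b} \<and> 1 + h < b" using l(2) by auto
    then obtain b' where b': "l' = {1, b'} \<and> 1 < b' \<and> b' \<le> 1 + h \<or> l' = {1 + h, b'} \<and> 1 + h < b'" by blast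
    show ?thesis using b b' by (elim disjE conjE; hypsubst; subst crossing_iff; simp)
  qed
  have ncT: "noncrossing N ?T" unfolding noncrossing_def using diag nc by blast
  have opp_T: "opp ` l \<in> ?T" if "l \<in> ?T" for l
  proof -
    from that obtain b where b: "l = {1, b} \<and> 3 \<le> b \<and> b \<le> 1 + h \<or> l = {1 + h, b} \<and> h + 3 \<le> b \<and> b \<le> 2 * h
        \<or> l = {1, 1 + h}" unfolding mem_Collect_eq by (rule exE)
    have diam: "opp ` {1, 1 + h} = {1, 1 + h}" by (auto simp: antipode_def)
    consider "l = {1, 1 + h}" | "l = {1, b}" "3 \<le> b" "b \<le> h" | "l = {1 + h, b}" "h + 3 \<le> b" "b \<le> 2 * h"
      using b by (cases "b = 1 + h") (fastforce simp: le_Suc_eq)+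
    then show ?thesis
    proof cases
      case 1
      then show ?thesis using diam by blast
    next
      case 2
      then have "opp ` l = {1 + h, b + h}" "h + 3 \<le> b + h" "b + h \<le> 2 * h" by (auto simp: antipode_def)
      then show ?thesis by blast
    next
      case 3
      then have "opp ` l = {1, b - h}" "3 \<le> b - h" "b - h \<le> 1 + h" by (auto simp: antipode_def)
      then show ?thesis by blast
    qed
  qed
  have symT: "(\<lambda>l. opp ` l) ` ?T = ?T"
  proof
    show "(\<lambda>l. opp ` l) ` ?T \<subseteq> ?T" by (rule image_subsetI) (rule opp_T)
    show "?T \<subseteq> (\<lambda>l. opp ` l) ` ?T"
    proof
      fix l assume l: "l \<in> ?T"
      have "l = opp ` (opp ` l)" using image_antipode_antipode[OF polygon_diagonals_range[OF diag[OF l]]] by simp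
      then show "l \<in> (\<lambda>l. opp ` l) ` ?T" using opp_T[OF l] by (rule image_eqI)
    qed
  qed
  have "1 \<le> n" using n by simp
  then obtain T where T: "symmetric_triangulation n T" "?T \<subseteq> T"
    by (rule extends_to_symmetric_triangulation[OF _ ncT symT])
  show thesis
  proof (rule that)
    show "y ` (seg_pair n ` T) \<in> clusters n m s" unfolding clusters_eq using T(1) by blast
    show "Q 1 1 \<in> y ` (seg_pair n ` T)"
      unfolding Q_def by (intro imageI subsetD[OF T(2)]) simp
    show "P 1 j \<in> y ` (seg_pair n ` T)" if "3 \<le> j" "j \<le> h" for j
      unfolding P_def by (intro imageI subsetD[OF T(2)]) (use that in auto)
  qed
qed

lemma frozen_P: "1 \<le> i \<Longrightarrow> i < h \<Longrightarrow> P i (Suc i) \<in> frozen_vars n m s"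
  unfolding frozen_vars_eq P_def edge_pairs_def
  by (intro imageI) (simp add: polygon_edge_iff)

lemma frozen_Q: "Q 1 h \<in> frozen_vars n m s"
proof -
  have "y (seg_pair n {h, 1 + h}) = Q 1 h" by (rule Q_commute) auto
  moreover have "{h, 1 + h} \<in> polygon_edges N" by (subst polygon_edge_iff) auto
  ultimately show ?thesis unfolding frozen_vars_eq edge_pairs_def by force
qed

lemma alg_indep_fan: "alg_indep emb (fan_index h) fan"
proof -
  \<comment> \<open>Arcs between consecutive vertices of the fan. Its last vertex is the antipode
    \<open>h + 1\<close> of 1, so the last arc is the edge \<open>{h, h + 1}\<close>, labelled
    \<open>Q 1 h\<close>.\<close>
  let ?c = "\<lambda>i. if i < h then P i (Suc i) else Q 1 h"
  let ?G = "\<lambda>i. if i = 0 then Q 1 1 else if i \<le> h then ?c i else P 1 (i - h)"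
  obtain X where X: "X \<in> clusters n m s" "Q 1 1 \<in> X" "\<And>j. 3 \<le> j \<Longrightarrow> j \<le> h \<Longrightarrow> P 1 j \<in> X"
    by (rule fan_cluster) blast
  have mem: "?G i \<in> X \<union> frozen_vars n m s" if i: "i \<in> fan_index h" for i
  proof -
    consider "i = 0" | "2 \<le> i" "i < h" | "i = h" | "i = h + 2" | "h + 3 \<le> i" "i \<le> 2 * h"
      using i by (fastforce simp: fan_index_def)
    then show ?thesis
    proof cases
      case 4
      then show ?thesis using frozen_P[of 1] n by (simp add: numeral_2_eq_2)
    qed (use X(2) X(3)[of "i - h"] frozen_P[of i] frozen_Q in auto)
  qed
  have "inj_on ?G (fan_index h)"
  proof (rule inj_onI)
    fix i j assume ij: "i \<in> fan_index h" "j \<in> fan_index h" and eq: "?G i = ?G j"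
    have form: "(\<exists>k. ?G i = Q 1 k \<and> 1 \<le> k \<and> k \<le> h \<and> i = (if k = 1 then 0 else k)) \<or>
      (\<exists>a b. ?G i = P a b \<and> 1 \<le> a \<and> a < b \<and> b \<le> h \<and> i = (if a = 1 then h + b else a))"
      if i: "i \<in> fan_index h" for i
    proof -
      have "i = 0 \<or> 2 \<le> i \<and> i \<le> h \<or> h + 2 \<le> i \<and> i \<le> 2 * h"
        using i unfolding fan_index_def Un_iff singleton_iff atLeastAtMost_iff by blast
      then consider "i = 0" | "2 \<le> i" "i < h" | "i = h" | "h + 2 \<le> i" "i \<le> 2 * h" by linarith
      then show ?thesis
      proof cases
        case 2
        then have "?G i = P i (Suc i)" by simp
        then show ?thesis using 2 by (intro disjI2 exI[of _ i] exI[of _ "Suc i"]) simp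
      next
        case 4
        then have "i \<noteq> 0" "\<not> i \<le> h" by linarith+
        then have "?G i = P 1 (i - h)" by (simp only: if_False)
        moreover have "1 < i - h" "i - h \<le> h" "i = (if (1::nat) = 1 then h + (i - h) else 1)"
          using 4 by (arith, arith, simp)
        ultimately show ?thesis by (intro disjI2 exI[of _ 1] exI[of _ "i - h"] conjI le_refl)
      next
        case 3
        then show ?thesis using n by (intro disjI1 exI[of _ h]) simp
      next
        case 1
        then show ?thesis by (intro disjI1 exI[of _ 1]) simp
      qed
    qed
    show "i = j"
      using form[OF ij(1)] form[OF ij(2)]
    proof (elim disjE exE conjE)
      fix k l assume "?G i = Q 1 k" "?G j = Q 1 l"
      then have "Q 1 k = Q 1 l" using eq by (simp only:)
      moreover assume *: "1 \<le> k" "k \<le> h" "1 \<le> l" "l \<le> h"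
      moreover assume "i = (if k = 1 then 0 else k)" "j = (if l = 1 then 0 else l)"
      ultimately show ?thesis using Q_eq_iff[of 1 k 1 l] by simp
    next
      fix k a b assume "?G i = Q 1 k" "?G j = P a b"
      then have "P a b = Q 1 k" using eq by (simp only:)
      moreover assume "1 \<le> a" "a < b" "b \<le> h" "1 \<le> k" "k \<le> h"
      ultimately show ?thesis using P_neq_Q[of a b 1 k] by simp
    next
      fix k a b assume "?G i = P a b" "?G j = Q 1 k"
      then have "P a b = Q 1 k" using eq by (simp only:)
      moreover assume "1 \<le> a" "a < b" "b \<le> h" "1 \<le> k" "k \<le> h"
      ultimately show ?thesis using P_neq_Q[of a b 1 k] by simp
    next
      fix a b a' b' assume "?G i = P a b" "?G j = P a' b'"
      then have "P a b = P a' b'" using eq by (simp only:)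
      moreover assume "1 \<le> a" "a < b" "b \<le> h" "1 \<le> a'" "a' < b'" "b' \<le> h"
      moreover assume "i = (if a = 1 then h + b else a)" "j = (if a' = 1 then h + b' else a')"
      ultimately show ?thesis using P_eq_iff[of a b a' b'] by simp
    qed
  qed
  moreover have "?G ` fan_index h \<subseteq> X \<union> frozen_vars n m s" using mem by blast
  ultimately have ind: "alg_indep emb (fan_index h) ?G"
    by (rule cluster_alg_indep[OF emb seed X(1)])
  have "alg_indep emb (fan_index h) (\<lambda>i. if i = 0 then Q 1 1
      else if i \<le> h then Q 1 i / Q 1 1 ^ d else P 1 (i - h) / Q 1 1 ^ d)"
  proof (rule fan_alg_indep[OF emb ind])
    show "2 \<le> h" using n by simp
    show "Q 1 h = ?c h" by simp
    show "P 1 (Suc j) * Q 1 j = P 1 j * Q 1 (Suc j) + Q 1 1 ^ d * ?c j" if "2 \<le> j" "j < h" for j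
      using exchange_first[of j "Suc j"] that by simp
  qed
  then show ?thesis unfolding fan_def[abs_def] .
qed

text \<open>The coordinates of vertex \<open>j\<close> as field elements: its arcs to vertex 1 and
  to the antipode of 1, divided by the factor that belongs to the diameter at 1.\<close>

definition al :: "nat \<Rightarrow> 'f" where "al j = (if j = 1 then 0 else P 1 j / Q 1 1 ^ d)"
definition be :: "nat \<Rightarrow> 'f" where "be j = (if j = 1 then 1 else Q 1 j / Q 1 1 ^ d)"

lemma al_one [simp]: "al (Suc 0) = 0" and be_one [simp]: "be (Suc 0) = 1"
  by (simp_all add: al_def be_def)

lemma eval_alpha: "1 \<le> j \<Longrightarrow> j \<le> h \<Longrightarrow> peval emb fan (alpha h j) = al j"
  by (auto simp: alpha_def fan_def al_def)

lemma eval_beta: "1 \<le> j \<Longrightarrow> j \<le> h \<Longrightarrow> peval emb fan (beta h j) = be j"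
  by (auto simp: beta_def fan_def be_def)

lemma Q11_nz: "Q 1 1 \<noteq> 0"
  using alg_indep_nonzero[OF alg_indep_fan, of 0] by (simp add: fan_index_def fan_def)

lemma be_nz: "1 \<le> j \<Longrightarrow> j \<le> h \<Longrightarrow> be j \<noteq> 0"
  using alg_indep_nonzero[OF alg_indep_fan, of j] by (auto simp: fan_index_def fan_def be_def)

lemma P1_eq: "2 \<le> j \<Longrightarrow> P 1 j = Q 1 1 ^ d * al j"
  and Q1_eq: "2 \<le> j \<Longrightarrow> Q 1 j = Q 1 1 ^ d * be j"
  using Q11_nz by (auto simp: al_def be_def)

lemma P_eq:
  assumes "1 \<le> i" "i < j" "j \<le> h"
  shows "P i j = Q 1 1 ^ d * (be i * al j - al i * be j)"
proof (cases "i = 1")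
  case True
  then show ?thesis using assms P1_eq[of j] by simp
next
  case False
  then have "Q 1 1 ^ d * al j * (Q 1 1 ^ d * be i) = Q 1 1 ^ d * al i * (Q 1 1 ^ d * be j) + Q 1 1 ^ d * P i j"
    using exchange_first[of i j] assms P1_eq[of i] P1_eq[of j] Q1_eq[of i] Q1_eq[of j] by simp
  then have "Q 1 1 ^ d * P i j = Q 1 1 ^ d * (Q 1 1 ^ d * (be i * al j - al i * be j))"
    by (simp add: algebra_simps)
  then show ?thesis using Q11_nz by simp
qed

text \<open>This comes from the relation between the diameters at 1 and at \<open>j\<close>; the
  powers of the common factor fit since \<open>d * r = 2\<close>.\<close>

lemma T_eq:
  assumes "1 \<le> j" "j \<le> h"
  shows "Q j j = Q 1 1 * (al j ^ r + be j ^ r)"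
proof (cases "j = 1")
  case True
  then show ?thesis using r by (auto simp: al_def be_def)
next
  case False
  then have "Q 1 1 * Q j j = (Q 1 1 ^ d * al j) ^ r + (Q 1 1 ^ d * be j) ^ r"
    using exchange_diameters[of 1 j] assms P1_eq[of j] Q1_eq[of j] by simp
  also have "\<dots> = Q 1 1 * (Q 1 1 * (al j ^ r + be j ^ r))"
    using r by (auto simp: power2_eq_square algebra_simps)
  finally show ?thesis using Q11_nz by simp
qed

text \<open>The bracket is the minor of vertex \<open>j\<close> with the vector (\<beta>, -\<alpha>)
  of vertex \<open>i\<close>, the image of \<open>i\<close> under the half turn.\<close>

lemma Q_eq_C:
  assumes r2: "r = 2" and ij: "1 \<le> i" "i \<le> j" "j \<le> h"
  shows "Q i j = Q 1 1 * (be i * be j + al i * al j)"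
proof -
  have d: "z ^ d = z" and sq: "z ^ r = z ^ 2" for z :: 'f by (simp_all add: r2)
  consider "i = j" | "i = 1" "i < j" | "2 \<le> i" "i < j" using ij by linarith
  then show ?thesis
  proof cases
    case 1
    then show ?thesis using T_eq[of j] ij by (simp add: sq power2_eq_square add.commute)
  next
    case 2
    then show ?thesis using Q1_eq[of j] by (simp add: d)
  next
    case 3
    let ?t = "Q 1 1"
    have Tii: "Q i i = Q 1 1 * (al i ^ r + be i ^ r)" using T_eq[of i] ij by simp
    have "(?t * be i) * Q i j = P i j * (?t * al i) + Q i i * (?t * be j)"
      using exchange_second[of i j] 3 ij P1_eq[of i] Q1_eq[of i] Q1_eq[of j] by (simp add: d)
    also have "\<dots> = (?t * be i) * (?t * (be i * be j + al i * al j))"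
      unfolding P_eq[OF ij(1) 3(2) ij(3)] Tii d sq by (simp add: power2_eq_square algebra_simps)
    finally show ?thesis using Q11_nz be_nz[of i] 3 ij by simp
  qed
qed

text \<open>The bracket is the minor of vertex \<open>j\<close> with the vector (2 \<alpha> +
  \<beta>, -\<alpha>) of vertex \<open>i\<close>. It is not symmetric, so the order of
  \<open>i\<close> and \<open>j\<close> matters; for \<open>i = j\<close> it would give the square
  of the diameter instead of the diameter.\<close>

lemma Q_eq_B:
  assumes r1: "r = 1" and ij: "1 \<le> i" "i < j" "j \<le> h"
  shows "Q i j = Q 1 1 ^ 2 * (be i * be j + (al i * al j + 2 * (al i * be j)))"
proof -
  have d: "z ^ d = z ^ 2" and one: "z ^ r = z" for z :: 'f by (simp_all add: r1)
  have "Q i j = Q i i * Q j j - P i j" using exchange_diameters[of i j] ij by (simp add: one)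
  moreover have "Q i i = Q 1 1 * (al i ^ r + be i ^ r)" "Q j j = Q 1 1 * (al j ^ r + be j ^ r)"
    using T_eq[of i] T_eq[of j] ij by simp_all
  ultimately show ?thesis
    unfolding P_eq[OF ij] d one by (simp add: power2_eq_square algebra_simps)
qed

text \<open>Definition by cases on the normal form of a label, well defined because the elements
  \<open>P i j\<close> and \<open>Q i j\<close> are pairwise distinct. The value is unspecified
  outside \<open>S\<close>.\<close>

definition arc_case :: "(nat \<Rightarrow> nat \<Rightarrow> 'c) \<Rightarrow> (nat \<Rightarrow> nat \<Rightarrow> 'c) \<Rightarrow> 'f \<Rightarrow> 'c" where
  "arc_case F G v = (THE z. (\<exists>i j. 1 \<le> i \<and> i < j \<and> j \<le> h \<and> v = P i j \<and> z = F i j) \<or>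
    (\<exists>i j. 1 \<le> i \<and> i \<le> j \<and> j \<le> h \<and> v = Q i j \<and> z = G i j))"

lemma arc_case_P:
  assumes "1 \<le> i" "i < j" "j \<le> h" shows "arc_case F G (P i j) = F i j"
  unfolding arc_case_def
proof (rule the_equality)
  show "(\<exists>k l. 1 \<le> k \<and> k < l \<and> l \<le> h \<and> P i j = P k l \<and> F i j = F k l) \<or>
    (\<exists>k l. 1 \<le> k \<and> k \<le> l \<and> l \<le> h \<and> P i j = Q k l \<and> F i j = G k l)" using assms by blast
qed (use assms P_eq_iff[OF assms] P_neq_Q[OF assms] in auto)

lemma arc_case_Q:
  assumes "1 \<le> i" "i \<le> j" "j \<le> h" shows "arc_case F G (Q i j) = G i j"
  unfolding arc_case_def
proof (rule the_equality)
  show "(\<exists>k l. 1 \<le> k \<and> k < l \<and> l \<le> h \<and> Q i j = P k l \<and> G i j = F k l) \<or>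
    (\<exists>k l. 1 \<le> k \<and> k \<le> l \<and> l \<le> h \<and> Q i j = Q k l \<and> G i j = G k l)" using assms by blast
qed (use assms Q_eq_iff[OF assms] P_neq_Q[OF _ _ _ assms] in \<open>auto dest: sym\<close>)

definition coord :: "'f \<Rightarrow> ((nat \<Rightarrow>\<^sub>0 nat) \<Rightarrow>\<^sub>0 'k)" where
  "coord = arc_case (\<lambda>i j. pvar 0 ^ d * (beta h i * alpha h j - alpha h i * beta h j))
    (\<lambda>i j. if r = 1 \<and> i = j then pvar 0 * (beta h i + alpha h i)
      else pvar 0 ^ d * (beta h i * beta h j + (alpha h i * alpha h j
        + single 0 (if r = 1 then 2 else 0) * (alpha h i * beta h j))))"

definition lead :: "'f \<Rightarrow> (nat \<Rightarrow>\<^sub>0 nat)" where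
  "lead = arc_case (\<lambda>i j. single 0 d + (beta_exp h i + alpha_exp h j))
    (\<lambda>i j. if r = 1 \<and> i = j then single 0 1 + beta_exp h i
      else single 0 d + (beta_exp h i + beta_exp h j))"

lemma leads_pvar_power: "leads (single i k) (pvar i ^ k :: (nat \<Rightarrow>\<^sub>0 nat) \<Rightarrow>\<^sub>0 'k)"
  unfolding pvar_power by (rule leads_single) simp

lemma leads_coord:
  assumes "v \<in> S" shows "leads (lead v) (coord v)"
  using assms
proof (cases rule: S_cases)
  case (P i j)
  have "leads (single 0 d + (beta_exp h i + alpha_exp h j))
    (pvar 0 ^ d * (beta h i * alpha h j - alpha h i * beta h j) :: (nat \<Rightarrow>\<^sub>0 nat) \<Rightarrow>\<^sub>0 'k)"
    by (intro leads_mult leads_pvar_power leads_minor) (use P in auto)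
  then show ?thesis using P by (simp add: lead_def coord_def arc_case_P)
next
  case (Q i j)
  show ?thesis
  proof (cases "r = 1 \<and> i = j")
    case True
    have "leads (single 0 1 + beta_exp h i) (pvar 0 * (beta h i + alpha h i) :: (nat \<Rightarrow>\<^sub>0 nat) \<Rightarrow>\<^sub>0 'k)"
      by (intro leads_mult leads_pvar leads_beta_alpha) (use Q in auto)
    then show ?thesis unfolding lead_def coord_def Q(4) arc_case_Q[OF Q(1-3)] if_P[OF True] .
  next
    case False
    have "leads (single 0 d + (beta_exp h i + beta_exp h j))
      (pvar 0 ^ d * (beta h i * beta h j + (alpha h i * alpha h j
        + single 0 (if r = 1 then 2 else 0) * (alpha h i * beta h j))) :: (nat \<Rightarrow>\<^sub>0 nat) \<Rightarrow>\<^sub>0 'k)"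
      by (intro leads_mult leads_pvar_power leads_beta_beta) (use Q False in auto)
    then show ?thesis unfolding lead_def coord_def Q(4) arc_case_Q[OF Q(1-3)] if_not_P[OF False] .
  qed
qed

lemma pvars_coord:
  assumes "v \<in> S" shows "pvars (coord v) \<subseteq> fan_index h"
proof -
  have ab: "pvars (alpha h i :: (nat \<Rightarrow>\<^sub>0 nat) \<Rightarrow>\<^sub>0 'k) \<subseteq> fan_index h"
    "pvars (beta h i :: (nat \<Rightarrow>\<^sub>0 nat) \<Rightarrow>\<^sub>0 'k) \<subseteq> fan_index h" if "1 \<le> i" "i \<le> h" for i
    by (rule pvars_alpha pvars_beta; use that in simp)+
  have z: "0 \<in> fan_index h" by (simp add: fan_index_def)
  show ?thesis
    using assms
  proof (cases rule: S_cases)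
    case (P i j)
    then show ?thesis unfolding coord_def P(4) arc_case_P[OF P(1-3)]
      by (intro pvars_multI pvars_diffI pvars_power pvars_pvarI ab z) auto
  next
    case (Q i j)
    show ?thesis
    proof (cases "r = 1 \<and> i = j")
      case True
      then show ?thesis unfolding coord_def Q(4) arc_case_Q[OF Q(1-3)] if_P[OF True]
        using Q by (intro pvars_multI pvars_addI pvars_pvarI ab z) auto
    next
      case False
      then show ?thesis unfolding coord_def Q(4) arc_case_Q[OF Q(1-3)] if_not_P[OF False]
        using Q by (intro pvars_multI pvars_addI pvars_power pvars_pvarI pvars_constI ab z) auto
    qed
  qed
qed

lemma eval_coord:
  assumes "v \<in> S" shows "peval emb fan (coord v) = v"
  using assms
proof (cases rule: S_cases)
  case (P i j)
  have ab: "peval emb fan (alpha h i) = al i" "peval emb fan (alpha h j) = al j"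
    "peval emb fan (beta h i) = be i" "peval emb fan (beta h j) = be j"
    by (rule eval_alpha eval_beta; use P in simp)+
  have fan0: "fan 0 = Q 1 1" by (simp add: fan_def)
  have "peval emb fan (coord v) = Q 1 1 ^ d * (be i * al j - al i * be j)"
    unfolding coord_def P(4) arc_case_P[OF P(1-3)]
      peval_mult peval_diff peval_power peval_pvar ab fan0 ..
  then show ?thesis unfolding P(4) P_eq[OF P(1-3), symmetric] .
next
  case (Q i j)
  have ab: "peval emb fan (alpha h i) = al i" "peval emb fan (alpha h j) = al j"
    "peval emb fan (beta h i) = be i" "peval emb fan (beta h j) = be j"
    by (rule eval_alpha eval_beta; use Q in simp)+
  have fan0: "fan 0 = Q 1 1" by (simp add: fan_def)
  have emb2: "emb 2 = 2" using hom_add[of 1 1] by (simp add: hom_one)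
  consider (diameter) "r = 1 \<and> i = j" | (B) "r = 1" "i < j" | (C) "r = 2" using r Q by linarith
  then show ?thesis
  proof cases
    case diameter
    have "z ^ r = z" for z :: 'f using diameter by simp
    then have eq: "Q i j = Q 1 1 * (be i + al i)" using T_eq[of i] Q diameter by (simp add: add.commute)
    have "peval emb fan (coord v) = Q 1 1 * (be i + al i)"
      unfolding coord_def Q(4) arc_case_Q[OF Q(1-3)] if_P[OF diameter] peval_mult peval_add peval_pvar ab fan0 ..
    then show ?thesis unfolding Q(4) eq .
  next
    case B
    have ne: "\<not> (r = 1 \<and> i = j)" using B by simp
    have d: "z ^ d = z ^ 2" for z :: "(nat \<Rightarrow>\<^sub>0 nat) \<Rightarrow>\<^sub>0 'k" using B by simp
    have "peval emb fan (coord v) = Q 1 1 ^ 2 * (be i * be j + (al i * al j + 2 * (al i * be j)))"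
      unfolding coord_def Q(4) arc_case_Q[OF Q(1-3)] if_not_P[OF ne] if_P[OF B(1)] d
        peval_mult peval_add peval_power peval_single peval_pvar emb2 ab fan0 by simp
    then show ?thesis unfolding Q(4) Q_eq_B[OF B(1) Q(1) B(2) Q(3), symmetric] .
  next
    case C
    have ne: "\<not> (r = 1 \<and> i = j)" "r \<noteq> 1" using C by simp_all
    have d: "z ^ d = z" for z :: "(nat \<Rightarrow>\<^sub>0 nat) \<Rightarrow>\<^sub>0 'k" using C by simp
    have "peval emb fan (coord v) = Q 1 1 * (be i * be j + al i * al j)"
      unfolding coord_def Q(4) arc_case_Q[OF Q(1-3)] if_not_P[OF ne(1)] if_not_P[OF ne(2)] d
        peval_mult peval_add peval_single peval_pvar ab fan0 by simp
    then show ?thesis unfolding Q(4) Q_eq_C[OF C Q(1-3), symmetric] .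
  qed
qed

end

section \<open>Leading monomials in types B and C\<close>

lemma lookup_beta_exp:
  "lookup (beta_exp H i) k = (if i \<noteq> 1 \<and> i \<noteq> Suc H \<and> k = i then 1 else 0)"
  by (auto simp: beta_exp_def lookup_single)

lemma lookup_alpha_exp:
  "lookup (alpha_exp H i) k = (if i \<noteq> 1 \<and> i \<noteq> Suc H \<and> k = H + i then 1 else 0)"
  by (auto simp: alpha_exp_def lookup_single)

lemma sum_beta_exp:
  assumes "1 \<le> i" "i \<le> H"
  shows "(\<Sum>k\<in>{2..2 * H}. lookup (beta_exp H i) k) = (if i = 1 then 0 else 1)"
proof -
  have "(\<Sum>k\<in>{2..2 * H}. lookup (beta_exp H i) k) =
      (\<Sum>k\<in>{2..2 * H}. if k = i then (if i = 1 then 0 else 1) else 0)"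
    by (rule sum.cong) (use assms in \<open>auto simp: lookup_beta_exp\<close>)
  then show ?thesis using assms by simp
qed

lemma sum_alpha_exp:
  assumes "2 \<le> i" "i \<le> H"
  shows "(\<Sum>k\<in>{2..2 * H}. lookup (alpha_exp H i) k) = 1"
proof -
  have "(\<Sum>k\<in>{2..2 * H}. lookup (alpha_exp H i) k) = (\<Sum>k\<in>{2..2 * H}. if k = H + i then 1 else 0)"
    by (rule sum.cong) (use assms in \<open>auto simp: lookup_alpha_exp\<close>)
  then show ?thesis using assms by simp
qed

context type_BC_model
begin

text \<open>Leading exponents do not show the first vertex, whose coordinates are constants; its multiplicity
  \<open>ones\<close> is recovered from the exponent of the common factor.\<close>

definition ones :: "'f \<Rightarrow> nat" where
  "ones = arc_case (\<lambda>i j. if i = 1 then 1 else 0) (\<lambda>i j. if i = 1 then if j = 1 then r else 1 else 0)"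

lemma lead_P:
  assumes "1 \<le> i" "i < j" "j \<le> h"
  shows "lead (P i j) = single 0 d + (beta_exp h i + alpha_exp h j)"
  unfolding lead_def arc_case_P[OF assms] ..

lemma lead_Q:
  assumes "1 \<le> i" "i \<le> j" "j \<le> h"
  shows "lead (Q i j) = (if r = 1 \<and> i = j then single 0 1 + beta_exp h i
      else single 0 d + (beta_exp h i + beta_exp h j))"
  unfolding lead_def arc_case_Q[OF assms] ..

lemma sum_single_zero: "(\<Sum>k\<in>{2..M}. lookup (single (0::nat) c) k) = 0"
  by (rule sum.neutral) (auto simp: lookup_single)

text \<open>The left-hand side counts ends with multiplicity: two for each arc, as
  \<open>r * d = 2\<close>, but one for a diameter of type B. The sum over the remaining indices
  sees all ends except those at vertex 1.\<close>

lemma ones_eq: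
  assumes "v \<in> S"
  shows "r * lookup (lead v) 0 = ones v + (\<Sum>k\<in>{2..2 * h}. lookup (lead v) k)"
  using assms
proof (cases rule: S_cases)
  case (P i j)
  have l0: "lookup (lead v) 0 = d"
    unfolding P(4) lead_P[OF P(1-3)] using P(1,2) by (simp add: lookup_add lookup_beta_exp lookup_alpha_exp)
  have "(\<Sum>k\<in>{2..2 * h}. lookup (lead v) k) = 0 + ((if i = 1 then 0 else 1) + 1)"
    unfolding P(4) lead_P[OF P(1-3)] lookup_add sum.distrib sum_single_zero
    using P by (subst sum_beta_exp, simp, simp, subst sum_alpha_exp, simp_all)
  moreover have "ones v = (if i = 1 then 1 else 0)" unfolding ones_def P(4) arc_case_P[OF P(1-3)] ..
  ultimately show ?thesis using r l0 by auto
next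
  case (Q i j)
  have o: "ones v = (if i = 1 then if j = 1 then r else 1 else 0)"
    unfolding ones_def Q(4) arc_case_Q[OF Q(1-3)] ..
  have "1 \<le> j" "i \<le> h" using Q by auto
  note sums = sum_beta_exp[OF Q(1) this(2)] sum_beta_exp[OF this(1) Q(3)]
  show ?thesis
  proof (cases "r = 1 \<and> i = j")
    case True
    have l: "lead v = single 0 1 + beta_exp h i"
      unfolding Q(4) lead_Q[OF Q(1-3)] if_P[OF True] ..
    have "lookup (lead v) 0 = 1" unfolding l using Q(1) by (simp add: lookup_add lookup_beta_exp)
    moreover have "(\<Sum>k\<in>{2..2 * h}. lookup (lead v) k) = 0 + (if i = 1 then 0 else 1)"
      unfolding l lookup_add sum.distrib sum_single_zero sums ..
    ultimately show ?thesis using o True by (simp split: if_splits)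
  next
    case False
    have l: "lead v = single 0 d + (beta_exp h i + beta_exp h j)"
      unfolding Q(4) lead_Q[OF Q(1-3)] if_not_P[OF False] ..
    have "lookup (lead v) 0 = d" unfolding l using Q(1,2) by (simp add: lookup_add lookup_beta_exp)
    moreover have "(\<Sum>k\<in>{2..2 * h}. lookup (lead v) k) =
        0 + ((if i = 1 then 0 else 1) + (if j = 1 then 0 else 1))"
      unfolding l lookup_add sum.distrib sum_single_zero sums ..
    moreover have "r * d = 2" using r by auto
    ultimately show ?thesis using o False r Q(1,2) by (auto split: if_splits)
  qed
qed

text \<open>How often \<open>i\<close> looks like an opening. For \<open>i = 1\<close> this is not
  an exponent but is supplied by \<open>ones\<close>.\<close>

definition mark :: "'f \<Rightarrow> nat \<Rightarrow> nat" where
  "mark v i = (if i = 1 then ones v else if i \<le> h then lookup (lead v) i else 0)"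

lemma mark_P:
  assumes "1 \<le> k" "k < l" "l \<le> h" "1 \<le> i"
  shows "0 < mark (P k l) i \<longleftrightarrow> k = i"
proof -
  have "ones (P k l) = (if k = 1 then 1 else 0)" unfolding ones_def arc_case_P[OF assms(1-3)] ..
  moreover have "lookup (lead (P k l)) i = (if k = i then 1 else 0)" if "2 \<le> i" "i \<le> h"
    unfolding lead_P[OF assms(1-3)] using assms that
    by (auto simp: lookup_add lookup_single lookup_beta_exp lookup_alpha_exp)
  ultimately show ?thesis using assms by (auto simp: mark_def)
qed

lemma mark_Q:
  assumes "1 \<le> k" "k \<le> l" "l \<le> h" "1 \<le> i"
  shows "0 < mark (Q k l) i \<longleftrightarrow> k = i \<or> l = i"
proof -
  have "ones (Q k l) = (if k = 1 then if l = 1 then r else 1 else 0)" unfolding ones_def arc_case_Q[OF assms(1-3)] ..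
  moreover have "0 < lookup (lead (Q k l)) i \<longleftrightarrow> k = i \<or> l = i" if "2 \<le> i" "i \<le> h"
    unfolding lead_Q[OF assms(1-3)] using assms that
    by (auto simp: lookup_add lookup_single lookup_beta_exp)
  ultimately show ?thesis using assms r by (auto simp: mark_def)
qed

lemma lookup_lead_alpha:
  assumes "2 \<le> j" "j \<le> h"
  shows "1 \<le> k \<Longrightarrow> k < l \<Longrightarrow> l \<le> h \<Longrightarrow> 0 < lookup (lead (P k l)) (h + j) \<longleftrightarrow> l = j"
    and "1 \<le> k \<Longrightarrow> k \<le> l \<Longrightarrow> l \<le> h \<Longrightarrow> \<not> 0 < lookup (lead (Q k l)) (h + j)"
  using assms by (auto simp: lead_P lead_Q lookup_add lookup_single lookup_beta_exp lookup_alpha_exp)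

lemma linear_weight_lead_inj:
  "inj_on (linear_weight lead) {\<mu>. keys \<mu> \<subseteq> S \<and> std \<mu>}"
proof (rule linear_weight_inj_by_cancellation)
  fix \<mu> \<nu> :: "'f \<Rightarrow>\<^sub>0 nat"
  assume \<mu>: "\<mu> \<in> {\<mu>. keys \<mu> \<subseteq> S \<and> std \<mu>}" and \<nu>: "\<nu> \<in> {\<mu>. keys \<mu> \<subseteq> S \<and> std \<mu>}"
    and nz: "\<mu> \<noteq> 0" and eq: "linear_weight lead \<mu> = linear_weight lead \<nu>"
  define RP where "RP \<kappa> i j \<longleftrightarrow> 1 \<le> i \<and> i < j \<and> j \<le> h \<and> P i j \<in> keys \<kappa>"
    for \<kappa> :: "'f \<Rightarrow>\<^sub>0 nat" and i j
  define RQ where "RQ \<kappa> i j \<longleftrightarrow> 1 \<le> i \<and> i \<le> j \<and> j \<le> h \<and> Q i j \<in> keys \<kappa>"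
    for \<kappa> :: "'f \<Rightarrow>\<^sub>0 nat" and i j
  have sub: "keys \<mu> \<subseteq> S" "keys \<nu> \<subseteq> S" and st: "std \<mu>" "std \<nu>"
    using \<mu> \<nu> by auto
  have lw: "linear_weight (\<lambda>v. lookup (lead v) k) \<mu> = linear_weight (\<lambda>v. lookup (lead v) k) \<nu>" for k
    using arg_cong[OF eq, of "\<lambda>e. lookup e k"] unfolding lookup_linear_weight .
  \<comment> \<open>The identity \<open>ones_eq\<close> summed over a monomial: the leading exponent
    determines the total multiplicity of vertex 1.\<close>
  have lw_ones: "r * linear_weight (\<lambda>v. lookup (lead v) 0) \<kappa> =
      linear_weight ones \<kappa> + (\<Sum>k\<in>{2..2 * h}. linear_weight (\<lambda>v. lookup (lead v) k) \<kappa>)"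
    if \<kappa>: "keys \<kappa> \<subseteq> S" for \<kappa>
  proof -
    have "r * linear_weight (\<lambda>v. lookup (lead v) 0) \<kappa> =
        (\<Sum>v\<in>keys \<kappa>. lookup \<kappa> v * (r * lookup (lead v) 0))"
      by (simp add: linear_weight_def sum_distrib_left mult_ac)
    also have "\<dots> = (\<Sum>v\<in>keys \<kappa>. lookup \<kappa> v *
        (ones v + (\<Sum>k\<in>{2..2 * h}. lookup (lead v) k)))"
      by (rule sum.cong[OF refl]) (simp only: ones_eq[OF subsetD[OF \<kappa>]])
    also have "\<dots> = linear_weight ones \<kappa> +
        (\<Sum>v\<in>keys \<kappa>. \<Sum>k\<in>{2..2 * h}. lookup \<kappa> v * lookup (lead v) k)"
      unfolding distrib_left sum.distrib sum_distrib_left linear_weight_def of_nat_id ..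
    also have "(\<Sum>v\<in>keys \<kappa>. \<Sum>k\<in>{2..2 * h}. lookup \<kappa> v * lookup (lead v) k) =
        (\<Sum>k\<in>{2..2 * h}. \<Sum>v\<in>keys \<kappa>. lookup \<kappa> v * lookup (lead v) k)"
      by (rule sum.swap)
    finally show ?thesis unfolding linear_weight_def of_nat_id .
  qed
  have "linear_weight ones \<mu> = linear_weight ones \<nu>"
    using lw_ones[OF sub(1)] lw_ones[OF sub(2)] unfolding lw by simp
  then have lw_mark: "linear_weight (\<lambda>v. mark v i) \<mu> = linear_weight (\<lambda>v. mark v i) \<nu>" for i
    using lw[of i] by (cases "i = 1"; cases "i \<le> h") (simp_all add: mark_def linear_weight_def)
  have vis: "(\<exists>v\<in>keys \<mu>. 0 < mark v i) \<longleftrightarrow> (\<exists>v\<in>keys \<nu>. 0 < mark v i)" for i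
    using arg_cong[OF lw_mark[of i], of "\<lambda>e. 0 < e"] unfolding linear_weight_nat_pos_iff .
  have vis_lead: "(\<exists>v\<in>keys \<mu>. 0 < lookup (lead v) k) \<longleftrightarrow>
      (\<exists>v\<in>keys \<nu>. 0 < lookup (lead v) k)" for k
    using arg_cong[OF lw[of k], of "\<lambda>e. 0 < e"] unfolding linear_weight_nat_pos_iff .
  have ex: "(\<exists>v\<in>keys \<kappa>. F v) \<longleftrightarrow> (\<exists>i j. RP \<kappa> i j \<and> F (P i j)) \<or> (\<exists>i j. RQ \<kappa> i j \<and> F (Q i j))"
    if keys: "keys \<kappa> \<subseteq> S" for \<kappa> F
  proof
    assume "\<exists>v\<in>keys \<kappa>. F v"
    then obtain v where v: "v \<in> keys \<kappa>" "F v" by blast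
    from subsetD[OF keys v(1)] show "(\<exists>i j. RP \<kappa> i j \<and> F (P i j)) \<or> (\<exists>i j. RQ \<kappa> i j \<and> F (Q i j))"
    proof (cases rule: S_cases)
      case (P i j)
      then have "RP \<kappa> i j \<and> F (P i j)" using v by (simp add: RP_def)
      then show ?thesis by blast
    next
      case (Q i j)
      then have "RQ \<kappa> i j \<and> F (Q i j)" using v by (simp add: RQ_def)
      then show ?thesis by blast
    qed
  qed (auto simp: RP_def RQ_def)
  have op: "(\<exists>j. RP \<kappa> i j) \<or> (\<exists>j. RQ \<kappa> i j) \<or> (\<exists>j. RQ \<kappa> j i) \<longleftrightarrow> 1 \<le> i \<and> (\<exists>v\<in>keys \<kappa>. 0 < mark v i)"
    if keys: "keys \<kappa> \<subseteq> S" for \<kappa> i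
  proof (cases "1 \<le> i")
    case True
    have "0 < mark (P k l) i \<longleftrightarrow> k = i" if "RP \<kappa> k l" for k l
      using that True unfolding RP_def by (intro mark_P) auto
    moreover have "0 < mark (Q k l) i \<longleftrightarrow> k = i \<or> l = i" if "RQ \<kappa> k l" for k l
      using that True unfolding RQ_def by (intro mark_Q) auto
    ultimately show ?thesis unfolding ex[OF keys] using True by blast
  qed (auto simp: RP_def RQ_def)
  have cl: "(\<exists>i. RP \<kappa> i j) \<longleftrightarrow> 2 \<le> j \<and> j \<le> h \<and> (\<exists>v\<in>keys \<kappa>. 0 < lookup (lead v) (h + j))"
    if keys: "keys \<kappa> \<subseteq> S" for \<kappa> j
  proof (cases "2 \<le> j \<and> j \<le> h")
    case True
    have "0 < lookup (lead (P k l)) (h + j) \<longleftrightarrow> l = j" if "RP \<kappa> k l" for k l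
      using that True unfolding RP_def by (intro lookup_lead_alpha(1)) auto
    moreover have "\<not> 0 < lookup (lead (Q k l)) (h + j)" if "RQ \<kappa> k l" for k l
      using that True unfolding RQ_def by (intro lookup_lead_alpha(2)) auto
    ultimately show ?thesis unfolding ex[OF keys] using True by blast
  qed (auto simp: RP_def)
  obtain v where "v \<in> keys \<mu>" using nz by (metis poly_mapping_eqI lookup_zero in_keys_iff)
  then have "\<exists>v\<in>keys \<mu>. True" by blast
  then obtain a b where ab: "RP \<mu> a b \<or> RQ \<mu> a b" unfolding ex[OF sub(1)] by blast
  have PP: "\<not> (i < k \<and> k < j \<and> j < l)" if "RP \<kappa> i j" "RP \<kappa> k l" "std \<kappa>" for \<kappa> i j k l
    using that incompatible_PP[of i j k l] unfolding RP_def std_def by auto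
  have PQ: "\<not> (i < k \<and> k < j) \<and> \<not> (i < l \<and> l < j)" if "RP \<kappa> i j" "RQ \<kappa> k l" "std \<kappa>" for \<kappa> i j k l
    using that incompatible_PQ[of i j k l] unfolding RP_def RQ_def std_def by auto
  have QQ: "\<not> (i < k \<and> j < l)" if "RQ \<kappa> i j" "RQ \<kappa> k l" "std \<kappa>" for \<kappa> i j k l
    using that incompatible_QQ[of i j k l] unfolding RQ_def std_def by auto
  have "(\<exists>i j. RP \<mu> i j \<and> RP \<nu> i j) \<or> (\<exists>i j. RQ \<mu> i j \<and> RQ \<nu> i j)"
  proof (rule common_pair[where h = h and P = "RP \<mu>" and P' = "RP \<nu>" and Q = "RQ \<mu>" and Q' = "RQ \<nu>", OF _ _ _ _ PP[OF _ _ st(1)] PP[OF _ _ st(2)] PQ[OF _ _ st(1)] PQ[OF _ _ st(2)]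
        QQ[OF _ _ st(1)] QQ[OF _ _ st(2)] _ _ ab])
    show "(\<exists>j. RP \<mu> i j) \<or> (\<exists>j. RQ \<mu> i j) \<or> (\<exists>j. RQ \<mu> j i) \<longleftrightarrow>
        (\<exists>j. RP \<nu> i j) \<or> (\<exists>j. RQ \<nu> i j) \<or> (\<exists>j. RQ \<nu> j i)" for i
      unfolding op[OF sub(1)] op[OF sub(2)] vis ..
    show "(\<exists>i. RP \<mu> i j) \<longleftrightarrow> (\<exists>i. RP \<nu> i j)" for j
      unfolding cl[OF sub(1)] cl[OF sub(2)] vis_lead ..
  qed (simp_all add: RP_def RQ_def)
  then show "keys \<mu> \<inter> keys \<nu> \<noteq> {}" by (auto simp: RP_def RQ_def)
next
  fix \<mu> and v :: 'f
  assume "\<mu> \<in> {\<mu>. keys \<mu> \<subseteq> S \<and> std \<mu>}" "v \<in> keys \<mu>"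
  then have "v \<in> S" by auto
  then have "lookup (lead v) 0 \<noteq> 0"
    using r by (cases rule: S_cases) (auto simp: lead_P lead_Q lookup_add)
  then show "lead v \<noteq> 0" by auto
qed (auto simp: keys_add_nat std_def)

lemma standard_monomials_independent:
  assumes "p \<in> relations" "\<And>\<mu>. \<mu> \<in> keys p \<Longrightarrow> std \<mu>"
  shows "p = 0"
proof (rule linear_independence_by_leading_monomials[OF coeff_hom_axioms alg_indep_fan
      pvars_coord eval_coord leads_coord])
  show "inj_on (linear_weight lead) (keys p)"
    by (rule inj_on_subset[OF linear_weight_lead_inj])
       (use assms keys_polynomial in \<open>auto simp: relations_def\<close>)
qed (use assms in \<open>auto simp: relations_def\<close>)

end

section \<open>Straightening relations and their ranks in types B and C\<close>

definition monomial_of :: "'v list \<Rightarrow> ('v \<Rightarrow>\<^sub>0 nat)" where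
  "monomial_of vs = (\<Sum>v\<leftarrow>vs. single v 1)"

lemma linear_weight_monomial_of: "linear_weight f (monomial_of vs) = (\<Sum>v\<leftarrow>vs. f v)"
  by (induction vs) (auto simp: monomial_of_def)

lemma meval_monomial_of: "meval g (monomial_of vs) = (\<Prod>v\<leftarrow>vs. g v)"
  by (induction vs) (auto simp: monomial_of_def meval_add meval_single)

lemma keys_monomial_of: "keys (monomial_of vs) = set vs"
  by (induction vs) (auto simp: monomial_of_def keys_add_nat)

lemma keys_sum_list_single:
  "keys (\<Sum>vs\<leftarrow>qs. single (f vs) c) \<subseteq> f ` set qs"
proof (induction qs)
  case (Cons a qs)
  show ?case
  proof
    fix \<mu> assume "\<mu> \<in> keys (\<Sum>vs\<leftarrow>a # qs. single (f vs) c)"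
    then have "\<mu> \<in> keys (single (f a) c + (\<Sum>vs\<leftarrow>qs. single (f vs) c))"
      by simp
    from subsetD[OF Poly_Mapping.keys_add this] show "\<mu> \<in> f ` set (a # qs)"
      using Cons.IH by (auto split: if_splits)
  qed
qed simp

text \<open>Twice the weight \<open>t (2 H - t)\<close> of the arcs \<open>[a, b]\<close> and \<open>[a, b + H]\<close> of the \<open>2 H\<close>-gon, which have
  lengths \<open>t = b - a\<close> and \<open>t = H + (b - a)\<close>.\<close>

definition arc_p :: "int \<Rightarrow> int \<Rightarrow> int \<Rightarrow> int" where "arc_p H a b = 2 * (H\<^sup>2 - (H - (b - a))\<^sup>2)"
definition arc_q :: "int \<Rightarrow> int \<Rightarrow> int \<Rightarrow> int" where "arc_q H a b = 2 * (H\<^sup>2 - (b - a)\<^sup>2)"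

text \<open>The inequalities below are certified by a product of positive lengths. For a resolved
  crossing these are the lengths of the two sides of the quadrilateral that the resulting product
  does not use.\<close>

lemma less_by_factors:
  fixes a b x y :: int
  assumes "b - a = c * (x * y)" "0 < c" "0 < x" "0 < y" shows "a < b"
proof -
  have "0 < c * (x * y)" using assms(2-4) by simp
  then show ?thesis using assms(1) by linarith
qed

lemma arc_less_pp:
  fixes i j k l m H :: int
  assumes "i < k" "k < j" "j < l" "l - i < H"
  shows "arc_p H i k + arc_p H j l < arc_p H i j + arc_p H k l"
    "arc_p H k j + arc_p H i l < arc_p H i j + arc_p H k l"
proof -
  show "arc_p H i k + arc_p H j l < arc_p H i j + arc_p H k l"
  proof (rule less_by_factors[where c = 4 and x = "j - k" and y = "2 * H - (l - i)"])
    show "0 < 2 * H - (l - i)"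
      using assms by (linarith)
  qed (use assms in \<open>simp_all add: arc_p_def arc_q_def power2_eq_square algebra_simps\<close>)
  show "arc_p H k j + arc_p H i l < arc_p H i j + arc_p H k l"
  proof (rule less_by_factors[where c = 4 and x = "k - i" and y = "l - j"])
    show "0 < l - j"
      using assms by (linarith)
  qed (use assms in \<open>simp_all add: arc_p_def arc_q_def power2_eq_square algebra_simps\<close>)
qed

lemma arc_less_pq:
  fixes i j k l m H :: int
  assumes "i < k" "k < j" "j - i < H" "l \<le> H" "0 < i" "j \<le> H" "0 < l"
  shows "arc_p H i k + arc_q H j l < arc_p H i j + arc_q H k l"
    "arc_p H k j + arc_q H i l < arc_p H i j + arc_q H k l"
proof -
  show "arc_p H i k + arc_q H j l < arc_p H i j + arc_q H k l"
  proof (rule less_by_factors[where c = 4 and x = "j - k" and y = "H + i - l"])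
    show "0 < H + i - l"
      using assms by (linarith)
  qed (use assms in \<open>simp_all add: arc_p_def arc_q_def power2_eq_square algebra_simps\<close>)
  show "arc_p H k j + arc_q H i l < arc_p H i j + arc_q H k l"
  proof (rule less_by_factors[where c = 4 and x = "k - i" and y = "H - j + l"])
    show "0 < H - j + l"
      using assms by (linarith)
  qed (use assms in \<open>simp_all add: arc_p_def arc_q_def power2_eq_square algebra_simps\<close>)
qed

lemma arc_less_qq:
  fixes i j k l m H :: int
  assumes "i \<le> j" "k \<le> l" "i < k" "j < l" "l - i < H"
  shows "arc_q H i l + arc_q H k j < arc_q H i j + arc_q H k l"
    "arc_p H i k + arc_p H j l < arc_q H i j + arc_q H k l"
proof -
  show "arc_q H i l + arc_q H k j < arc_q H i j + arc_q H k l"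
  proof (rule less_by_factors[where c = 4 and x = "l - j" and y = "k - i"])
    show "0 < k - i"
      using assms by (linarith)
  qed (use assms in \<open>simp_all add: arc_p_def arc_q_def power2_eq_square algebra_simps\<close>)
  show "arc_p H i k + arc_p H j l < arc_q H i j + arc_q H k l"
  \<comment> \<open>Here \<open>y\<close> is \<open>2 * (H + j - k)\<close>, twice the length from
    \<open>k\<close> to \<open>j + H\<close>, so \<open>c\<close> is 2 and not 4.\<close>
  proof (rule less_by_factors[where c = 2 and x = "H - (l - i)" and y = "(H - (l - j) + (j - i)) + (H - (k - i) + (l - k))"])
    show "0 < (H - (l - j) + (j - i)) + (H - (k - i) + (l - k))"
      using assms by (linarith)
  qed (use assms in \<open>simp_all add: arc_p_def arc_q_def power2_eq_square algebra_simps\<close>)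
qed

text \<open>For the product \<open>P i k * Q l l * Q j j\<close> of type B, whose diameters together
  have rank \<open>2 * H\<^sup>2\<close>. Half the difference is not a product of lengths but a sum
  of such products.\<close>

lemma arc_less_mixed:
  fixes i j k l m H :: int
  assumes "i < k" "k < l" "l < j" "j - i < H"
  shows "arc_p H i k + 2 * H\<^sup>2 < arc_p H i j + arc_q H k l"
proof -
  show "arc_p H i k + 2 * H\<^sup>2 < arc_p H i j + arc_q H k l"
  proof (rule less_by_factors[where c = 2 and x = "1" and y = "2 * (H - (j - i)) * (j - k) + (j - l) * ((j - k) + (l - k))"])
    show "0 < 2 * (H - (j - i)) * (j - k) + (j - l) * ((j - k) + (l - k))"
      using assms by (intro add_pos_pos add_pos_nonneg mult_pos_pos zero_less_power; simp)
  qed (use assms in \<open>simp_all add: arc_p_def arc_q_def power2_eq_square algebra_simps\<close>)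
qed

lemma arc_p_less:
  fixes i j k l m H :: int
  assumes "i < k" "k < j" "j - i < H"
  shows "arc_p H i k < arc_p H i j"
    "arc_p H k j < arc_p H i j"
proof -
  show "arc_p H i k < arc_p H i j"
  proof (rule less_by_factors[where c = 2 and x = "j - k" and y = "2 * H - (k - i) - (j - i)"])
    show "0 < 2 * H - (k - i) - (j - i)"
      using assms by (linarith)
  qed (use assms in \<open>simp_all add: arc_p_def arc_q_def power2_eq_square algebra_simps\<close>)
  show "arc_p H k j < arc_p H i j"
  proof (rule less_by_factors[where c = 2 and x = "k - i" and y = "2 * H - (j - k) - (j - i)"])
    show "0 < 2 * H - (j - k) - (j - i)"
      using assms by (linarith)
  qed (use assms in \<open>simp_all add: arc_p_def arc_q_def power2_eq_square algebra_simps\<close>)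
qed

lemma arc_less_q_left:
  fixes i j k l m H :: int
  assumes "m < k" "k < l" "l - m < H"
  shows "arc_p H m k < arc_q H k l"
    "arc_q H m l < arc_q H k l"
proof -
  show "arc_p H m k < arc_q H k l"
  proof (rule less_by_factors[where c = 2 and x = "H - (l - m)" and y = "H - (k - m) + (l - k)"])
    show "0 < H - (k - m) + (l - k)"
      using assms by (linarith)
  qed (use assms in \<open>simp_all add: arc_p_def arc_q_def power2_eq_square algebra_simps\<close>)
  show "arc_q H m l < arc_q H k l"
  proof (rule less_by_factors[where c = 2 and x = "k - m" and y = "2 * l - m - k"])
    show "0 < 2 * l - m - k"
      using assms by (linarith)
  qed (use assms in \<open>simp_all add: arc_p_def arc_q_def power2_eq_square algebra_simps\<close>)
qed

lemma arc_less_q_right: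
  fixes i j k l m H :: int
  assumes "k < l" "l < m" "m - k < H"
  shows "arc_q H k m < arc_q H k l"
    "arc_p H l m < arc_q H k l"
proof -
  show "arc_q H k m < arc_q H k l"
  proof (rule less_by_factors[where c = 2 and x = "m - l" and y = "m + l - 2 * k"])
    show "0 < m + l - 2 * k"
      using assms by (linarith)
  qed (use assms in \<open>simp_all add: arc_p_def arc_q_def power2_eq_square algebra_simps\<close>)
  show "arc_p H l m < arc_q H k l"
  proof (rule less_by_factors[where c = 2 and x = "H - (m - k)" and y = "H - (m - l) + (l - k)"])
    show "0 < H - (m - l) + (l - k)"
      using assms by (linarith)
  qed (use assms in \<open>simp_all add: arc_p_def arc_q_def power2_eq_square algebra_simps\<close>)
qed

text \<open>For the product \<open>Q i l * Q j j * Q k k\<close> of type B. Half the difference is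
  the square of a sum of three lengths minus the squares of the outer two.\<close>

lemma arc_less_qq_far:
  fixes i j k l m H :: int
  assumes "i < j" "j < k" "k < l"
  shows "arc_q H i l + 2 * H\<^sup>2 < arc_q H i j + arc_q H k l"
proof -
  show "arc_q H i l + 2 * H\<^sup>2 < arc_q H i j + arc_q H k l"
  proof (rule less_by_factors[where c = 2 and x = "1" and y = "(k - j)\<^sup>2 + 2 * (j - i) * (k - j) + 2 * (k - j) * (l - k) + 2 * (j - i) * (l - k)"])
    show "0 < (k - j)\<^sup>2 + 2 * (j - i) * (k - j) + 2 * (k - j) * (l - k) + 2 * (j - i) * (l - k)"
      using assms by (intro add_pos_pos add_pos_nonneg mult_pos_pos zero_less_power; simp)
  qed (use assms in \<open>simp_all add: arc_p_def arc_q_def power2_eq_square algebra_simps\<close>)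
qed

lemma arc_less_diameters:
  fixes i j k l m H :: int
  assumes "i < j" "j - i < H"
  shows "arc_p H i j < 2 * H\<^sup>2"
    "arc_q H i j < 2 * H\<^sup>2"
proof -
  show "arc_p H i j < 2 * H\<^sup>2"
  proof (rule less_by_factors[where c = 2 and x = "H - (j - i)" and y = "H - (j - i)"])
    show "0 < H - (j - i)"
      using assms by (linarith)
  qed (use assms in \<open>simp_all add: arc_p_def arc_q_def power2_eq_square algebra_simps\<close>)
  show "arc_q H i j < 2 * H\<^sup>2"
  proof (rule less_by_factors[where c = 2 and x = "j - i" and y = "j - i"])
    show "0 < j - i"
      using assms by (linarith)
  qed (use assms in \<open>simp_all add: arc_p_def arc_q_def power2_eq_square algebra_simps\<close>)
qed

lemma arc_p_le: "arc_p H i j \<le> 2 * H\<^sup>2"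
  by (simp add: arc_p_def)

lemma arc_p_nonneg: "i < j \<Longrightarrow> j - i < H \<Longrightarrow> 0 \<le> arc_p H i j"
  unfolding arc_p_def by (simp add: power_mono)

lemma arc_q_nonneg: "i \<le> j \<Longrightarrow> j - i < H \<Longrightarrow> 0 \<le> arc_q H i j"
  unfolding arc_q_def by (simp add: power_mono)

context type_BC_model
begin

definition tt :: 'f where "tt = Q 1 1"

definition hh :: int where "hh = int h"

lemma hh_bounds: "0 < hh" "j \<le> h \<Longrightarrow> int j \<le> hh" "1 \<le> i \<Longrightarrow> j \<le> h \<Longrightarrow> int j - int i < hh"
  by (auto simp: hh_def)

text \<open>A diameter of type B has half the rank of an arc of length \<open>H\<close>, since its
  square plays the part of that arc. The factor 2 in \<open>arc_p\<close> and \<open>arc_q\<close>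
  keeps this half an integer.\<close>

definition rank :: "'f \<Rightarrow> int" where
  "rank = arc_case (\<lambda>i j. arc_p hh (int i) (int j))
    (\<lambda>i j. if i = j then int r * hh\<^sup>2 else arc_q hh (int i) (int j))"

text \<open>The general combination of the vectors \<open>E_BC\<close>, with coefficients
  \<open>f\<close>, as a function on variables: a diameter counts its vertex \<open>r\<close>
  times.\<close>

definition val :: "(nat \<Rightarrow> real) \<Rightarrow> 'f \<Rightarrow> real" where
  "val f = arc_case (\<lambda>i j. f i + f j) (\<lambda>i j. if i = j then real r * f i else f i + f j)"

lemma rank_P: "1 \<le> i \<Longrightarrow> i < j \<Longrightarrow> j \<le> h \<Longrightarrow> rank (P i j) = arc_p hh (int i) (int j)"
  unfolding rank_def by (rule arc_case_P)

lemma rank_Q: "1 \<le> i \<Longrightarrow> i < j \<Longrightarrow> j \<le> h \<Longrightarrow> rank (Q i j) = arc_q hh (int i) (int j)"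
  unfolding rank_def by (subst arc_case_Q) auto

lemma rank_T: "1 \<le> i \<Longrightarrow> i \<le> h \<Longrightarrow> rank (Q i i) = int r * hh\<^sup>2"
  unfolding rank_def by (subst arc_case_Q) auto

lemma val_P: "1 \<le> i \<Longrightarrow> i < j \<Longrightarrow> j \<le> h \<Longrightarrow> val f (P i j) = f i + f j"
  unfolding val_def by (rule arc_case_P)

lemma val_Q: "1 \<le> i \<Longrightarrow> i < j \<Longrightarrow> j \<le> h \<Longrightarrow> val f (Q i j) = f i + f j"
  unfolding val_def by (subst arc_case_Q) auto

lemma val_T: "1 \<le> i \<Longrightarrow> i \<le> h \<Longrightarrow> val f (Q i i) = real r * f i"
  unfolding val_def by (subst arc_case_Q) auto

lemma rank_nonneg: "v \<in> S \<Longrightarrow> 0 \<le> rank v"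
proof (erule S_cases)
  fix i j assume "1 \<le> i" "i < j" "j \<le> h" "v = P i j"
  then show ?thesis using hh_bounds(3)[of i j] by (simp add: rank_P arc_p_nonneg)
next
  fix i j assume "1 \<le> i" "i \<le> j" "j \<le> h" "v = Q i j"
  then show ?thesis by (cases "i = j") (simp_all add: rank_Q rank_T arc_q_nonneg hh_bounds)
qed

text \<open>Condition (i) in a form checkable on explicit formulas. The products \<open>ms\<close>
  need not be standard; the decrease of the rank lets them be reduced further. Working with lists
  allows repeated factors.\<close>

definition reducible :: "'f \<Rightarrow> 'f \<Rightarrow> bool" where
  "reducible v w \<longleftrightarrow> (\<exists>qs. v * w = (\<Sum>ms\<leftarrow>qs. prod_list ms) \<and>
    (\<forall>ms\<in>set qs. set ms \<subseteq> S \<and> (\<Sum>u\<leftarrow>ms. rank u) < rank v + rank w \<and>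
      (\<forall>f. (\<Sum>u\<leftarrow>ms. val f u) = val f v + val f w)))"

lemma reducibleI:
  assumes "v * w = (\<Sum>ms\<leftarrow>qs. prod_list ms)"
    and "\<And>ms. ms \<in> set qs \<Longrightarrow> set ms \<subseteq> S"
    and "\<And>ms. ms \<in> set qs \<Longrightarrow> (\<Sum>u\<leftarrow>ms. rank u) < rank v + rank w"
    and "\<And>ms f. ms \<in> set qs \<Longrightarrow> (\<Sum>u\<leftarrow>ms. val f u) = val f v + val f w"
  shows "reducible v w"
  unfolding reducible_def using assms by blast

lemma reducible_commute: "reducible v w \<Longrightarrow> reducible w v"
  unfolding reducible_def by (simp add: mult.commute add.commute)

lemma P_t: "1 \<le> i \<Longrightarrow> i < j \<Longrightarrow> j \<le> h \<Longrightarrow> P i j = tt ^ d * (be i * al j - al i * be j)"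
  unfolding tt_def by (rule P_eq)

lemma P_C: "r = 2 \<Longrightarrow> 1 \<le> i \<Longrightarrow> i < j \<Longrightarrow> j \<le> h \<Longrightarrow> P i j = tt * (be i * al j - al i * be j)"
  using P_t[of i j] by simp

lemma Q_C: "r = 2 \<Longrightarrow> 1 \<le> i \<Longrightarrow> i \<le> j \<Longrightarrow> j \<le> h \<Longrightarrow> Q i j = tt * (be i * be j + al i * al j)"
  unfolding tt_def by (rule Q_eq_C)

lemma P_B: "r = 1 \<Longrightarrow> 1 \<le> i \<Longrightarrow> i < j \<Longrightarrow> j \<le> h \<Longrightarrow> P i j = tt ^ 2 * (be i * al j - al i * be j)"
  using P_t[of i j] by simp

lemma Q_B: "r = 1 \<Longrightarrow> 1 \<le> i \<Longrightarrow> i < j \<Longrightarrow> j \<le> h \<Longrightarrow>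
    Q i j = tt ^ 2 * (be i * be j + (al i * al j + 2 * (al i * be j)))"
  unfolding tt_def by (rule Q_eq_B)

lemma T_B: "r = 1 \<Longrightarrow> 1 \<le> i \<Longrightarrow> i \<le> h \<Longrightarrow> Q i i = tt * (al i + be i)"
  using T_eq[of i] unfolding tt_def by simp

lemma rank_C: "r = 2 \<Longrightarrow> 1 \<le> i \<Longrightarrow> i \<le> j \<Longrightarrow> j \<le> h \<Longrightarrow> rank (Q i j) = arc_q hh (int i) (int j)"
  by (cases "i = j"; use rank_Q[of i j] rank_T[of i] in \<open>simp add: arc_q_def\<close>)

lemma val_C: "r = 2 \<Longrightarrow> 1 \<le> i \<Longrightarrow> i \<le> j \<Longrightarrow> j \<le> h \<Longrightarrow> val f (Q i j) = f i + f j"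
  by (cases "i = j"; use val_Q[of i j f] val_T[of i f] in simp)

lemma rank_B: "r = 1 \<Longrightarrow> 1 \<le> i \<Longrightarrow> i \<le> h \<Longrightarrow> rank (Q i i) = hh\<^sup>2"
  using rank_T[of i] by simp

lemma val_B: "r = 1 \<Longrightarrow> 1 \<le> i \<Longrightarrow> i \<le> h \<Longrightarrow> val f (Q i i) = f i"
  using val_T[of i f] by simp

lemma arc_q_commute: "arc_q H a b = arc_q H b a"
  by (simp add: arc_q_def power2_commute)

lemma arc_q_same: "arc_q H a a = 2 * H\<^sup>2"
  by (simp add: arc_q_def)

text \<open>Both crossings are resolved as in type A; the claimed equation is a polynomial identity
  in \<open>al\<close>, \<open>be\<close> and the common factor, and so it is in all lemmas of this
  kind.\<close>

lemma reducible_PP: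
  assumes ord: "1 \<le> i" "i < k" "k < j" "j < l" "l \<le> h"
  shows "reducible (P i j) (P k l)"
proof -
  let ?qs = "[[P i k, P j l], [P k j, P i l]]"
  show ?thesis
  proof (rule reducibleI[where qs = ?qs])
    show "P i j * P k l = (\<Sum>ms\<leftarrow>?qs. prod_list ms)"
      using ord by (simp add: P_t power2_eq_square algebra_simps)
    fix ms assume ms: "ms \<in> set ?qs"
    show "set ms \<subseteq> S" using ms ord by (auto intro!: P_in_S Q_in_S)
    show "(\<Sum>u\<leftarrow>ms. rank u) < rank (P i j) + rank (P k l)"
      using ms ord arc_less_pp[of "int i" "int k" "int j" "int l" hh]
      by (auto simp: rank_P hh_bounds arc_q_same)
    show "(\<Sum>u\<leftarrow>ms. val f u) = val f (P i j) + val f (P k l)" for f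
      using ms ord by (auto simp: val_P)
  qed
qed

lemma reducible_PQ_C1:
  assumes r: "r = 2" and ord: "1 \<le> i" "i < k" "k < j" "j \<le> l" "l \<le> h"
  shows "reducible (P i j) (Q k l)"
proof -
  let ?qs = "[[P i k, Q j l], [P k j, Q i l]]"
  show ?thesis
  proof (rule reducibleI[where qs = ?qs])
    show "P i j * Q k l = (\<Sum>ms\<leftarrow>?qs. prod_list ms)"
      using ord by (simp add: P_C[OF r] Q_C[OF r] power2_eq_square algebra_simps)
    fix ms assume ms: "ms \<in> set ?qs"
    show "set ms \<subseteq> S" using ms ord by (auto intro!: P_in_S Q_in_S)
    show "(\<Sum>u\<leftarrow>ms. rank u) < rank (P i j) + rank (Q k l)"
      using ms ord arc_less_pq[of "int i" "int k" "int j" hh "int l"]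
      by (auto simp: rank_P rank_C[OF r] hh_bounds arc_q_same)
    show "(\<Sum>u\<leftarrow>ms. val f u) = val f (P i j) + val f (Q k l)" for f
      using ms ord by (auto simp: val_P val_C[OF r])
  qed
qed

lemma reducible_PQ_C2:
  assumes r: "r = 2" and ord: "1 \<le> i" "i < k" "k \<le> l" "l < j" "j \<le> h"
  shows "reducible (P i j) (Q k l)"
proof -
  let ?qs = "[[P i k, Q l j], [P k j, Q i l]]"
  show ?thesis
  proof (rule reducibleI[where qs = ?qs])
    show "P i j * Q k l = (\<Sum>ms\<leftarrow>?qs. prod_list ms)"
      using ord by (simp add: P_C[OF r] Q_C[OF r] power2_eq_square algebra_simps)
    fix ms assume ms: "ms \<in> set ?qs"
    show "set ms \<subseteq> S" using ms ord by (auto intro!: P_in_S Q_in_S)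
    show "(\<Sum>u\<leftarrow>ms. rank u) < rank (P i j) + rank (Q k l)"
      using ms ord arc_less_pq[of "int i" "int k" "int j" hh "int l"] arc_q_commute[of hh "int j" "int l"]
      by (auto simp: rank_P rank_C[OF r] hh_bounds arc_q_same)
    show "(\<Sum>u\<leftarrow>ms. val f u) = val f (P i j) + val f (Q k l)" for f
      using ms ord by (auto simp: val_P val_C[OF r])
  qed
qed

lemma reducible_PQ_C3:
  assumes r: "r = 2" and ord: "1 \<le> k" "k \<le> i" "i < l" "l < j" "j \<le> h"
  shows "reducible (P i j) (Q k l)"
proof -
  let ?qs = "[[P i l, Q k j], [P l j, Q k i]]"
  show ?thesis
  proof (rule reducibleI[where qs = ?qs])
    show "P i j * Q k l = (\<Sum>ms\<leftarrow>?qs. prod_list ms)"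
      using ord by (simp add: P_C[OF r] Q_C[OF r] power2_eq_square algebra_simps)
    fix ms assume ms: "ms \<in> set ?qs"
    show "set ms \<subseteq> S" using ms ord by (auto intro!: P_in_S Q_in_S)
    show "(\<Sum>u\<leftarrow>ms. rank u) < rank (P i j) + rank (Q k l)"
      using ms ord arc_less_pq[of "int i" "int l" "int j" hh "int k"] arc_q_commute[of hh "int j" "int k"] arc_q_commute[of hh "int l" "int k"] arc_q_commute[of hh "int i" "int k"]
      by (auto simp: rank_P rank_C[OF r] hh_bounds arc_q_same)
    show "(\<Sum>u\<leftarrow>ms. val f u) = val f (P i j) + val f (Q k l)" for f
      using ms ord by (auto simp: val_P val_C[OF r])
  qed
qed

lemma reducible_QQ_C1:
  assumes r: "r = 2" and ord: "1 \<le> i" "i < k" "k \<le> j" "j < l" "l \<le> h"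
  shows "reducible (Q i j) (Q k l)"
proof -
  let ?qs = "[[Q i l, Q k j], [P i k, P j l]]"
  show ?thesis
  proof (rule reducibleI[where qs = ?qs])
    show "Q i j * Q k l = (\<Sum>ms\<leftarrow>?qs. prod_list ms)"
      using ord by (simp add: P_C[OF r] Q_C[OF r] power2_eq_square algebra_simps)
    fix ms assume ms: "ms \<in> set ?qs"
    show "set ms \<subseteq> S" using ms ord by (auto intro!: P_in_S Q_in_S)
    show "(\<Sum>u\<leftarrow>ms. rank u) < rank (Q i j) + rank (Q k l)"
      using ms ord arc_less_qq[of "int i" "int j" "int k" "int l" hh]
      by (auto simp: rank_P rank_C[OF r] hh_bounds arc_q_same)
    show "(\<Sum>u\<leftarrow>ms. val f u) = val f (Q i j) + val f (Q k l)" for f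
      using ms ord by (auto simp: val_P val_C[OF r])
  qed
qed

lemma reducible_QQ_C2:
  assumes r: "r = 2" and ord: "1 \<le> i" "i \<le> j" "j < k" "k \<le> l" "l \<le> h"
  shows "reducible (Q i j) (Q k l)"
proof -
  let ?qs = "[[Q i l, Q j k], [P i k, P j l]]"
  show ?thesis
  proof (rule reducibleI[where qs = ?qs])
    show "Q i j * Q k l = (\<Sum>ms\<leftarrow>?qs. prod_list ms)"
      using ord by (simp add: P_C[OF r] Q_C[OF r] power2_eq_square algebra_simps)
    fix ms assume ms: "ms \<in> set ?qs"
    show "set ms \<subseteq> S" using ms ord by (auto intro!: P_in_S Q_in_S)
    show "(\<Sum>u\<leftarrow>ms. rank u) < rank (Q i j) + rank (Q k l)"
      using ms ord arc_less_qq[of "int i" "int j" "int k" "int l" hh] arc_q_commute[of hh "int k" "int j"]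
      by (auto simp: rank_P rank_C[OF r] hh_bounds arc_q_same)
    show "(\<Sum>u\<leftarrow>ms. val f u) = val f (Q i j) + val f (Q k l)" for f
      using ms ord by (auto simp: val_P val_C[OF r])
  qed
qed

lemma reducible_PQ_B1:
  assumes r: "r = 1" and ord: "1 \<le> i" "i < k" "k < j" "j < l" "l \<le> h"
  shows "reducible (P i j) (Q k l)"
proof -
  let ?qs = "[[P k j, Q i l], [P i k, Q j l]]"
  show ?thesis
  proof (rule reducibleI[where qs = ?qs])
    show "P i j * Q k l = (\<Sum>ms\<leftarrow>?qs. prod_list ms)"
      using ord by (simp add: P_B[OF r] Q_B[OF r] T_B[OF r] power2_eq_square algebra_simps)
    fix ms assume ms: "ms \<in> set ?qs"
    show "set ms \<subseteq> S" using ms ord by (auto intro!: P_in_S Q_in_S)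
    show "(\<Sum>u\<leftarrow>ms. rank u) < rank (P i j) + rank (Q k l)"
      using ms ord arc_less_pq[of "int i" "int k" "int j" hh "int l"]
      by (auto simp: rank_P rank_Q rank_B[OF r] hh_bounds arc_q_same)
    show "(\<Sum>u\<leftarrow>ms. val f u) = val f (P i j) + val f (Q k l)" for f
      using ms ord by (auto simp: val_P val_Q val_B[OF r])
  qed
qed

text \<open>The relation for \<open>j < l\<close> degenerates at \<open>l = j\<close>: the arc from
  \<open>j\<close> to its own antipode is the square of the diameter. The repeated diameters in
  other relations of type B have the same origin.\<close>

lemma reducible_PQ_B2:
  assumes r: "r = 1" and ord: "1 \<le> i" "i < k" "k < j" "j \<le> h"
  shows "reducible (P i j) (Q k j)"
proof -
  let ?qs = "[[P k j, Q i j], [P i k, Q j j, Q j j]]"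
  show ?thesis
  proof (rule reducibleI[where qs = ?qs])
    show "P i j * Q k j = (\<Sum>ms\<leftarrow>?qs. prod_list ms)"
      using ord by (simp add: P_B[OF r] Q_B[OF r] T_B[OF r] power2_eq_square algebra_simps)
    fix ms assume ms: "ms \<in> set ?qs"
    show "set ms \<subseteq> S" using ms ord by (auto intro!: P_in_S Q_in_S)
    show "(\<Sum>u\<leftarrow>ms. rank u) < rank (P i j) + rank (Q k j)"
      using ms ord arc_less_pq[of "int i" "int k" "int j" hh "int j"]
      by (auto simp: rank_P rank_Q rank_B[OF r] hh_bounds arc_q_same)
    show "(\<Sum>u\<leftarrow>ms. val f u) = val f (P i j) + val f (Q k j)" for f
      using ms ord by (auto simp: val_P val_Q val_B[OF r])
  qed
qed

text \<open>Both ends of the \<open>Q\<close> arc lie under the \<open>P\<close> arc, so there are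
  two crossings to resolve. The last product is not standard: rewriting \<open>Q l l * Q j j\<close>
  as \<open>P l j + Q l j\<close> would produce the coefficient 2 at \<open>P i k * P l j\<close>,
  while the form chosen has unit coefficients.\<close>

lemma reducible_PQ_B3:
  assumes r: "r = 1" and ord: "1 \<le> i" "i < k" "k < l" "l < j" "j \<le> h"
  shows "reducible (P i j) (Q k l)"
proof -
  let ?qs = "[[P k j, Q i l], [P i k, P l j], [P i k, Q l l, Q j j]]"
  show ?thesis
  proof (rule reducibleI[where qs = ?qs])
    show "P i j * Q k l = (\<Sum>ms\<leftarrow>?qs. prod_list ms)"
      using ord by (simp add: P_B[OF r] Q_B[OF r] T_B[OF r] power2_eq_square algebra_simps)
    fix ms assume ms: "ms \<in> set ?qs"
    show "set ms \<subseteq> S" using ms ord by (auto intro!: P_in_S Q_in_S)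
    show "(\<Sum>u\<leftarrow>ms. rank u) < rank (P i j) + rank (Q k l)"
      using ms ord arc_less_pq[of "int i" "int k" "int j" hh "int l"] arc_less_mixed[of "int i" "int k" "int l" "int j" hh] arc_p_le[of hh "int l" "int j"]
      by (auto simp: rank_P rank_Q rank_B[OF r] hh_bounds arc_q_same)
    show "(\<Sum>u\<leftarrow>ms. val f u) = val f (P i j) + val f (Q k l)" for f
      using ms ord by (auto simp: val_P val_Q val_B[OF r])
  qed
qed

lemma reducible_PT_B:
  assumes r: "r = 1" and ord: "1 \<le> i" "i < k" "k < j" "j \<le> h"
  shows "reducible (P i j) (Q k k)"
proof -
  let ?qs = "[[P i k, Q j j], [P k j, Q i i]]"
  show ?thesis
  proof (rule reducibleI[where qs = ?qs])
    show "P i j * Q k k = (\<Sum>ms\<leftarrow>?qs. prod_list ms)"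
      using ord by (simp add: P_B[OF r] Q_B[OF r] T_B[OF r] power2_eq_square algebra_simps)
    fix ms assume ms: "ms \<in> set ?qs"
    show "set ms \<subseteq> S" using ms ord by (auto intro!: P_in_S Q_in_S)
    show "(\<Sum>u\<leftarrow>ms. rank u) < rank (P i j) + rank (Q k k)"
      using ms ord arc_p_less[of "int i" "int k" "int j" hh]
      by (auto simp: rank_P rank_Q rank_B[OF r] hh_bounds arc_q_same)
    show "(\<Sum>u\<leftarrow>ms. val f u) = val f (P i j) + val f (Q k k)" for f
      using ms ord by (auto simp: val_P val_Q val_B[OF r])
  qed
qed

lemma reducible_PQ_B4:
  assumes r: "r = 1" and ord: "1 \<le> k" "k < i" "i < l" "l < j" "j \<le> h"
  shows "reducible (P i j) (Q k l)"
proof -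
  let ?qs = "[[P i l, Q k j], [P l j, Q k i]]"
  show ?thesis
  proof (rule reducibleI[where qs = ?qs])
    show "P i j * Q k l = (\<Sum>ms\<leftarrow>?qs. prod_list ms)"
      using ord by (simp add: P_B[OF r] Q_B[OF r] T_B[OF r] power2_eq_square algebra_simps)
    fix ms assume ms: "ms \<in> set ?qs"
    show "set ms \<subseteq> S" using ms ord by (auto intro!: P_in_S Q_in_S)
    show "(\<Sum>u\<leftarrow>ms. rank u) < rank (P i j) + rank (Q k l)"
      using ms ord arc_less_pq[of "int i" "int l" "int j" hh "int k"] arc_q_commute[of hh "int j" "int k"] arc_q_commute[of hh "int l" "int k"] arc_q_commute[of hh "int i" "int k"]
      by (auto simp: rank_P rank_Q rank_B[OF r] hh_bounds arc_q_same)
    show "(\<Sum>u\<leftarrow>ms. val f u) = val f (P i j) + val f (Q k l)" for f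
      using ms ord by (auto simp: val_P val_Q val_B[OF r])
  qed
qed

lemma reducible_PQ_B5:
  assumes r: "r = 1" and ord: "1 \<le> i" "i < l" "l < j" "j \<le> h"
  shows "reducible (P i j) (Q i l)"
proof -
  let ?qs = "[[P i l, Q i j], [P l j, Q i i, Q i i]]"
  show ?thesis
  proof (rule reducibleI[where qs = ?qs])
    show "P i j * Q i l = (\<Sum>ms\<leftarrow>?qs. prod_list ms)"
      using ord by (simp add: P_B[OF r] Q_B[OF r] T_B[OF r] power2_eq_square algebra_simps)
    fix ms assume ms: "ms \<in> set ?qs"
    show "set ms \<subseteq> S" using ms ord by (auto intro!: P_in_S Q_in_S)
    show "(\<Sum>u\<leftarrow>ms. rank u) < rank (P i j) + rank (Q i l)"
      using ms ord arc_less_pq[of "int i" "int l" "int j" hh "int i"] arc_q_commute[of hh "int j" "int i"] arc_q_commute[of hh "int l" "int i"]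
      by (auto simp: rank_P rank_Q rank_B[OF r] hh_bounds arc_q_same)
    show "(\<Sum>u\<leftarrow>ms. val f u) = val f (P i j) + val f (Q i l)" for f
      using ms ord by (auto simp: val_P val_Q val_B[OF r])
  qed
qed

lemma reducible_TT_B:
  assumes r: "r = 1" and ord: "1 \<le> i" "i < k" "k \<le> h"
  shows "reducible (Q i i) (Q k k)"
proof -
  let ?qs = "[[P i k], [Q i k]]"
  show ?thesis
  proof (rule reducibleI[where qs = ?qs])
    show "Q i i * Q k k = (\<Sum>ms\<leftarrow>?qs. prod_list ms)"
      using ord by (simp add: P_B[OF r] Q_B[OF r] T_B[OF r] power2_eq_square algebra_simps)
    fix ms assume ms: "ms \<in> set ?qs"
    show "set ms \<subseteq> S" using ms ord by (auto intro!: P_in_S Q_in_S)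
    show "(\<Sum>u\<leftarrow>ms. rank u) < rank (Q i i) + rank (Q k k)"
      using ms ord arc_less_diameters[of "int i" "int k" hh]
      by (auto simp: rank_P rank_Q rank_B[OF r] hh_bounds arc_q_same)
    show "(\<Sum>u\<leftarrow>ms. val f u) = val f (Q i i) + val f (Q k k)" for f
      using ms ord by (auto simp: val_P val_Q val_B[OF r])
  qed
qed

lemma reducible_TQ_B1:
  assumes r: "r = 1" and ord: "1 \<le> i" "i < k" "k < l" "l \<le> h"
  shows "reducible (Q i i) (Q k l)"
proof -
  let ?qs = "[[Q l l, P i k], [Q k k, Q i l]]"
  show ?thesis
  proof (rule reducibleI[where qs = ?qs])
    show "Q i i * Q k l = (\<Sum>ms\<leftarrow>?qs. prod_list ms)"
      using ord by (simp add: P_B[OF r] Q_B[OF r] T_B[OF r] power2_eq_square algebra_simps)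
    fix ms assume ms: "ms \<in> set ?qs"
    show "set ms \<subseteq> S" using ms ord by (auto intro!: P_in_S Q_in_S)
    show "(\<Sum>u\<leftarrow>ms. rank u) < rank (Q i i) + rank (Q k l)"
      using ms ord arc_less_q_left[of "int i" "int k" "int l" hh]
      by (auto simp: rank_P rank_Q rank_B[OF r] hh_bounds arc_q_same)
    show "(\<Sum>u\<leftarrow>ms. val f u) = val f (Q i i) + val f (Q k l)" for f
      using ms ord by (auto simp: val_P val_Q val_B[OF r])
  qed
qed

lemma reducible_TQ_B2:
  assumes r: "r = 1" and ord: "1 \<le> i" "i < j" "j < k" "k \<le> h"
  shows "reducible (Q i j) (Q k k)"
proof -
  let ?qs = "[[Q j j, Q i k], [Q i i, P j k]]"
  show ?thesis
  proof (rule reducibleI[where qs = ?qs])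
    show "Q i j * Q k k = (\<Sum>ms\<leftarrow>?qs. prod_list ms)"
      using ord by (simp add: P_B[OF r] Q_B[OF r] T_B[OF r] power2_eq_square algebra_simps)
    fix ms assume ms: "ms \<in> set ?qs"
    show "set ms \<subseteq> S" using ms ord by (auto intro!: P_in_S Q_in_S)
    show "(\<Sum>u\<leftarrow>ms. rank u) < rank (Q i j) + rank (Q k k)"
      using ms ord arc_less_q_right[of "int i" "int j" "int k" hh]
      by (auto simp: rank_P rank_Q rank_B[OF r] hh_bounds arc_q_same)
    show "(\<Sum>u\<leftarrow>ms. val f u) = val f (Q i j) + val f (Q k k)" for f
      using ms ord by (auto simp: val_P val_Q val_B[OF r])
  qed
qed

lemma reducible_QQ_B1:
  assumes r: "r = 1" and ord: "1 \<le> i" "i < k" "k < j" "j < l" "l \<le> h"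
  shows "reducible (Q i j) (Q k l)"
proof -
  let ?qs = "[[P j l, P i k], [Q i l, Q k j]]"
  show ?thesis
  proof (rule reducibleI[where qs = ?qs])
    show "Q i j * Q k l = (\<Sum>ms\<leftarrow>?qs. prod_list ms)"
      using ord by (simp add: P_B[OF r] Q_B[OF r] T_B[OF r] power2_eq_square algebra_simps)
    fix ms assume ms: "ms \<in> set ?qs"
    show "set ms \<subseteq> S" using ms ord by (auto intro!: P_in_S Q_in_S)
    show "(\<Sum>u\<leftarrow>ms. rank u) < rank (Q i j) + rank (Q k l)"
      using ms ord arc_less_qq[of "int i" "int j" "int k" "int l" hh]
      by (auto simp: rank_P rank_Q rank_B[OF r] hh_bounds arc_q_same)
    show "(\<Sum>u\<leftarrow>ms. val f u) = val f (Q i j) + val f (Q k l)" for f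
      using ms ord by (auto simp: val_P val_Q val_B[OF r])
  qed
qed

lemma reducible_QQ_B2:
  assumes r: "r = 1" and ord: "1 \<le> i" "i < j" "j < l" "l \<le> h"
  shows "reducible (Q i j) (Q j l)"
proof -
  let ?qs = "[[P j l, P i j], [Q i l, Q j j, Q j j]]"
  show ?thesis
  proof (rule reducibleI[where qs = ?qs])
    show "Q i j * Q j l = (\<Sum>ms\<leftarrow>?qs. prod_list ms)"
      using ord by (simp add: P_B[OF r] Q_B[OF r] T_B[OF r] power2_eq_square algebra_simps)
    fix ms assume ms: "ms \<in> set ?qs"
    show "set ms \<subseteq> S" using ms ord by (auto intro!: P_in_S Q_in_S)
    show "(\<Sum>u\<leftarrow>ms. rank u) < rank (Q i j) + rank (Q j l)"
      using ms ord arc_less_qq[of "int i" "int j" "int j" "int l" hh]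
      by (auto simp: rank_P rank_Q rank_B[OF r] hh_bounds arc_q_same)
    show "(\<Sum>u\<leftarrow>ms. val f u) = val f (Q i j) + val f (Q j l)" for f
      using ms ord by (auto simp: val_P val_Q val_B[OF r])
  qed
qed

text \<open>Again two crossings are resolved, and \<open>Q j j * Q k k\<close> is left unexpanded,
  as \<open>P j k + Q j k\<close> would give \<open>Q i l * P j k\<close> the coefficient 2.\<close>

lemma reducible_QQ_B3:
  assumes r: "r = 1" and ord: "1 \<le> i" "i < j" "j < k" "k < l" "l \<le> h"
  shows "reducible (Q i j) (Q k l)"
proof -
  let ?qs = "[[P j l, P i k], [Q i l, P j k], [Q i l, Q j j, Q k k]]"
  show ?thesis
  proof (rule reducibleI[where qs = ?qs])
    show "Q i j * Q k l = (\<Sum>ms\<leftarrow>?qs. prod_list ms)"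
      using ord by (simp add: P_B[OF r] Q_B[OF r] T_B[OF r] power2_eq_square algebra_simps)
    fix ms assume ms: "ms \<in> set ?qs"
    show "set ms \<subseteq> S" using ms ord by (auto intro!: P_in_S Q_in_S)
    show "(\<Sum>u\<leftarrow>ms. rank u) < rank (Q i j) + rank (Q k l)"
      using ms ord arc_less_qq[of "int i" "int j" "int k" "int l" hh] arc_less_qq_far[of "int i" "int j" "int k" "int l" hh] arc_p_le[of hh "int j" "int k"]
      by (auto simp: rank_P rank_Q rank_B[OF r] hh_bounds arc_q_same)
    show "(\<Sum>u\<leftarrow>ms. val f u) = val f (Q i j) + val f (Q k l)" for f
      using ms ord by (auto simp: val_P val_Q val_B[OF r])
  qed
qed

text \<open>In type C the formula for \<open>Q i j\<close> is symmetric and includes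
  \<open>i = j\<close>, so only the order of the indices in the result has to be sorted out. In type
  B every coincidence and every order of the ends has its own relation.\<close>

lemma incompatible_reducible:
  assumes "incompatible n m s v w" shows "reducible v w"
proof -
  have swap: "reducible v w" if "{v, w} = {a, b}" "reducible a b" for a b
    using that reducible_commute by (auto simp: doubleton_eq_iff)
  from assms show ?thesis
  proof (cases rule: incompatible_cases)
    case (PP i j k l)
    then show ?thesis by (intro swap[OF PP(6)] reducible_PP)
  next
    case (PQ i j k l)
    consider "r = 2" "j \<le> l" | "r = 2" "l < j" | "r = 1" "j < l" | "r = 1" "l = j" | "r = 1" "k < l" "l < j"
      | "r = 1" "k = l" using r PQ(5) by linarith
    then have "reducible (P i j) (Q k l)"
    proof cases
      case 1
      show ?thesis by (rule reducible_PQ_C1[OF 1(1) PQ(1-3) 1(2) PQ(6)])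
    next
      case 2
      show ?thesis by (rule reducible_PQ_C2[OF 2(1) PQ(1,2,5) 2(2) PQ(4)])
    next
      case 3
      show ?thesis by (rule reducible_PQ_B1[OF 3(1) PQ(1-3) 3(2) PQ(6)])
    next
      case 4
      have "reducible (P i j) (Q k j)" by (rule reducible_PQ_B2[OF 4(1) PQ(1-4)])
      then show ?thesis using 4(2) by simp
    next
      case 5
      show ?thesis by (rule reducible_PQ_B3[OF 5(1) PQ(1,2) 5(2,3) PQ(4)])
    next
      case 6
      have "reducible (P i j) (Q k k)" by (rule reducible_PT_B[OF 6(1) PQ(1-4)])
      then show ?thesis using 6(2) by simp
    qed
    then show ?thesis by (rule swap[OF PQ(7)])
  next
    case (PQ' i j k l)
    consider "r = 2" | "r = 1" "k < i" | "r = 1" "k = i" using r PQ'(2) by linarith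
    then have "reducible (P i j) (Q k l)"
    proof cases
      case 1
      show ?thesis by (rule reducible_PQ_C3[OF 1(1) PQ'(1-5)])
    next
      case 2
      show ?thesis by (rule reducible_PQ_B4[OF 2(1) PQ'(1) 2(2) PQ'(3-5)])
    next
      case 3
      have "reducible (P k j) (Q k l)" using PQ'(3) 3(2) by (intro reducible_PQ_B5[OF 3(1) PQ'(1) _ PQ'(4,5)]) simp
      then show ?thesis using 3(2) by simp
    qed
    then show ?thesis by (rule swap[OF PQ'(6)])
  next
    case (QQ i j k l)
    have "i = j \<or> i < j" "k = l \<or> k < l" "k < j \<or> k = j \<or> j < k" "k \<le> j \<or> j < k"
      using QQ(2,6) by linarith+
    then consider "r = 2" "k \<le> j" | "r = 2" "j < k" | "r = 1" "i = j" "k = l" | "r = 1" "i = j" "k < l"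
      | "r = 1" "i < j" "k = l" | "r = 1" "i < j" "k < l" "k < j" | "r = 1" "i < j" "k < l" "k = j"
      | "r = 1" "i < j" "k < l" "j < k" using r by blast
    then have "reducible (Q i j) (Q k l)"
    proof cases
      case 1
      show ?thesis by (rule reducible_QQ_C1[OF 1(1) QQ(1,5) 1(2) QQ(3,4)])
    next
      case 2
      show ?thesis by (rule reducible_QQ_C2[OF 2(1) QQ(1,2) 2(2) QQ(6,4)])
    next
      case 3
      have "reducible (Q i i) (Q k k)" by (rule reducible_TT_B[OF 3(1) QQ(1,5) QQ(4)[folded 3(3)]])
      then show ?thesis using 3(2,3) by simp
    next
      case 4
      have "reducible (Q i i) (Q k l)" by (rule reducible_TQ_B1[OF 4(1) QQ(1,5) 4(3) QQ(4)])
      then show ?thesis using 4(2) by simp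
    next
      case 5
      have "reducible (Q i j) (Q k k)" by (rule reducible_TQ_B2[OF 5(1) QQ(1) 5(2) QQ(3)[folded 5(3)] QQ(4)[folded 5(3)]])
      then show ?thesis using 5(3) by simp
    next
      case 6
      show ?thesis by (rule reducible_QQ_B1[OF 6(1) QQ(1,5) 6(4) QQ(3,4)])
    next
      case 7
      have "reducible (Q i j) (Q j l)" by (rule reducible_QQ_B2[OF 7(1) QQ(1) 7(2) QQ(3,4)])
      then show ?thesis using 7(4) by simp
    next
      case 8
      show ?thesis by (rule reducible_QQ_B3[OF 8(1) QQ(1) 8(2) 8(4) 8(3) QQ(4)])
    qed
    then show ?thesis by (rule swap[OF QQ(7)])
  qed
qed

end

section \<open>The lineality space and its basis in types B and C\<close>

context type_BC_model
begin

definition vertex_weights :: "('f \<Rightarrow>\<^sub>0 real) set" where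
  "vertex_weights = {\<omega>. keys \<omega> \<subseteq> S \<and> (\<exists>f. \<forall>v\<in>S. lookup \<omega> v = val f v)}"

lemma val_linear:
  assumes "v \<in> S"
  shows "val (\<lambda>i. f i + g i) v = val f v + val g v" "val (\<lambda>i. c * f i) v = c * val f v" "val (\<lambda>i. 0) v = 0"
  using assms
  by (cases rule: S_cases; unfold val_def; simp add: arc_case_P arc_case_Q distrib_left)+

lemma val_unit_sum:
  assumes "v \<in> S"
  shows "(\<Sum>k\<in>{1..h}. f k * val (\<lambda>i. if i = k then 1 else 0) v) = val f v"
  using assms
proof (cases rule: S_cases)
  case (P i j)
  have "(\<Sum>k\<in>{1..h}. f k * val (\<lambda>i. if i = k then 1 else 0) v) =
      (\<Sum>k\<in>{1..h}. (if k = i then f k else 0) + (if k = j then f k else 0))"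
    unfolding P(4) val_P[OF P(1-3)] by (rule sum.cong) auto
  also have "\<dots> = f i + f j" using P by (simp add: sum.distrib)
  finally show ?thesis unfolding P(4) val_P[OF P(1-3)] .
next
  case (Q i j)
  show ?thesis
  proof (cases "i = j")
    case True
    have i: "1 \<le> i" "i \<le> h" using Q by auto
    have "(\<Sum>k\<in>{1..h}. f k * val (\<lambda>i. if i = k then 1 else 0) v) = (\<Sum>k\<in>{1..h}. if k = i then real r * f k else 0)"
      unfolding Q(4) True[symmetric] val_T[OF i] by (rule sum.cong) auto
    also have "\<dots> = real r * f i" using i by simp
    finally show ?thesis unfolding Q(4) True[symmetric] val_T[OF i] .
  next
    case False
    then have ij: "1 \<le> i" "i < j" "j \<le> h" using Q by auto
    have "(\<Sum>k\<in>{1..h}. f k * val (\<lambda>i. if i = k then 1 else 0) v) =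
        (\<Sum>k\<in>{1..h}. (if k = i then f k else 0) + (if k = j then f k else 0))"
      unfolding Q(4) val_Q[OF ij] by (rule sum.cong) auto
    also have "\<dots> = f i + f j" using ij by (simp add: sum.distrib)
    finally show ?thesis unfolding Q(4) val_Q[OF ij] .
  qed
qed

lemma lookup_E_BC:
  assumes k: "1 \<le> k" "k \<le> h"
  shows "lookup (E_BC (real r) n y k) v = (if v \<in> S then val (\<lambda>i. if i = k then 1 else 0) v else 0)"
proof -
  let ?LL = "diagonal_pairs n \<union> edge_pairs n" and ?D = "diameter n k"
  let ?R = "\<exists>l\<in>?LL. k \<in> \<Union>l \<and> l \<noteq> ?D \<and> y l = v"
  have fin: "finite ?LL" unfolding pairs_eq by (simp add: finite_polygon_diagonals finite_polygon_edges)
  have D: "?D = seg_pair n {k, k + h}" using k by (simp add: diameter_def antipode_def)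
  have yD: "y ?D = Q k k" unfolding D Q_def ..
  have "lookup (E_BC (real r) n y k) v = (if Q k k = v then real r else 0) +
      (\<Sum>l\<in>{l\<in>?LL. k \<in> \<Union>l \<and> l \<noteq> ?D}. if y l = v then 1 else 0)"
    by (simp add: E_BC_def lookup_add lookup_sum lookup_single when_def yD)
  also have "(\<Sum>l\<in>{l\<in>?LL. k \<in> \<Union>l \<and> l \<noteq> ?D}. if y l = v then 1 else 0) = (if ?R then 1 else 0 :: real)"
  proof (cases ?R)
    case True
    then obtain l where l: "l \<in> ?LL" "k \<in> \<Union>l" "l \<noteq> ?D" "y l = v" by blast
    have "(\<Sum>l'\<in>{l\<in>?LL. k \<in> \<Union>l \<and> l \<noteq> ?D}. if y l' = v then 1 else 0) =
        (\<Sum>l'\<in>{l\<in>?LL. k \<in> \<Union>l \<and> l \<noteq> ?D}. if l' = l then 1 else 0 :: real)"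
      using l inj by (intro sum.cong) (auto simp: inj_on_eq_iff)
    also have "\<dots> = 1" using l fin by simp
    finally show ?thesis using True by simp
  next
    case False
    then have "(\<Sum>l\<in>{l\<in>?LL. k \<in> \<Union>l \<and> l \<noteq> ?D}. if y l = v then 1 else 0) = (0 :: real)"
      by (intro sum.neutral) auto
    then show ?thesis using False by simp
  qed
  finally have eq: "lookup (E_BC (real r) n y k) v =
      (if Q k k = v then real r else 0) + (if ?R then 1 else 0)" .
  have R: "?R \<longleftrightarrow> k \<in> \<Union>(seg_pair n l) \<and> seg_pair n l \<noteq> ?D" if "l \<in> L" "v = y (seg_pair n l)" for l
  proof -
    have l: "seg_pair n l \<in> ?LL" using that(1) by (simp add: pairs_eq)
    then have "y l' = v \<longleftrightarrow> l' = seg_pair n l" if "l' \<in> ?LL" for l'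
      using inj_on_eq_iff[OF inj that l] \<open>v = _\<close> by simp
    then show ?thesis using l by blast
  qed
  show ?thesis
  proof (cases "v \<in> S")
    case False
    then have "\<not> ?R" "Q k k \<noteq> v" using Q_in_S[of k k] k unfolding S_eq pairs_eq by auto
    then show ?thesis using False eq by simp
  next
    case True
    then show ?thesis
    proof (cases rule: S_cases)
      case (P i j)
      have ne: "Q k k \<noteq> P i j" using P_neq_Q[OF P(1-3) k(1) _ k(2)] by simp
      then have "seg_pair n {i, j} \<noteq> ?D" using yD by (auto simp: P_def)
      moreover have "\<Union>(seg_pair n {i, j}) = {i, j, i + h, j + h}"
        using opp_P[of i j] P by (auto simp: seg_pair_def)
      ultimately have "?R \<longleftrightarrow> k = i \<or> k = j"
        using R[OF P_L[OF P(1-3)]] P k by (simp add: P_def)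
      then show ?thesis using eq ne True P by (simp add: val_P)
    next
      case (Q i j)
      have ij: "1 \<le> j" "i \<le> h" using Q by auto
      have "\<Union>(seg_pair n {i, j + h}) = {i, j, i + h, j + h}"
        using opp_Q[OF Q(1) ij(2,1) Q(3)] by (auto simp: seg_pair_def)
      moreover have "seg_pair n {i, j + h} = ?D \<longleftrightarrow> i = k \<and> j = k"
      proof
        assume "seg_pair n {i, j + h} = ?D"
        then have "Q i j = Q k k" using yD by (simp add: Q_def)
        then show "i = k \<and> j = k" using Q_eq_iff[OF Q(1-3) k(1) _ k(2)] by simp
      qed (simp add: D)
      ultimately have "?R \<longleftrightarrow> (k = i \<or> k = j) \<and> \<not> (i = k \<and> j = k)"
        using R[OF Q_L[OF Q(1) ij(2,1) Q(3)]] Q k by (auto simp: Q_def)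
      moreover have "Q k k = v \<longleftrightarrow> k = i \<and> k = j"
        using Q_eq_iff[OF k(1) _ k(2) Q(1-3)] Q(4) by simp
      ultimately show ?thesis using eq True Q val_T[of i] val_Q[of i j] by (cases "i = j") auto
    qed
  qed
qed

lemma subspace_vertex_weights: "subspace vertex_weights"
  unfolding subspace_def
proof (intro conjI ballI allI)
  have "\<forall>v\<in>S. lookup 0 v = val (\<lambda>_. 0) v" using val_linear(3) by simp
  then show "0 \<in> vertex_weights" unfolding vertex_weights_def by auto
next
  fix a b assume "a \<in> vertex_weights" "b \<in> vertex_weights"
  then obtain f g where *: "keys a \<subseteq> S" "keys b \<subseteq> S"
    "\<forall>v\<in>S. lookup a v = val f v" "\<forall>v\<in>S. lookup b v = val g v"
    unfolding vertex_weights_def by blast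
  have "keys (a + b) \<subseteq> S" using Poly_Mapping.keys_add[of a b] *(1,2) by blast
  moreover have "\<forall>v\<in>S. lookup (a + b) v = val (\<lambda>i. f i + g i) v"
    using *(3,4) by (simp add: lookup_add val_linear(1))
  ultimately show "a + b \<in> vertex_weights" unfolding vertex_weights_def by blast
next
  fix c a assume "a \<in> vertex_weights"
  then obtain f where *: "keys a \<subseteq> S" "\<forall>v\<in>S. lookup a v = val f v"
    unfolding vertex_weights_def by blast
  have "keys (c *\<^sub>R a) \<subseteq> S" using *(1) by (auto simp: in_keys_iff lookup_scaleR)
  moreover have "\<forall>v\<in>S. lookup (c *\<^sub>R a) v = val (\<lambda>i. c * f i) v"
    using *(2) by (simp add: lookup_scaleR val_linear(2))
  ultimately show "c *\<^sub>R a \<in> vertex_weights" unfolding vertex_weights_def by blast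
qed

lemma lookup_sum_E_BC:
  "lookup (\<Sum>k\<in>{1..h}. f k *\<^sub>R E_BC (real r) n y k) v = (if v \<in> S then val f v else 0)"
proof -
  have "lookup (\<Sum>k\<in>{1..h}. f k *\<^sub>R E_BC (real r) n y k) v =
      (\<Sum>k\<in>{1..h}. if v \<in> S then f k * val (\<lambda>i. if i = k then 1 else 0) v else 0)"
    unfolding lookup_sum lookup_scaleR by (rule sum.cong) (auto simp: lookup_E_BC)
  also have "\<dots> = (if v \<in> S then val f v else 0)"
    using val_unit_sum[of v f] by (cases "v \<in> S") simp_all
  finally show ?thesis .
qed

lemma span_E_BC: "span (E_BC (real r) n y ` {1..n + 1}) = vertex_weights"
proof
  have "E_BC (real r) n y k \<in> vertex_weights" if "k \<in> {1..h}" for k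
  proof -
    have "keys (E_BC (real r) n y k) \<subseteq> S"
      using that by (auto simp: in_keys_iff lookup_E_BC split: if_splits)
    moreover have "\<forall>v\<in>S. lookup (E_BC (real r) n y k) v = val (\<lambda>i. if i = k then 1 else 0) v"
      using that by (simp add: lookup_E_BC)
    ultimately show ?thesis unfolding vertex_weights_def by blast
  qed
  then show "span (E_BC (real r) n y ` {1..n + 1}) \<subseteq> vertex_weights"
    by (intro span_minimal subspace_vertex_weights image_subsetI)
  show "vertex_weights \<subseteq> span (E_BC (real r) n y ` {1..n + 1})"
  proof
    fix \<omega> assume "\<omega> \<in> vertex_weights"
    then obtain f where f: "keys \<omega> \<subseteq> S" "\<forall>v\<in>S. lookup \<omega> v = val f v"
      unfolding vertex_weights_def by blast
    have "\<omega> = (\<Sum>k\<in>{1..h}. f k *\<^sub>R E_BC (real r) n y k)"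
    proof (rule poly_mapping_eqI)
      fix v
      have "lookup \<omega> v = (if v \<in> S then val f v else 0)" using f by (auto simp: in_keys_iff)
      then show "lookup \<omega> v = lookup (\<Sum>k\<in>{1..h}. f k *\<^sub>R E_BC (real r) n y k) v"
        unfolding lookup_sum_E_BC .
    qed
    moreover have "(\<Sum>k\<in>{1..h}. f k *\<^sub>R E_BC (real r) n y k) \<in> span (E_BC (real r) n y ` {1..n + 1})"
      by (intro span_sum span_scale span_base imageI)
    ultimately show "\<omega> \<in> span (E_BC (real r) n y ` {1..n + 1})" by (simp only:)
  qed
qed

text \<open>The diameters suffice to detect the coefficients, each of them meeting only one of the
  vectors.\<close>

lemma independent_E_BC: "independent (E_BC (real r) n y ` {1..n + 1})"
proof (rule independent_familyI)
  fix f assume z: "(\<Sum>k\<in>{1..n + 1}. f k *\<^sub>R E_BC (real r) n y k) = 0"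
  show "\<forall>k\<in>{1..n + 1}. f k = 0"
  proof
    fix k assume k: "k \<in> {1..n + 1}"
    then have "Q k k \<in> S" by (intro Q_in_S) auto
    then have "val f (Q k k) = 0" using lookup_sum_E_BC[of f "Q k k"] unfolding z by simp
    then show "f k = 0" using k r by (auto simp: val_T)
  qed
qed simp

lemma lineality: "lineality_space (groebner_cone emb n m s) = vertex_weights"
  unfolding groebner_cone_eq[OF incompatibility_axioms]
proof (rule lineality_space_eq[where rk = "\<lambda>v. nat (rank v)"])
  show "subspace vertex_weights" by (rule subspace_vertex_weights)
  show "keys u \<subseteq> S" if "u \<in> vertex_weights" for u
    using that by (auto simp: vertex_weights_def)
  show "p = 0" if "p \<in> relations" "\<And>\<mu>. \<mu> \<in> keys p \<Longrightarrow> std \<mu>" for p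
    using that by (rule standard_monomials_independent)
next
  fix v w assume vw: "incompatible n m s v w"
  have SS: "v \<in> S" "w \<in> S" using bad(1,2)[OF vw] .
  obtain qs where qs: "v * w = (\<Sum>ms\<leftarrow>qs. prod_list ms)"
    "\<And>ms. ms \<in> set qs \<Longrightarrow> set ms \<subseteq> S"
    "\<And>ms. ms \<in> set qs \<Longrightarrow> (\<Sum>u\<leftarrow>ms. rank u) < rank v + rank w"
    "\<And>ms f. ms \<in> set qs \<Longrightarrow> (\<Sum>u\<leftarrow>ms. val f u) = val f v + val f w"
    using incompatible_reducible[OF vw] unfolding reducible_def by auto
  define q :: "('f \<Rightarrow>\<^sub>0 nat) \<Rightarrow>\<^sub>0 'k" where "q = (\<Sum>ms\<leftarrow>qs. single (monomial_of ms) 1)"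
  have keys: "\<exists>ms\<in>set qs. \<nu> = monomial_of ms" if "\<nu> \<in> keys q" for \<nu>
    using subsetD[OF keys_sum_list_single that[unfolded q_def]] by auto
  have "pvars q \<subseteq> S"
    using keys qs(2) by (fastforce simp: pvars_def keys_monomial_of)
  moreover have "v * w = peval emb (\<lambda>v. v) q"
  proof -
    have "peval emb (\<lambda>v. v) (\<Sum>ms\<leftarrow>qs. single (monomial_of ms) 1) = (\<Sum>ms\<leftarrow>qs. prod_list ms)" for qs
      by (induction qs) (simp_all add: peval_add peval_single hom_one meval_monomial_of)
    then show ?thesis by (simp add: qs(1) q_def)
  qed
  moreover have "linear_weight (\<lambda>v. nat (rank v)) \<nu> < nat (rank v) + nat (rank w)"
    if \<nu>: "\<nu> \<in> keys q" for \<nu>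
  proof -
    obtain ms where ms: "ms \<in> set qs" "\<nu> = monomial_of ms" using keys[OF \<nu>] by blast
    have "int (\<Sum>u\<leftarrow>ms. nat (rank u)) = (\<Sum>u\<leftarrow>ms. rank u)" if "set ms \<subseteq> S" for ms
      using that by (induction ms) (auto simp: rank_nonneg)
    from this[OF qs(2)[OF ms(1)]] have "int (\<Sum>u\<leftarrow>ms. nat (rank u)) < int (nat (rank v) + nat (rank w))"
      using qs(3)[OF ms(1)] rank_nonneg SS by simp
    then show ?thesis unfolding ms(2) linear_weight_monomial_of by (simp only: of_nat_less_iff)
  qed
  moreover have "weight u \<nu> = weight u (single v 1 + single w 1)"
    if \<nu>: "\<nu> \<in> keys q" and u: "u \<in> vertex_weights" for \<nu> u
  proof -
    obtain ms where ms: "ms \<in> set qs" "\<nu> = monomial_of ms" using keys[OF \<nu>] by blast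
    obtain f where f: "\<And>v. v \<in> S \<Longrightarrow> lookup u v = val f v"
      using u unfolding vertex_weights_def by blast
    have "(\<Sum>x\<leftarrow>ms. lookup u x) = (\<Sum>x\<leftarrow>ms. val f x)"
      by (rule arg_cong[where f = sum_list], rule map_cong[OF refl]) (use qs(2)[OF ms(1)] f in auto)
    then show ?thesis
      unfolding ms(2) weight_eq linear_weight_monomial_of qs(4)[OF ms(1)] by (simp add: f SS)
  qed
  ultimately show "\<exists>q. pvars q \<subseteq> S \<and> v * w = peval emb (\<lambda>v. v) q \<and>
      (\<forall>\<nu>\<in>keys q. linear_weight (\<lambda>v. nat (rank v)) \<nu> < nat (rank v) + nat (rank w) \<and>
        (\<forall>u\<in>vertex_weights. weight u \<nu> = weight u (single v 1 + single w 1)))"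
    by (intro exI[of _ q]) simp
next
  fix \<omega> :: "'f \<Rightarrow>\<^sub>0 real"
  assume keys: "keys \<omega> \<subseteq> S"
    and eq: "\<And>v w q \<nu>. incompatible n m s v w \<Longrightarrow> pvars q \<subseteq> S \<Longrightarrow> v * w = peval emb (\<lambda>v. v) q \<Longrightarrow>
        (\<And>\<mu>. \<mu> \<in> keys q \<Longrightarrow> std \<mu>) \<Longrightarrow> \<nu> \<in> keys q \<Longrightarrow>
        weight \<omega> \<nu> = weight \<omega> (single v 1 + single w 1)"
  let ?w = "lookup \<omega>"
  define f where "f i = ?w (Q i i) / real r" for i
  have r_pos: "real r > 0" using r by auto
  \<comment> \<open>The relations between two diameters are enough: their right-hand sides consist
    of powers of single variables, which are standard, and each arc that is not a diameter occurs
    there. The weights of the diameters thus determine all others.\<close>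
  have rel: "real r * ?w (P i j) = ?w (Q i i) + ?w (Q j j)" "real r * ?w (Q i j) = ?w (Q i i) + ?w (Q j j)"
    if ij: "1 \<le> i" "i < j" "j \<le> h" for i j
  proof -
    let ?q = "pvar (P i j) ^ r + pvar (Q i j) ^ r :: ('f \<Rightarrow>\<^sub>0 nat) \<Rightarrow>\<^sub>0 'k"
    have K: "keys ?q = {single (P i j) r, single (Q i j) r}"
      unfolding pvar_power keys_two_terms ..
    have inc: "incompatible n m s (Q i i) (Q j j)"
      using ij by (subst incompatible_QQ) auto
    have pv: "pvars ?q \<subseteq> S"
      using ij by (intro pvars_addI pvars_power pvars_pvarI P_in_S Q_in_S) auto
    have ev: "Q i i * Q j j = peval emb (\<lambda>v. v) ?q"
      using exchange_diameters[OF ij] by (simp add: peval_add peval_power)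
    have st: "std \<kappa>" if "\<kappa> \<in> keys ?q" for \<kappa>
      using that bad(3) unfolding K by (auto simp: std_def split: if_splits)
    from eq[OF inc pv ev st, of "single (P i j) r"] eq[OF inc pv ev st, of "single (Q i j) r"]
    show "real r * ?w (P i j) = ?w (Q i i) + ?w (Q j j)" "real r * ?w (Q i j) = ?w (Q i i) + ?w (Q j j)"
      unfolding K weight_eq by simp_all
  qed
  have "?w v = val f v" if "v \<in> S" for v
    using that
  proof (cases rule: S_cases)
    case (P i j)
    then show ?thesis using rel(1)[OF P(1-3)] r_pos by (simp add: val_P f_def field_simps)
  next
    case (Q i j)
    show ?thesis
    proof (cases "i = j")
      case True
      then show ?thesis using Q val_T[of i f] r_pos by (simp add: f_def)
    next
      case False
      then have ij: "1 \<le> i" "i < j" "j \<le> h" using Q by auto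
      show ?thesis unfolding Q(4) val_Q[OF ij] using rel(2)[OF ij] r_pos by (simp add: f_def field_simps)
    qed
  qed
  then show "\<omega> \<in> vertex_weights" using keys unfolding vertex_weights_def by blast
qed

theorem basis_BC: "is_basis (E_BC (real r) n y ` {1..n + 1}) (lineality_space (groebner_cone emb n m s))"
  unfolding is_basis_def lineality using independent_E_BC span_E_BC by simp

end

theorem proposition5p1p1:
  fixes emb :: "'k::field_char_0 \<Rightarrow> 'f::field"
    and n m :: nat
    and s :: "'f seed"
    and x :: "nat set \<Rightarrow> 'f"
    and y :: "nat set set \<Rightarrow> 'f"
  assumes "field_embedding emb"
  shows "(1 \<le> n \<and> polygon_model_A emb n m s x \<longrightarrow>
            is_basis (K_A n x) (lineality_space (groebner_cone emb n m s))) \<and>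
         (2 \<le> n \<and> polygon_model_B emb n m s y \<longrightarrow>
            is_basis (K_B n y) (lineality_space (groebner_cone emb n m s))) \<and>
         (2 \<le> n \<and> polygon_model_C emb n m s y \<longrightarrow>
            is_basis (K_C n y) (lineality_space (groebner_cone emb n m s)))"
proof (intro conjI impI; elim conjE)
  assume "1 \<le> n" "polygon_model_A emb n m s x"
  then interpret type_A_model emb n m s x using assms by unfold_locales
  show "is_basis (K_A n x) (lineality_space (groebner_cone emb n m s))" by (rule basis_A)
next
  assume "2 \<le> n" "polygon_model_B emb n m s y"
  then interpret type_BC_model emb n m s y 1 cartan_B
    using assms by unfold_locales (simp_all add: polygon_model_B_def)
  show "is_basis (K_B n y) (lineality_space (groebner_cone emb n m s))"
    using basis_BC by (simp add: K_B_def)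
next
  assume "2 \<le> n" "polygon_model_C emb n m s y"
  then interpret type_BC_model emb n m s y 2 cartan_C
    using assms by unfold_locales (simp_all add: polygon_model_C_def)
  show "is_basis (K_C n y) (lineality_space (groebner_cone emb n m s))"
    using basis_BC by (simp add: K_C_def)
qed

end
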